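(* Let $\mathbb{K}$ be a field of characteristic zero and let $(C,\Delta)$ be a locally conilpotent cocommutative (coassociative) graded coalgebra over $\mathbb{K}$. Then the cobar construction $\mathcal{L}(C)$ associated to $(C,\Delta)$ is a semifree DG-Lie algebra, i.e. the initial map $0\to\mathcal{L}(C)$ is a semifree extension.
   Context: Graded vector spaces are $\mathbb{Z}$-graded over $\mathbb{K}$, differentials have degree $+1$, and $\overline{x}$ denotes the degree of a homogeneous element $x$. A coassociative graded coalgebra is a graded vector space $C$ with a morphism of graded vector spaces $\Delta\colon C\to C\otimes C$ satisfying $(\Delta\otimes \operatorname{Id}_C)\Delta=(\operatorname{Id}_C\otimes\Delta)\Delta$. It is cocommutative if $\operatorname{tw}\circ\Delta=\Delta$, where $\operatorname{tw}(x\otimes y)=(-1)^{\overline{x}\,\overline{y}}y\otimes x$. The iterated coproducts $\Delta^n\colon C\to C^{\otimes n+1}$ are $\Delta^0=\operatorname{Id}$ and $\Delta^n=(\operatorname{Id}\otimes\Delta^{n-1})\Delta$. The coalgebra is locally conilpotent if $C=\bigcup_n\ker\Delta^n$. For a graded vector space $V$, $\mathbb{L}(V)$ is the free graded Lie algebra on $V$ (the smallest graded Lie subalgebra containing $V$ of the tensor algebra $T(V)$ with the graded commutator bracket). Cobar construction: let $s\colon C\to C[-1]$ be the suspension (so $\overline{sx}=\overline{x}+1$). $\mathcal{L}(C)$ is the DG-Lie algebra whose underlying graded Lie algebra is $\mathbb{L}(C[-1])$, with differential determined by the Leibniz rule and $$d(sx)=\frac12\sum_i(-1)^{\overline{x_i}}[sx_i,sx_i']\quad\text{for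 } x\in C \text{ with } \Delta(x)=\sum_i x_i\otimes x_i'.$$ Elementary semifree extension: a morphism of DG-Lie algebras $f\colon A \to B$ such that there are a graded vector space $V$ and an isomorphism of graded Lie algebras from $B$ to the coproduct of graded Lie algebras $A \amalg \mathbb{L}(V)$, under which $f$ is identified with the inclusion $A \to A \amalg \mathbb{L}(V)$, and such that the differential $d$ induced on $A \amalg \mathbb{L}(V)$ by this isomorphism satisfies $dV \subseteq A$. Semifree extension: a countable composition of elementary semifree extensions, i.e. the canonical map $A_0 \to \operatorname{colim}_n A_n$ for a sequence $A_0 \to A_1 \to A_2 \to \cdots$ of elementary semifree extensions (finite compositions are included). *)

theory Defs
  imports "HOL-Algebra.Module" "HOL-Algebra.QuotRing" "HOL-Library.Poly_Mapping"
begin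

section \<open>Graded vector spaces\<close>

definition scalars :: "'k::field_char_0 ring" where
  "scalars = \<lparr>carrier = UNIV, mult = (*), one = 1, zero = 0, add = (+)\<rparr>"

text \<open>
  Vector spaces over the field \<^typ>\<open>'k\<close> are modules in the sense of HOL-Algebra over
  \<^const>\<open>scalars\<close>. The record fields \<^const>\<open>mult\<close> and \<^const>\<open>one\<close> that the library's record
  carries along play a role for the tensor algebra only.
\<close>

record ('k, 'a) graded_space = "('k, 'a) module" +
  grade :: "int \<Rightarrow> 'a set"

definition is_decomposition ::
    "('k, 'a, 'm) graded_space_scheme \<Rightarrow> 'a \<Rightarrow> (int \<Rightarrow> 'a) \<Rightarrow> bool" where
  "is_decomposition V x f \<longleftrightarrow>
     (\<forall>n. f n \<in> grade V n) \<and> finite {n. f n \<noteq> \<zero>\<^bsub>V\<^esub>} \<and>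
     x = (\<Oplus>\<^bsub>V\<^esub>n\<in>{n. f n \<noteq> \<zero>\<^bsub>V\<^esub>}. f n)"

definition homog_component :: "('k, 'a, 'm) graded_space_scheme \<Rightarrow> int \<Rightarrow> 'a \<Rightarrow> 'a" where
  "homog_component V n x = (THE f. is_decomposition V x f) n"

locale graded_space = module "scalars :: 'k::field_char_0 ring" V
  for V :: "('k::field_char_0, 'a, 'm) graded_space_scheme" (structure) +
  assumes grade_submodule: "submodule (grade V n) (scalars :: 'k ring) V"
    and direct_sum_decomposition: "x \<in> carrier V \<Longrightarrow> \<exists>!f. is_decomposition V x f"

definition linear_map ::
    "('k, 'a, 'm) module_scheme \<Rightarrow> ('k, 'b, 'n) module_scheme \<Rightarrow> ('a \<Rightarrow> 'b) \<Rightarrow> bool" where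
  "linear_map V W h \<longleftrightarrow> h \<in> carrier V \<rightarrow> carrier W \<and>
     (\<forall>x\<in>carrier V. \<forall>y\<in>carrier V. h (x \<oplus>\<^bsub>V\<^esub> y) = h x \<oplus>\<^bsub>W\<^esub> h y) \<and>
     (\<forall>c. \<forall>x\<in>carrier V. h (c \<odot>\<^bsub>V\<^esub> x) = c \<odot>\<^bsub>W\<^esub> h x)"

definition graded_map :: "int \<Rightarrow> ('k, 'a, 'm) graded_space_scheme \<Rightarrow>
    ('k, 'b, 'n) graded_space_scheme \<Rightarrow> ('a \<Rightarrow> 'b) \<Rightarrow> bool" where
  "graded_map k V W h \<longleftrightarrow> linear_map V W h \<and> (\<forall>n. h ` grade V n \<subseteq> grade W (n + k))"

text \<open>The suspension \<open>V[-1]\<close> has the same elements as \<open>V\<close>, and the map \<open>s\<close> is the identity on them.\<close>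

definition suspension :: "('k, 'a) graded_space \<Rightarrow> ('k, 'a) graded_space" where
  "suspension V = V\<lparr>grade := \<lambda>n. grade V (n - 1)\<rparr>"

definition direct_sum :: "('k, 'a, 'm) graded_space_scheme \<Rightarrow> ('k, 'b, 'n) graded_space_scheme \<Rightarrow>
    ('k, 'a \<times> 'b) graded_space" where
  "direct_sum V W =
     \<lparr>carrier = carrier V \<times> carrier W, mult = undefined, one = undefined,
      zero = (\<zero>\<^bsub>V\<^esub>, \<zero>\<^bsub>W\<^esub>),
      add = (\<lambda>(v, w) (v', w'). (v \<oplus>\<^bsub>V\<^esub> v', w \<oplus>\<^bsub>W\<^esub> w')),
      smult = (\<lambda>c (v, w). (c \<odot>\<^bsub>V\<^esub> v, c \<odot>\<^bsub>W\<^esub> w)),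
      grade = (\<lambda>n. grade V n \<times> grade W n)\<rparr>"

definition koszul_sign :: "int \<Rightarrow> 'k::field_char_0" where
  "koszul_sign n = (if even n then 1 else - 1)"


section \<open>The tensor algebra\<close>

text \<open>
  Lists with concatenation are the free monoid, so that the finitely supported functions
  \<open>'a list \<Rightarrow>\<^sub>0 'k\<close> with their library multiplication are the free associative unital algebra on \<open>'a\<close>.
\<close>

instantiation list :: (type) monoid_add
begin

definition zero_list :: "'a list" where "zero_list = []"

definition plus_list :: "'a list \<Rightarrow> 'a list \<Rightarrow> 'a list" where "plus_list = (@)"

instance
  by standard (simp_all add: zero_list_def plus_list_def)

end

definition free_algebra :: "'a set \<Rightarrow> ('a list \<Rightarrow>\<^sub>0 'k::field_char_0) ring" where
  "free_algebra X =
     \<lparr>carrier = {p. Poly_Mapping.keys p \<subseteq> lists X}, mult = (*), one = 1, zero = 0, add = (+)\<rparr>"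

definition letter :: "'a \<Rightarrow> 'a list \<Rightarrow>\<^sub>0 'k::field_char_0" where
  "letter x = Poly_Mapping.single [x] 1"

definition const_poly :: "'k \<Rightarrow> 'a list \<Rightarrow>\<^sub>0 'k::field_char_0" where
  "const_poly c = Poly_Mapping.single [] c"

definition linearity_relations ::
    "('k::field_char_0, 'a, 'm) graded_space_scheme \<Rightarrow> ('a list \<Rightarrow>\<^sub>0 'k) set" where
  "linearity_relations V =
     {letter (x \<oplus>\<^bsub>V\<^esub> y) - letter x - letter y | x y. x \<in> carrier V \<and> y \<in> carrier V} \<union>
     {letter (c \<odot>\<^bsub>V\<^esub> x) - const_poly c * letter x | c x. x \<in> carrier V}"

definition tensor_ideal ::
    "('k::field_char_0, 'a, 'm) graded_space_scheme \<Rightarrow> ('a list \<Rightarrow>\<^sub>0 'k) set" where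
  "tensor_ideal V = Idl\<^bsub>free_algebra (carrier V)\<^esub> (linearity_relations V)"

definition tensor_class ::
    "('k::field_char_0, 'a, 'm) graded_space_scheme \<Rightarrow> ('a list \<Rightarrow>\<^sub>0 'k) \<Rightarrow> ('a list \<Rightarrow>\<^sub>0 'k) set" where
  "tensor_class V p = tensor_ideal V +>\<^bsub>free_algebra (carrier V)\<^esub> p"

definition homog_words :: "('k, 'a, 'm) graded_space_scheme \<Rightarrow> int \<Rightarrow> 'a list set" where
  "homog_words V n = {w. \<exists>ds. list_all2 (\<lambda>x d. x \<in> grade V d) w ds \<and> sum_list ds = n}"

definition tensor_algebra ::
    "('k::field_char_0, 'a, 'm) graded_space_scheme \<Rightarrow> ('k, ('a list \<Rightarrow>\<^sub>0 'k) set) graded_space" where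
  "tensor_algebra V = (let Q = free_algebra (carrier V) Quot tensor_ideal V in
     \<lparr>carrier = carrier Q, mult = mult Q, one = \<one>\<^bsub>Q\<^esub>, zero = \<zero>\<^bsub>Q\<^esub>, add = add Q,
      smult = (\<lambda>c t. tensor_class V (const_poly c) \<otimes>\<^bsub>Q\<^esub> t),
      grade = (\<lambda>n. tensor_class V ` {p. Poly_Mapping.keys p \<subseteq> homog_words V n})\<rparr>)"

definition tensor_inc ::
    "('k::field_char_0, 'a, 'm) graded_space_scheme \<Rightarrow> 'a \<Rightarrow> ('a list \<Rightarrow>\<^sub>0 'k) set" where
  "tensor_inc V x = tensor_class V (letter x)"

definition tensor_power ::
    "('k::field_char_0, 'a, 'm) graded_space_scheme \<Rightarrow> nat \<Rightarrow>
      ('k, ('a list \<Rightarrow>\<^sub>0 'k) set) graded_space" where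
  "tensor_power V m =
     (let P = tensor_class V `
            {p. Poly_Mapping.keys p \<subseteq> {w. w \<in> lists (carrier V) \<and> length w = m}} in
      (tensor_algebra V)\<lparr>carrier := P, grade := \<lambda>n. grade (tensor_algebra V) n \<inter> P\<rparr>)"

abbreviation tensor ::
    "'a \<Rightarrow> ('k::field_char_0, 'a, 'm) graded_space_scheme \<Rightarrow> 'a \<Rightarrow> ('a list \<Rightarrow>\<^sub>0 'k) set" where
  "tensor x V y \<equiv> tensor_inc V x \<otimes>\<^bsub>tensor_algebra V\<^esub> tensor_inc V y"

text \<open>
  The tensor product \<open>f \<otimes> g\<close> of two linear maps from \<open>V\<close> to tensor powers of \<open>V\<close>, as a map on
  \<open>V \<otimes> V\<close>. Only maps of degree 0 are tensored below, so no Koszul sign occurs.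
\<close>

definition tensor_map ::
    "('k::field_char_0, 'a, 'm) graded_space_scheme \<Rightarrow>
      ('a \<Rightarrow> ('a list \<Rightarrow>\<^sub>0 'k) set) \<Rightarrow> ('a \<Rightarrow> ('a list \<Rightarrow>\<^sub>0 'k) set) \<Rightarrow>
      ('a list \<Rightarrow>\<^sub>0 'k) set \<Rightarrow> ('a list \<Rightarrow>\<^sub>0 'k) set" where
  "tensor_map V f g = (THE h.
     h \<in> extensional (carrier (tensor_power V 2)) \<and>
     linear_map (tensor_power V 2) (tensor_algebra V) h \<and>
     (\<forall>x\<in>carrier V. \<forall>y\<in>carrier V. h (tensor x V y) = f x \<otimes>\<^bsub>tensor_algebra V\<^esub> g y))"

definition twist ::
    "('k::field_char_0, 'a, 'm) graded_space_scheme \<Rightarrow>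
      ('a list \<Rightarrow>\<^sub>0 'k) set \<Rightarrow> ('a list \<Rightarrow>\<^sub>0 'k) set" where
  "twist V = (THE h.
     h \<in> extensional (carrier (tensor_power V 2)) \<and>
     linear_map (tensor_power V 2) (tensor_power V 2) h \<and>
     (\<forall>i j. \<forall>x\<in>grade V i. \<forall>y\<in>grade V j.
        h (tensor x V y) = koszul_sign (i * j) \<odot>\<^bsub>tensor_algebra V\<^esub> tensor y V x))"


section \<open>Graded coalgebras\<close>

text \<open>The coproduct \<open>C \<rightarrow> C \<otimes> C\<close> takes its values in the tensors of length two of the tensor algebra.\<close>

locale graded_coalgebra = graded_space C
  for C :: "('k::field_char_0, 'a) graded_space" (structure)
    and \<Delta> :: "'a \<Rightarrow> ('a list \<Rightarrow>\<^sub>0 'k) set" +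
  assumes coproduct_graded_map: "graded_map 0 C (tensor_power C 2) \<Delta>"
    and coassociative: "x \<in> carrier C \<Longrightarrow>
      tensor_map C \<Delta> (tensor_inc C) (\<Delta> x) = tensor_map C (tensor_inc C) \<Delta> (\<Delta> x)"

definition cocommutative ::
    "('k::field_char_0, 'a) graded_space \<Rightarrow> ('a \<Rightarrow> ('a list \<Rightarrow>\<^sub>0 'k) set) \<Rightarrow> bool" where
  "cocommutative C \<Delta> \<longleftrightarrow> (\<forall>x\<in>carrier C. twist C (\<Delta> x) = \<Delta> x)"

primrec iterated_coproduct ::
    "('k::field_char_0, 'a) graded_space \<Rightarrow> ('a \<Rightarrow> ('a list \<Rightarrow>\<^sub>0 'k) set) \<Rightarrow> nat \<Rightarrow>
      'a \<Rightarrow> ('a list \<Rightarrow>\<^sub>0 'k) set" where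
  "iterated_coproduct C \<Delta> 0 = tensor_inc C"
| "iterated_coproduct C \<Delta> (Suc n) =
     (\<lambda>x. tensor_map C (tensor_inc C) (iterated_coproduct C \<Delta> n) (\<Delta> x))"

definition locally_conilpotent ::
    "('k::field_char_0, 'a) graded_space \<Rightarrow> ('a \<Rightarrow> ('a list \<Rightarrow>\<^sub>0 'k) set) \<Rightarrow> bool" where
  "locally_conilpotent C \<Delta> \<longleftrightarrow>
     carrier C = (\<Union>n. {x \<in> carrier C. iterated_coproduct C \<Delta> n x = \<zero>\<^bsub>tensor_algebra C\<^esub>})"


section \<open>Graded Lie algebras and DG-Lie algebras\<close>

record ('k, 'a) graded_lie = "('k, 'a) graded_space" +
  bracket :: "'a \<Rightarrow> 'a \<Rightarrow> 'a"

record ('k, 'a) dg_lie = "('k, 'a) graded_lie" +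
  diff :: "'a \<Rightarrow> 'a"

locale graded_lie_algebra = graded_space L
  for L :: "('k::field_char_0, 'a, 'm) graded_lie_scheme" (structure) +
  assumes bracket_linear_left: "y \<in> carrier L \<Longrightarrow> linear_map L L (\<lambda>x. bracket L x y)"
    and bracket_linear_right: "x \<in> carrier L \<Longrightarrow> linear_map L L (bracket L x)"
    and bracket_grade: "\<lbrakk>x \<in> grade L i; y \<in> grade L j\<rbrakk> \<Longrightarrow> bracket L x y \<in> grade L (i + j)"
    and graded_antisymmetry: "\<lbrakk>x \<in> grade L i; y \<in> grade L j\<rbrakk> \<Longrightarrow>
      bracket L x y = \<ominus> (koszul_sign (i * j) \<odot> bracket L y x)"
    and graded_jacobi: "\<lbrakk>x \<in> grade L i; y \<in> grade L j; z \<in> grade L k\<rbrakk> \<Longrightarrow>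
      bracket L x (bracket L y z) =
        bracket L (bracket L x y) z \<oplus> koszul_sign (i * j) \<odot> bracket L y (bracket L x z)"

definition leibniz :: "('k::field_char_0, 'a, 'm) graded_lie_scheme \<Rightarrow> ('a \<Rightarrow> 'a) \<Rightarrow> bool" where
  "leibniz L d \<longleftrightarrow> (\<forall>i. \<forall>x\<in>grade L i. \<forall>y\<in>carrier L.
     d (bracket L x y) = bracket L (d x) y \<oplus>\<^bsub>L\<^esub> koszul_sign i \<odot>\<^bsub>L\<^esub> bracket L x (d y))"

locale dg_lie_algebra = graded_lie_algebra L
  for L :: "('k::field_char_0, 'a, 'm) dg_lie_scheme" (structure) +
  assumes diff_graded_map: "graded_map 1 L L (diff L)"
    and diff_square: "x \<in> carrier L \<Longrightarrow> diff L (diff L x) = \<zero>"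
    and diff_leibniz: "leibniz L (diff L)"

definition graded_lie_hom :: "('k::field_char_0, 'a, 'm) graded_lie_scheme \<Rightarrow>
    ('k, 'b, 'n) graded_lie_scheme \<Rightarrow> ('a \<Rightarrow> 'b) \<Rightarrow> bool" where
  "graded_lie_hom A B f \<longleftrightarrow> graded_map 0 A B f \<and>
     (\<forall>x\<in>carrier A. \<forall>y\<in>carrier A. f (bracket A x y) = bracket B (f x) (f y))"

definition graded_lie_iso :: "('k::field_char_0, 'a, 'm) graded_lie_scheme \<Rightarrow>
    ('k, 'b, 'n) graded_lie_scheme \<Rightarrow> ('a \<Rightarrow> 'b) \<Rightarrow> bool" where
  "graded_lie_iso A B f \<longleftrightarrow> graded_lie_hom A B f \<and> bij_betw f (carrier A) (carrier B) \<and>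
     (\<forall>n. f ` grade A n = grade B n)"

definition dg_lie_hom :: "('k::field_char_0, 'a, 'm) dg_lie_scheme \<Rightarrow>
    ('k, 'b, 'n) dg_lie_scheme \<Rightarrow> ('a \<Rightarrow> 'b) \<Rightarrow> bool" where
  "dg_lie_hom A B f \<longleftrightarrow> graded_lie_hom A B f \<and> (\<forall>x\<in>carrier A. f (diff A x) = diff B (f x))"

definition dg_lie_iso :: "('k::field_char_0, 'a, 'm) dg_lie_scheme \<Rightarrow>
    ('k, 'b, 'n) dg_lie_scheme \<Rightarrow> ('a \<Rightarrow> 'b) \<Rightarrow> bool" where
  "dg_lie_iso A B f \<longleftrightarrow> graded_lie_iso A B f \<and> dg_lie_hom A B f"


section \<open>Free graded Lie algebras\<close>

text \<open>The bilinear extension of \<open>[a, b] = ab - (-1)\<^sup>i\<^sup>j ba\<close> for \<open>a\<close>, \<open>b\<close> homogeneous of degrees \<open>i\<close>, \<open>j\<close>.\<close>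

definition graded_commutator ::
    "('k::field_char_0, 'a, 'm) graded_space_scheme \<Rightarrow> 'a \<Rightarrow> 'a \<Rightarrow> 'a" where
  "graded_commutator A x y =
     (\<Oplus>\<^bsub>A\<^esub>i\<in>{i. homog_component A i x \<noteq> \<zero>\<^bsub>A\<^esub>}. \<Oplus>\<^bsub>A\<^esub>j\<in>{j. homog_component A j y \<noteq> \<zero>\<^bsub>A\<^esub>}.
        (homog_component A i x \<otimes>\<^bsub>A\<^esub> homog_component A j y)
        \<ominus>\<^bsub>A\<^esub> (koszul_sign (i * j) \<odot>\<^bsub>A\<^esub> (homog_component A j y \<otimes>\<^bsub>A\<^esub> homog_component A i x)))"

definition commutator_lie :: "('k::field_char_0, 'a) graded_space \<Rightarrow> ('k, 'a) graded_lie" where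
  "commutator_lie A = graded_space.extend A \<lparr>bracket = graded_commutator A\<rparr>"

definition graded_lie_subalgebra ::
    "'a set \<Rightarrow> ('k::field_char_0, 'a, 'm) graded_lie_scheme \<Rightarrow> bool" where
  "graded_lie_subalgebra S L \<longleftrightarrow> submodule S (scalars :: 'k ring) L \<and>
     (\<forall>x\<in>S. \<forall>n. homog_component L n x \<in> S) \<and> (\<forall>x\<in>S. \<forall>y\<in>S. bracket L x y \<in> S)"

definition free_lie :: "('k::field_char_0, 'a, 'm) graded_space_scheme \<Rightarrow>
    ('k, ('a list \<Rightarrow>\<^sub>0 'k) set) graded_lie" where
  "free_lie V =
     (let T = commutator_lie (tensor_algebra V);
          S = \<Inter>{S. graded_lie_subalgebra S T \<and> tensor_inc V ` carrier V \<subseteq> S} in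
      T\<lparr>carrier := S, grade := \<lambda>n. grade T n \<inter> S\<rparr>)"


section \<open>Coproducts of graded Lie algebras\<close>

definition graded_lie_ideal ::
    "'a set \<Rightarrow> ('k::field_char_0, 'a, 'm) graded_lie_scheme \<Rightarrow> bool" where
  "graded_lie_ideal I L \<longleftrightarrow> submodule I (scalars :: 'k ring) L \<and>
     (\<forall>x\<in>I. \<forall>n. homog_component L n x \<in> I) \<and>
     (\<forall>x\<in>carrier L. \<forall>y\<in>I. bracket L x y \<in> I \<and> bracket L y x \<in> I)"

definition lie_ideal_generated ::
    "('k::field_char_0, 'a, 'm) graded_lie_scheme \<Rightarrow> 'a set \<Rightarrow> 'a set" where
  "lie_ideal_generated L X = \<Inter>{I. graded_lie_ideal I L \<and> X \<subseteq> I}"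

definition lie_quotient ::
    "('k::field_char_0, 'a) graded_lie \<Rightarrow> 'a set \<Rightarrow> ('k, 'a set) graded_lie" where
  "lie_quotient L I =
     \<lparr>carrier = a_rcosets\<^bsub>L\<^esub> I, mult = undefined, one = undefined,
      zero = I, add = set_add L,
      smult = (\<lambda>c X. \<Union>x\<in>X. I +>\<^bsub>L\<^esub> (c \<odot>\<^bsub>L\<^esub> x)),
      grade = (\<lambda>n. (\<lambda>x. I +>\<^bsub>L\<^esub> x) ` grade L n),
      bracket = (\<lambda>X Y. \<Union>x\<in>X. \<Union>y\<in>Y. I +>\<^bsub>L\<^esub> bracket L x y)\<rparr>"

text \<open>
  The coproduct \<open>A \<amalg> B\<close> is the free graded Lie algebra on the graded vector space \<open>A \<oplus> B\<close>, divided by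
  the relations saying that both summands are included by Lie algebra homomorphisms.
\<close>

definition coproduct_ideal :: "('k::field_char_0, 'a, 'm) graded_lie_scheme \<Rightarrow>
    ('k, 'b, 'n) graded_lie_scheme \<Rightarrow> (('a \<times> 'b) list \<Rightarrow>\<^sub>0 'k) set set" where
  "coproduct_ideal A B =
     (let F = free_lie (direct_sum A B);
          \<alpha> = (\<lambda>a. tensor_inc (direct_sum A B) (a, \<zero>\<^bsub>B\<^esub>));
          \<beta> = (\<lambda>b. tensor_inc (direct_sum A B) (\<zero>\<^bsub>A\<^esub>, b)) in
      lie_ideal_generated F
        ({bracket F (\<alpha> a) (\<alpha> a') \<ominus>\<^bsub>F\<^esub> \<alpha> (bracket A a a') | a a'. a \<in> carrier A \<and> a' \<in> carrier A} \<union>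
         {bracket F (\<beta> b) (\<beta> b') \<ominus>\<^bsub>F\<^esub> \<beta> (bracket B b b') | b b'. b \<in> carrier B \<and> b' \<in> carrier B}))"

definition lie_coproduct :: "('k::field_char_0, 'a, 'm) graded_lie_scheme \<Rightarrow>
    ('k, 'b, 'n) graded_lie_scheme \<Rightarrow> ('k, (('a \<times> 'b) list \<Rightarrow>\<^sub>0 'k) set set) graded_lie" where
  "lie_coproduct A B = lie_quotient (free_lie (direct_sum A B)) (coproduct_ideal A B)"

definition coproduct_inl :: "('k::field_char_0, 'a, 'm) graded_lie_scheme \<Rightarrow>
    ('k, 'b, 'n) graded_lie_scheme \<Rightarrow> 'a \<Rightarrow> (('a \<times> 'b) list \<Rightarrow>\<^sub>0 'k) set set" where
  "coproduct_inl A B a =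
     coproduct_ideal A B +>\<^bsub>free_lie (direct_sum A B)\<^esub> tensor_inc (direct_sum A B) (a, \<zero>\<^bsub>B\<^esub>)"

definition coproduct_inr :: "('k::field_char_0, 'a, 'm) graded_lie_scheme \<Rightarrow>
    ('k, 'b, 'n) graded_lie_scheme \<Rightarrow> 'b \<Rightarrow> (('a \<times> 'b) list \<Rightarrow>\<^sub>0 'k) set set" where
  "coproduct_inr A B b =
     coproduct_ideal A B +>\<^bsub>free_lie (direct_sum A B)\<^esub> tensor_inc (direct_sum A B) (\<zero>\<^bsub>A\<^esub>, b)"


section \<open>Semifree extensions\<close>

text \<open>
  The existentially quantified \<open>V\<close> may be given the element type of \<open>B\<close> without loss of generality,
  since \<open>V\<close> embeds into \<open>A \<amalg> \<L>(V) \<cong> B\<close>.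
\<close>

definition elementary_semifree_extension :: "('k::field_char_0, 'a) dg_lie \<Rightarrow>
    ('k, 'b) dg_lie \<Rightarrow> ('a \<Rightarrow> 'b) \<Rightarrow> bool" where
  "elementary_semifree_extension A B f \<longleftrightarrow>
     dg_lie_algebra A \<and> dg_lie_algebra B \<and> dg_lie_hom A B f \<and>
     (\<exists>(V :: ('k, 'b) graded_space) \<phi>.
        graded_space V \<and>
        graded_lie_iso B (lie_coproduct A (free_lie V)) \<phi> \<and>
        (\<forall>a\<in>carrier A. \<phi> (f a) = coproduct_inl A (free_lie V) a) \<and>
        (\<forall>v\<in>carrier V.
           \<phi> (diff B (inv_into (carrier B) \<phi> (coproduct_inr A (free_lie V) (tensor_inc V v))))
             \<in> coproduct_inl A (free_lie V) ` carrier A))"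

primrec transition :: "(nat \<Rightarrow> 'b \<Rightarrow> 'b) \<Rightarrow> nat \<Rightarrow> nat \<Rightarrow> 'b \<Rightarrow> 'b" where
  "transition i n 0 = id"
| "transition i n (Suc k) = i (n + k) \<circ> transition i n k"

text \<open>
  The colimit of \<open>X 0 \<rightarrow> X 1 \<rightarrow> X 2 \<rightarrow> \<dots>\<close>: the disjoint union, where elements are identified that become
  equal at some later stage, with the induced operations.
\<close>

definition colim_class :: "(nat \<Rightarrow> ('k, 'b) dg_lie) \<Rightarrow> (nat \<Rightarrow> 'b \<Rightarrow> 'b) \<Rightarrow>
    nat \<Rightarrow> 'b \<Rightarrow> (nat \<times> 'b) set" where
  "colim_class X i n x = {(m, y). y \<in> carrier (X m) \<and>
     (\<exists>k l. n + k = m + l \<and> transition i n k x = transition i m l y)}"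

definition colimit :: "(nat \<Rightarrow> ('k, 'b) dg_lie) \<Rightarrow> (nat \<Rightarrow> 'b \<Rightarrow> 'b) \<Rightarrow>
    ('k, (nat \<times> 'b) set) dg_lie" where
  "colimit X i =
     \<lparr>carrier = (\<Union>n. colim_class X i n ` carrier (X n)), mult = undefined, one = undefined,
      zero = colim_class X i 0 \<zero>\<^bsub>X 0\<^esub>,
      add = (\<lambda>P Q. \<Union>{colim_class X i n (x \<oplus>\<^bsub>X n\<^esub> y) | n x y. (n, x) \<in> P \<and> (n, y) \<in> Q}),
      smult = (\<lambda>c P. \<Union>{colim_class X i n (c \<odot>\<^bsub>X n\<^esub> x) | n x. (n, x) \<in> P}),
      grade = (\<lambda>d. \<Union>n. colim_class X i n ` grade (X n) d),
      bracket = (\<lambda>P Q. \<Union>{colim_class X i n (bracket (X n) x y) | n x y. (n, x) \<in> P \<and> (n, y) \<in> Q}),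
      diff = (\<lambda>P. \<Union>{colim_class X i n (diff (X n) x) | n x. (n, x) \<in> P})\<rparr>"

text \<open>
  Elementary semifree extensions are injective, so all stages of the sequence embed into the
  colimit, and their elements may be taken from the type of \<open>B\<close>.
\<close>

definition semifree_extension :: "('k::field_char_0, 'a) dg_lie \<Rightarrow>
    ('k, 'b) dg_lie \<Rightarrow> ('a \<Rightarrow> 'b) \<Rightarrow> bool" where
  "semifree_extension A B f \<longleftrightarrow>
     dg_lie_algebra A \<and> dg_lie_algebra B \<and> dg_lie_hom A B f \<and>
     (\<exists>(X :: nat \<Rightarrow> ('k, 'b) dg_lie) i \<alpha> \<beta>.
        (\<forall>n. elementary_semifree_extension (X n) (X (Suc n)) (i n)) \<and>
        dg_lie_iso A (X 0) \<alpha> \<and> dg_lie_iso (colimit X i) B \<beta> \<and>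
        (\<forall>a\<in>carrier A. f a = \<beta> (colim_class X i 0 (\<alpha> a))))"

definition zero_dg_lie :: "('k, unit) dg_lie" where
  "zero_dg_lie =
     \<lparr>carrier = {()}, mult = (\<lambda>_ _. ()), one = (), zero = (), add = (\<lambda>_ _. ()),
      smult = (\<lambda>_ _. ()), grade = (\<lambda>_. {()}), bracket = (\<lambda>_ _. ()), diff = (\<lambda>_. ())\<rparr>"

definition semifree_dg_lie_algebra :: "('k::field_char_0, 'b) dg_lie \<Rightarrow> bool" where
  "semifree_dg_lie_algebra B \<longleftrightarrow> semifree_extension zero_dg_lie B (\<lambda>_. \<zero>\<^bsub>B\<^esub>)"


section \<open>The cobar construction\<close>

definition cobar_diff ::
    "('k::field_char_0, 'a) graded_space \<Rightarrow> ('a \<Rightarrow> ('a list \<Rightarrow>\<^sub>0 'k) set) \<Rightarrow>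
      ('a list \<Rightarrow>\<^sub>0 'k) set \<Rightarrow> ('a list \<Rightarrow>\<^sub>0 'k) set" where
  "cobar_diff C \<Delta> = (let L = free_lie (suspension C); s = tensor_inc (suspension C) in
     THE d. d \<in> extensional (carrier L) \<and> graded_map 1 L L d \<and> leibniz L d \<and>
       (\<forall>x\<in>carrier C. \<forall>m (y :: nat \<Rightarrow> 'a) (y' :: nat \<Rightarrow> 'a) (e :: nat \<Rightarrow> int) (e' :: nat \<Rightarrow> int).
          (\<forall>r<m. y r \<in> grade C (e r) \<and> y' r \<in> grade C (e' r)) \<and>
          \<Delta> x = (\<Oplus>\<^bsub>tensor_algebra C\<^esub>r\<in>{..<m}. tensor (y r) C (y' r)) \<longrightarrow>
          d (s x) = (1 / 2) \<odot>\<^bsub>L\<^esub>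
            (\<Oplus>\<^bsub>L\<^esub>r\<in>{..<m}. koszul_sign (e r) \<odot>\<^bsub>L\<^esub> bracket L (s (y r)) (s (y' r)))))"

definition cobar :: "('k::field_char_0, 'a) graded_space \<Rightarrow> ('a \<Rightarrow> ('a list \<Rightarrow>\<^sub>0 'k) set) \<Rightarrow>
    ('k, ('a list \<Rightarrow>\<^sub>0 'k) set) dg_lie" where
  "cobar C \<Delta> = graded_lie.extend (free_lie (suspension C)) \<lparr>diff = cobar_diff C \<Delta>\<rparr>"

end

theory Submission
  imports Defs
begin

text \<open>
  Let \<open>L = \<L>(C)\<close> be the free graded Lie algebra on \<open>C[-1]\<close> with the cobar differential. The filtration of
  \<open>C\<close> by the kernels of the iterated coproducts induces a filtration of \<open>L\<close> by graded Lie subalgebras, and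
  each step of it adjoins free generators whose differentials lie in the previous step.

  In detail, choose a homogeneous basis \<open>B\<close> of \<open>C\<close> that is an ascending union of sets \<open>B\<^sub>n\<close>, where \<open>B\<^sub>n\<close>
  is a basis of the span of the homogeneous elements killed by one of \<open>\<Delta>\<^sup>0, \<dots>, \<Delta>\<^sup>n\<close>; local conilpotency
  makes the union a basis of all of \<open>C\<close> (\<open>adapted_basis_exists\<close>). If \<open>\<Delta>\<^sup>m\<^sup>+\<^sup>1 b = 0\<close> and
  \<open>\<Delta> b = \<Sum> c\<^sub>x\<^sub>y x \<otimes> y\<close> in the basis, then \<open>\<Delta>\<^sup>m\<close> kills \<open>\<Sum>\<^sub>y c\<^sub>x\<^sub>y y\<close> for every \<open>x\<close>, because
  \<open>\<Delta>\<^sup>m\<^sup>+\<^sup>1 = (Id \<otimes> \<Delta>\<^sup>m) \<Delta>\<close>. So the second factors that occur in \<open>\<Delta> b\<close>, and by cocommutativity also the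
  first ones, are in \<open>B\<^sub>n\<close> for \<open>b \<in> B\<^sub>n\<^sub>+\<^sub>1\<close> (\<open>cop_conilpotent_part\<close>). Hence \<open>d(sb)\<close> is a combination of
  brackets of elements of \<open>s B\<^sub>n\<close>, and the Lie subalgebras \<open>L\<^sub>n\<close> generated by \<open>s B\<^sub>n\<close> form a sequence of
  DG-Lie algebras with \<open>L\<^sub>0 = 0\<close> and union \<open>L\<close>.

  It remains to see that \<open>L\<^sub>n \<rightarrow> L\<^sub>n\<^sub>+\<^sub>1\<close> is an elementary semifree extension, that is,
  \<open>L\<^sub>n\<^sub>+\<^sub>1 \<cong> L\<^sub>n \<amalg> Lie(V)\<close> for \<open>V\<close> spanned by \<open>s(B\<^sub>n\<^sub>+\<^sub>1 - B\<^sub>n)\<close> (\<open>elementary_extension\<close>). The coproduct is a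
  quotient of the free Lie algebra \<open>F\<close> on \<open>L\<^sub>n \<oplus> Lie(V)\<close>. Linear maps into free Lie algebras extend to
  homomorphisms of free Lie algebras, since they extend to the tensor algebras (\<open>free_lie_extension\<close>).
  This gives \<open>\<psi> : F \<rightarrow> L\<close>, induced by the inclusions of the summands, and \<open>\<chi> : L \<rightarrow> F\<close>, which sends
  \<open>sb\<close> to the corresponding generator in the first or in the second summand. One has \<open>\<psi> \<chi> = id\<close> on
  \<open>L\<^sub>n\<^sub>+\<^sub>1\<close> and \<open>\<chi> \<psi> = id\<close> modulo the relations of the coproduct, as one checks on generators.

  The differential comes from the tensor algebra. For \<open>\<Delta> x = \<Sum> y \<otimes> y'\<close>, and with \<open>(-1)\<^sup>y\<close> for the sign given by the
  degree of \<open>y\<close> in \<open>C\<close>, the two terms of the commutators in \<open>1/2 \<Sum> (-1)\<^sup>y [sy, sy']\<close> contribute equally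
  by cocommutativity, so that \<open>d(sx) = \<Sum> (-1)\<^sup>y sy \<otimes> sy'\<close> there (\<open>\<delta>_formula\<close>), and \<open>d\<^sup>2 = 0\<close> follows from
  coassociativity (\<open>DP_D1\<close>).

  All calculations take place in the free associative algebra on a homogeneous basis, realized by
  finitely supported functions on words. Every graded space has a homogeneous basis, and the map
  \<open>\<nu>\<close> that expands tensors in it identifies the quotient by the linearity relations with a subalgebra of
  the type \<open>'a list \<Rightarrow>\<^sub>0 'k\<close>, in which ring identities hold without side conditions.
\<close>

section \<open>Free vector spaces\<close>

abbreviation "keys \<equiv> Poly_Mapping.keys"
abbreviation "lookup \<equiv> Poly_Mapping.lookup"
abbreviation "single \<equiv> Poly_Mapping.single"

definition scl :: "'k::field_char_0 \<Rightarrow> ('x \<Rightarrow>\<^sub>0 'k) \<Rightarrow> 'x \<Rightarrow>\<^sub>0 'k" where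
  "scl c p = Poly_Mapping.map ((*) c) p"

lemma lookup_scl [simp]: "lookup (scl c p) x = c * lookup p x"
  by (auto simp: scl_def Poly_Mapping.map.rep_eq when_def)

lemma keys_scl: "keys (scl c p) \<subseteq> keys p"
  by (auto simp: in_keys_iff)

lemma scl_add_right: "scl c (p + q) = scl c p + scl c q"
  by (rule poly_mapping_eqI) (simp add: lookup_add algebra_simps)

lemma scl_add_left: "scl (c + d) p = scl c p + scl d p"
  by (rule poly_mapping_eqI) (simp add: lookup_add algebra_simps)

lemma scl_scl [simp]: "scl c (scl d p) = scl (c * d) p"
  by (rule poly_mapping_eqI) simp

lemma scl_one [simp]: "scl 1 p = p"
  by (rule poly_mapping_eqI) simp

lemma scl_minus_one: "scl (- 1) p = - p"
  by (rule poly_mapping_eqI) simp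

lemma scl_zero_left [simp]: "scl 0 p = 0"
  by (rule poly_mapping_eqI) simp

lemma scl_zero_right [simp]: "scl c 0 = 0"
  by (rule poly_mapping_eqI) simp

lemma scl_minus_right [simp]: "scl c (- p) = - scl c p"
  by (rule poly_mapping_eqI) simp

lemma scl_minus_left [simp]: "scl (- c) p = - scl c p"
  by (rule poly_mapping_eqI) simp

lemma scl_diff_right: "scl c (p - q) = scl c p - scl c q"
  by (rule poly_mapping_eqI) (simp add: lookup_minus algebra_simps)

lemma scl_sum: "scl c (sum f A) = (\<Sum>a\<in>A. scl c (f a))"
  by (induction A rule: infinite_finite_induct) (simp_all add: scl_add_right)

lemma scl_single [simp]: "scl c (single x d) = single x (c * d)"
  by (rule poly_mapping_eqI) (simp add: lookup_single when_def)

lemma poly_mapping_monomials: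
  fixes p :: "'x \<Rightarrow>\<^sub>0 'k::field_char_0"
  shows "(\<Sum>x\<in>keys p. single x (lookup p x)) = p"
  by (rule poly_mapping_eqI) (auto simp: lookup_sum lookup_single when_def in_keys_iff)

lemma poly_mapping_linear_induct [consumes 1, case_names zero single add]:
  fixes p :: "'x \<Rightarrow>\<^sub>0 'k::field_char_0"
  assumes keys: "keys p \<subseteq> A"
    and zero: "P 0"
    and single: "\<And>x c. x \<in> A \<Longrightarrow> P (single x c)"
    and add: "\<And>p q. keys p \<subseteq> A \<Longrightarrow> keys q \<subseteq> A \<Longrightarrow> P p \<Longrightarrow> P q \<Longrightarrow> P (p + q)"
  shows "P p"
proof -
  have "P (\<Sum>x\<in>X. single x (lookup p x)) \<and>
      keys (\<Sum>x\<in>X. single x (lookup p x)) \<subseteq> A" if "finite X" "X \<subseteq> A" for X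
    using that
  proof (induction X)
    case (insert x X)
    have k: "keys (single x (lookup p x)) \<subseteq> A" using insert by simp
    show ?case using insert add[OF k] single[of x] k
      by (simp del: keys_single) (meson keys_add order_trans Un_least)
  qed (simp add: zero)
  from this[of "keys p"] show ?thesis using keys by (simp add: poly_mapping_monomials)
qed

text \<open>
  Finitely supported functions are the free vector space on their index type. Linear maps between such
  spaces are determined by their values on the indices, and \<open>lin\<close> below constructs them from these values.
\<close>

definition linear_pm :: "(('x \<Rightarrow>\<^sub>0 'k::field_char_0) \<Rightarrow> ('y \<Rightarrow>\<^sub>0 'k)) \<Rightarrow> bool" where
  "linear_pm h \<longleftrightarrow> (\<forall>p q. h (p + q) = h p + h q) \<and> (\<forall>c p. h (scl c p) = scl c (h p))"

lemma linear_pmI: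
  "(\<And>p q. h (p + q) = h p + h q) \<Longrightarrow> (\<And>c p. h (scl c p) = scl c (h p)) \<Longrightarrow> linear_pm h"
  by (simp add: linear_pm_def)

lemma linear_pm_add: "linear_pm h \<Longrightarrow> h (p + q) = h p + h q"
  and linear_pm_scl: "linear_pm h \<Longrightarrow> h (scl c p) = scl c (h p)"
  by (simp_all add: linear_pm_def)

lemma linear_pm_zero: "linear_pm h \<Longrightarrow> h 0 = 0"
  using linear_pm_scl[of h 0 0] by simp

lemma linear_pm_minus: "linear_pm h \<Longrightarrow> h (- p) = - h p"
  using linear_pm_scl[of h "- 1" p] by simp

lemma linear_pm_diff: "linear_pm h \<Longrightarrow> h (p - q) = h p - h q"
  using linear_pm_add[of h p "- q"] linear_pm_minus[of h q] by simp

lemma linear_pm_sum: "linear_pm h \<Longrightarrow> h (sum f A) = (\<Sum>a\<in>A. h (f a))"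
  by (induction A rule: infinite_finite_induct) (simp_all add: linear_pm_zero linear_pm_add)

lemma linear_pm_eqI:
  assumes "linear_pm h" "linear_pm h'" "keys p \<subseteq> A"
    and "\<And>x. x \<in> A \<Longrightarrow> h (single x 1) = h' (single x 1)"
  shows "h p = h' p"
  using assms(3)
proof (induction rule: poly_mapping_linear_induct)
  case (single x c)
  have "single x c = scl c (single x 1)" by simp
  then show ?case using assms single linear_pm_scl[of h c "Poly_Mapping.single x 1"] linear_pm_scl[of h' c "Poly_Mapping.single x 1"] by simp
qed (simp_all add: assms linear_pm_zero linear_pm_add)

lemma linear_pm_comp: "linear_pm h \<Longrightarrow> linear_pm g \<Longrightarrow> linear_pm (\<lambda>p. h (g p))"
  by (simp add: linear_pm_def)

lemma linear_pm_minus': "linear_pm h \<Longrightarrow> linear_pm g \<Longrightarrow> linear_pm (\<lambda>p. h p - g p)"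
  by (simp add: linear_pm_def scl_diff_right)

lemma linear_pm_scl': "linear_pm h \<Longrightarrow> linear_pm (\<lambda>p. scl c (h p))"
  by (simp add: linear_pm_def scl_add_right mult.commute)

lemma linear_pm_id: "linear_pm (\<lambda>p. p)"
  and linear_pm_const_zero: "linear_pm (\<lambda>p. 0)"
  by (simp_all add: linear_pm_def)

definition lin :: "('x \<Rightarrow> ('y \<Rightarrow>\<^sub>0 'k::field_char_0)) \<Rightarrow> ('x \<Rightarrow>\<^sub>0 'k) \<Rightarrow> ('y \<Rightarrow>\<^sub>0 'k)" where
  "lin f p = (\<Sum>x\<in>keys p. scl (lookup p x) (f x))"

lemma lin_superset: "finite A \<Longrightarrow> keys p \<subseteq> A \<Longrightarrow> lin f p = (\<Sum>x\<in>A. scl (lookup p x) (f x))"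
  unfolding lin_def by (rule sum.mono_neutral_left) (auto simp: in_keys_iff)

lemma linear_pm_lin [simp]: "linear_pm (lin f)"
proof (rule linear_pmI)
  fix p q :: "'a \<Rightarrow>\<^sub>0 'b"
  let ?A = "keys p \<union> keys q"
  have "lin f (p + q) = (\<Sum>x\<in>?A. scl (lookup (p + q) x) (f x))"
    by (rule lin_superset) (auto simp: keys_add)
  also have "\<dots> = lin f p + lin f q"
    by (simp add: lin_superset[of ?A] lookup_add scl_add_left sum.distrib)
  finally show "lin f (p + q) = lin f p + lin f q" .
next
  fix c and p :: "'a \<Rightarrow>\<^sub>0 'b"
  have "lin f (scl c p) = (\<Sum>x\<in>keys p. scl (lookup (scl c p) x) (f x))"
    by (rule lin_superset) (auto simp: keys_scl)
  then show "lin f (scl c p) = scl c (lin f p)" by (simp add: lin_def scl_sum)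
qed

lemmas lin_add = linear_pm_add[OF linear_pm_lin]
  and lin_scl = linear_pm_scl[OF linear_pm_lin]
  and lin_zero [simp] = linear_pm_zero[OF linear_pm_lin]
  and lin_sum = linear_pm_sum[OF linear_pm_lin]

lemma lin_single [simp]: "lin f (single x c) = scl c (f x)"
  by (simp add: lin_def)

lemma lin_eq: "linear_pm h \<Longrightarrow> (\<And>x. x \<in> keys p \<Longrightarrow> h (single x 1) = f x) \<Longrightarrow> h p = lin f p"
  by (rule linear_pm_eqI[of h "lin f" p "keys p"]) auto

lemma lin_cong: "(\<And>x. x \<in> keys p \<Longrightarrow> f x = g x) \<Longrightarrow> lin f p = lin g p"
  by (simp add: lin_def)

lemma linear_pm_lin_arg: "(\<And>x. linear_pm (\<lambda>q. f q x)) \<Longrightarrow> linear_pm (\<lambda>q. lin (f q) p)"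
  by (simp add: linear_pm_def lin_def scl_add_right sum.distrib scl_sum mult.commute)

lemma keys_lin: "keys (lin f p) \<subseteq> (\<Union>x\<in>keys p. keys (f x))"
proof -
  have "keys (\<Sum>x\<in>X. scl (lookup p x) (f x)) \<subseteq> (\<Union>x\<in>X. keys (f x))" if "finite X" for X
    using that
  proof induction
    case (insert x X)
    then show ?case
      using keys_add[of "scl (lookup p x) (f x)" "\<Sum>x\<in>X. scl (lookup p x) (f x)"]
        keys_scl[of "lookup p x" "f x"] by (simp add: subset_iff) blast
  qed simp
  then show ?thesis by (simp add: lin_def)
qed

lemma keys_lin_subset: "(\<And>x. x \<in> keys p \<Longrightarrow> keys (f x) \<subseteq> A) \<Longrightarrow> keys (lin f p) \<subseteq> A"
  using keys_lin[of f p] by blast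

definition filt :: "'x set \<Rightarrow> ('x \<Rightarrow>\<^sub>0 'k::field_char_0) \<Rightarrow> ('x \<Rightarrow>\<^sub>0 'k)" where
  "filt A p = Poly_Mapping.mapp (\<lambda>x c. c when x \<in> A) p"

lemma lookup_filt [simp]: "lookup (filt A p) x = (if x \<in> A then lookup p x else 0)"
  by (auto simp: filt_def lookup_mapp when_def in_keys_iff)

lemma linear_pm_filt [simp]: "linear_pm (filt A)"
  by (auto intro!: linear_pmI poly_mapping_eqI simp: lookup_add)

lemma keys_filt [simp]: "keys (filt A p) = keys p \<inter> A"
  by (auto simp: in_keys_iff split: if_splits)

lemma filt_id: "keys p \<subseteq> A \<Longrightarrow> filt A p = p"
  by (rule poly_mapping_eqI) (auto simp: in_keys_iff)

lemma filt_zero: "keys p \<inter> A = {} \<Longrightarrow> filt A p = 0"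
  by (rule poly_mapping_eqI) (auto simp: in_keys_iff)

section \<open>The free algebra on graded letters\<close>

lemma koszul_sign_add: "koszul_sign (m + n) = (koszul_sign m * koszul_sign n :: 'k::field_char_0)"
  by (auto simp: koszul_sign_def)

lemma koszul_sign_square [simp]: "koszul_sign n * koszul_sign n = (1 :: 'k::field_char_0)"
  by (auto simp: koszul_sign_def)

lemma koszul_sign_zero [simp]: "koszul_sign 0 = (1 :: 'k::field_char_0)"
  by (auto simp: koszul_sign_def)

lemma koszul_sign_square_left [simp]: "koszul_sign n * (koszul_sign n * a) = (a :: 'k::field_char_0)"
  by (auto simp: koszul_sign_def)

lemma scl_koszul_sign: "scl (koszul_sign n) p = (if even n then p else - p)"
  by (simp add: koszul_sign_def scl_minus_one)

lemma single_mult [simp]: "single u a * single v b = single (u @ v) (a * b)"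
  by (simp add: mult_single plus_list_def)

lemma single_Nil [simp]: "single ([] :: 'x list) 1 = 1"
  using single_one[where ?'a = "'x list"] by (simp add: zero_list_def)

lemma scl_eq_mult: "scl c p = const_poly c * p"
  by (simp add: scl_def const_poly_def mult_map_scale_conv_mult zero_list_def)

lemma scl_mult_left [simp]:
  fixes p q :: "'a list \<Rightarrow>\<^sub>0 'k::field_char_0"
  shows "scl c p * q = scl c (p * q)"
  by (simp add: scl_eq_mult mult.assoc)

lemma scl_mult_right [simp]:
  fixes p q :: "'a list \<Rightarrow>\<^sub>0 'k::field_char_0"
  shows "p * scl c q = scl c (p * q)"
proof -
  have "p * const_poly c = const_poly c * p"
    using subset_UNIV by (induction p rule: poly_mapping_linear_induct)
      (simp_all add: const_poly_def mult.commute distrib_left distrib_right)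
  then show ?thesis by (simp add: scl_eq_mult flip: mult.assoc)
qed

lemma linear_pm_mult_left [simp]: "linear_pm (\<lambda>p. p * q)"
  and linear_pm_mult_right [simp]: "linear_pm (\<lambda>p. q * (p :: 'a list \<Rightarrow>\<^sub>0 'k::field_char_0))"
  by (simp_all add: linear_pm_def distrib_left distrib_right)

definition word_degree :: "('a \<Rightarrow> int) \<Rightarrow> 'a list \<Rightarrow> int" where
  "word_degree d w = sum_list (map d w)"

lemma word_degree_simps [simp]:
  "word_degree d [] = 0" "word_degree d (x # w) = d x + word_degree d w"
  "word_degree d (u @ v) = word_degree d u + word_degree d v"
  by (simp_all add: word_degree_def)

definition homogeneous :: "('a \<Rightarrow> int) \<Rightarrow> int \<Rightarrow> ('a list \<Rightarrow>\<^sub>0 'k::field_char_0) \<Rightarrow> bool" where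
  "homogeneous d n p \<longleftrightarrow> keys p \<subseteq> {w. word_degree d w = n}"

abbreviation component :: "('a \<Rightarrow> int) \<Rightarrow> int \<Rightarrow> ('a list \<Rightarrow>\<^sub>0 'k::field_char_0) \<Rightarrow> 'a list \<Rightarrow>\<^sub>0 'k" where
  "component d n \<equiv> filt {w. word_degree d w = n}"

lemma homogeneous_zero [simp]: "homogeneous d n 0"
  and homogeneous_add: "homogeneous d n p \<Longrightarrow> homogeneous d n q \<Longrightarrow> homogeneous d n (p + q)"
  and homogeneous_scl: "homogeneous d n p \<Longrightarrow> homogeneous d n (scl c p)"
  and homogeneous_single: "homogeneous d (word_degree d w) (single w c)"
  and homogeneous_component: "homogeneous d n (component d n r)"
  using keys_add[of p q] keys_scl[of c p] by (auto simp: homogeneous_def)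

lemma homogeneous_diff: "homogeneous d n p \<Longrightarrow> homogeneous d n q \<Longrightarrow> homogeneous d n (p - q)"
  using keys_diff[of p q] by (auto simp: homogeneous_def)

lemma homogeneous_lin: "(\<And>x. x \<in> keys p \<Longrightarrow> homogeneous d n (f x)) \<Longrightarrow> homogeneous d n (lin f p)"
  unfolding homogeneous_def by (rule keys_lin_subset)

lemma homogeneous_mult: "homogeneous d m p \<Longrightarrow> homogeneous d n q \<Longrightarrow> homogeneous d (m + n) (p * q)"
  using keys_mult[of p q] by (force simp: homogeneous_def plus_list_def)

lemma component_homogeneous: "homogeneous d n p \<Longrightarrow> component d m p = (if m = n then p else 0)"
  by (auto simp: homogeneous_def intro!: filt_id filt_zero)

lemma component_sum:
  assumes "finite A" "\<And>w. w \<in> keys p \<Longrightarrow> word_degree d w \<in> A"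
  shows "(\<Sum>n\<in>A. component d n p) = p"
  by (rule poly_mapping_eqI) (use assms in \<open>auto simp: lookup_sum sum.delta' in_keys_iff\<close>)

lemma homogeneous_sum_induct [case_names homogeneous add]:
  assumes "\<And>n p. homogeneous d n p \<Longrightarrow> P p" "\<And>p q. P p \<Longrightarrow> P q \<Longrightarrow> P (p + q)"
  shows "P (p :: 'a list \<Rightarrow>\<^sub>0 'k::field_char_0)"
  using subset_UNIV[of "keys p"] by (induction rule: poly_mapping_linear_induct)
    (blast intro: assms homogeneous_zero homogeneous_single)+

section \<open>The graded commutator\<close>

text \<open>
  The product in the opposite order with the Koszul sign, \<open>(-1)\<^sup>i\<^sup>j q p\<close> for \<open>p\<close>, \<open>q\<close> homogeneous of degrees
  \<open>i\<close>, \<open>j\<close>. It is defined on words, which are homogeneous, so that bilinearity is clear.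
\<close>

definition swapped_mult ::
  "('a \<Rightarrow> int) \<Rightarrow> ('a list \<Rightarrow>\<^sub>0 'k::field_char_0) \<Rightarrow> ('a list \<Rightarrow>\<^sub>0 'k) \<Rightarrow> 'a list \<Rightarrow>\<^sub>0 'k" where
  "swapped_mult d p q =
     lin (\<lambda>u. lin (\<lambda>v. scl (koszul_sign (word_degree d u * word_degree d v)) (single (v @ u) 1)) q) p"

definition commutator ::
  "('a \<Rightarrow> int) \<Rightarrow> ('a list \<Rightarrow>\<^sub>0 'k::field_char_0) \<Rightarrow> ('a list \<Rightarrow>\<^sub>0 'k) \<Rightarrow> 'a list \<Rightarrow>\<^sub>0 'k" where
  "commutator d p q = p * q - swapped_mult d p q"

lemma linear_swapped_mult: "linear_pm (\<lambda>p. swapped_mult d p q)" "linear_pm (\<lambda>q. swapped_mult d p q)"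
  unfolding swapped_mult_def by (auto intro!: linear_pm_lin_arg)

lemma linear_commutator: "linear_pm (\<lambda>p. commutator d p q)" "linear_pm (\<lambda>q. commutator d p q)"
  unfolding commutator_def by (auto intro!: linear_pm_minus' linear_swapped_mult)

lemma swapped_mult_homogeneous:
  assumes p: "homogeneous d i p" and q: "homogeneous d j q"
  shows "swapped_mult d p q = scl (koszul_sign (i * j)) (q * p)"
proof -
  have "swapped_mult d (single u 1) q = scl (koszul_sign (i * j)) (q * single u 1)"
    if u: "word_degree d u = i" for u
    by (rule linear_pm_eqI[OF linear_swapped_mult(2) _ q[unfolded homogeneous_def]])
      (auto simp: swapped_mult_def u intro!: linear_pm_scl')
  then show ?thesis
    by (intro linear_pm_eqI[OF linear_swapped_mult(1) _ p[unfolded homogeneous_def]])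
      (auto intro!: linear_pm_scl')
qed

lemma commutator_homogeneous:
  "homogeneous d i p \<Longrightarrow> homogeneous d j q \<Longrightarrow>
    commutator d p q = p * q - scl (koszul_sign (i * j)) (q * p)"
  by (simp add: commutator_def swapped_mult_homogeneous)

lemma homogeneous_commutator:
  "homogeneous d i p \<Longrightarrow> homogeneous d j q \<Longrightarrow> homogeneous d (i + j) (commutator d p q)"
  using homogeneous_mult[of d j q i p]
  by (auto simp: commutator_homogeneous add.commute intro!: homogeneous_diff homogeneous_mult homogeneous_scl)

lemma commutator_antisymmetry:
  assumes p: "homogeneous d i p" and q: "homogeneous d j q"
  shows "commutator d p q = - scl (koszul_sign (i * j)) (commutator d q p)"
  by (simp add: commutator_homogeneous[OF p q] commutator_homogeneous[OF q p] scl_diff_right mult.commute)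

text \<open>
  The signs depend only on the parities of the three degrees, and in each of the eight cases both sides
  expand to the same signed sum of products.
\<close>

lemma commutator_jacobi:
  assumes p: "homogeneous d i p" and q: "homogeneous d j q" and r: "homogeneous d k r"
  shows "commutator d p (commutator d q r) =
    commutator d (commutator d p q) r + scl (koszul_sign (i * j)) (commutator d q (commutator d p r))"
  unfolding commutator_homogeneous[OF p homogeneous_commutator[OF q r]]
    commutator_homogeneous[OF homogeneous_commutator[OF p q] r]
    commutator_homogeneous[OF q homogeneous_commutator[OF p r]]
  unfolding commutator_homogeneous[OF p q] commutator_homogeneous[OF q r] commutator_homogeneous[OF p r]
  by (cases "even i"; cases "even j"; cases "even k") (simp_all add: scl_koszul_sign algebra_simps)

lemma commutator_components:
  assumes "finite A" "\<And>w. w \<in> keys p \<Longrightarrow> word_degree d w \<in> A"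
    and "finite B" "\<And>w. w \<in> keys q \<Longrightarrow> word_degree d w \<in> B"
  shows "commutator d p q = (\<Sum>i\<in>A. \<Sum>j\<in>B. component d i p * component d j q -
    scl (koszul_sign (i * j)) (component d j q * component d i p))"
proof -
  have "commutator d p q = commutator d (\<Sum>i\<in>A. component d i p) (\<Sum>j\<in>B. component d j q)"
    using assms by (simp add: component_sum)
  also have "\<dots> = (\<Sum>i\<in>A. \<Sum>j\<in>B. commutator d (component d i p) (component d j q))"
    unfolding linear_pm_sum[OF linear_commutator(1)] linear_pm_sum[OF linear_commutator(2)]
    by (rule sum.swap)
  finally show ?thesis
    by (simp add: commutator_homogeneous[OF homogeneous_component homogeneous_component])
qed

lemma keys_commutator:
  assumes "keys p \<subseteq> lists X" "keys q \<subseteq> lists X"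
  shows "keys (commutator d p q) \<subseteq> lists X"
proof -
  have "keys (p * q) \<subseteq> lists X" using keys_mult[of p q] assms by (force simp: plus_list_def)
  moreover have "keys (swapped_mult d p q) \<subseteq> lists X" unfolding swapped_mult_def
    by (intro keys_lin_subset order_trans[OF keys_scl]) (use assms in auto)
  ultimately show ?thesis using keys_diff[of "p * q"] unfolding commutator_def by blast
qed

section \<open>Algebra homomorphisms and derivations\<close>

definition subst_letters :: "('a \<Rightarrow> ('b list \<Rightarrow>\<^sub>0 'k::field_char_0)) \<Rightarrow> ('a list \<Rightarrow>\<^sub>0 'k) \<Rightarrow> 'b list \<Rightarrow>\<^sub>0 'k" where
  "subst_letters h = lin (\<lambda>w. prod_list (map h w))"

lemma linear_subst_letters [simp]: "linear_pm (subst_letters h)"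
  by (simp add: subst_letters_def)

lemmas subst_letters_add = linear_pm_add[OF linear_subst_letters]
  and subst_letters_scl = linear_pm_scl[OF linear_subst_letters]
  and subst_letters_zero [simp] = linear_pm_zero[OF linear_subst_letters]
  and subst_letters_diff = linear_pm_diff[OF linear_subst_letters]

lemma subst_letters_letter [simp]: "subst_letters h (letter x) = h x"
  and subst_letters_one [simp]: "subst_letters h 1 = 1"
  using lin_single[of "\<lambda>w. prod_list (map h w)" "[]" 1]
  by (simp_all add: subst_letters_def letter_def)

lemma linear_bilinear_eqI:
  assumes "\<And>q. linear_pm (\<lambda>p. B p q)" "\<And>p. linear_pm (B p)"
    and "\<And>q. linear_pm (\<lambda>p. B' p q)" "\<And>p. linear_pm (B' p)"
    and "keys p \<subseteq> X" "keys q \<subseteq> Y"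
    and "\<And>u v. u \<in> X \<Longrightarrow> v \<in> Y \<Longrightarrow> B (single u 1) (single v 1) = B' (single u 1) (single v 1)"
  shows "B p q = B' p q"
  by (rule linear_pm_eqI[of "\<lambda>p. B p q" "\<lambda>p. B' p q" _ X], (use assms in simp)+)
    (rule linear_pm_eqI[of _ _ _ Y], use assms in simp_all)

lemma subst_letters_mult: "subst_letters h (p * q) = subst_letters h p * subst_letters h q"
  by (rule linear_bilinear_eqI[of _ _ p UNIV q UNIV])
    (simp_all add: linear_pm_def subst_letters_add subst_letters_scl algebra_simps, simp add: subst_letters_def)

lemma homogeneous_subst_letters:
  assumes h: "\<And>x. x \<in> X \<Longrightarrow> homogeneous d' (d x) (h x)" and p: "homogeneous d n p" "keys p \<subseteq> lists X"
  shows "homogeneous d' n (subst_letters h p)"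
  unfolding subst_letters_def
proof (rule homogeneous_lin)
  fix w assume w: "w \<in> keys p"
  have "homogeneous d' (word_degree d w) (prod_list (map h w))" if "set w \<subseteq> X" for w
    using that
  proof (induction w)
    case Nil
    have "homogeneous d' (word_degree d' []) (single [] (1 :: 'c))" by (rule homogeneous_single)
    then show ?case by simp
  qed (auto intro!: homogeneous_mult h)
  then show "homogeneous d' n (prod_list (map h w))"
    using w p by (force simp: homogeneous_def)
qed

lemma subst_letters_commutator:
  assumes h: "\<And>x. x \<in> X \<Longrightarrow> homogeneous d' (d x) (h x)"
    and p: "keys p \<subseteq> lists X" and q: "keys q \<subseteq> lists X"
  shows "subst_letters h (commutator d p q) = commutator d' (subst_letters h p) (subst_letters h q)"
proof (rule linear_bilinear_eqI[OF _ _ _ _ p q])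
  fix u v assume "u \<in> lists X" "v \<in> lists X"
  then have "homogeneous d' (word_degree d w) (subst_letters h (single w 1))" if "w \<in> {u, v}" for w
    using that by (intro homogeneous_subst_letters[where X = X and d = d]) (auto simp: h homogeneous_single)
  then show "subst_letters h (commutator d (single u 1) (single v 1)) =
      commutator d' (subst_letters h (single u 1)) (subst_letters h (single v 1))"
    by (subst (1 2) commutator_homogeneous)
      (auto simp: homogeneous_single subst_letters_diff subst_letters_scl subst_letters_mult simp del: single_mult)
qed (simp_all add: linear_pm_def subst_letters_add subst_letters_scl
    linear_pm_add[OF linear_commutator(1)] linear_pm_scl[OF linear_commutator(1)]
    linear_pm_add[OF linear_commutator(2)] linear_pm_scl[OF linear_commutator(2)])

lemma keys_mult_lists:
  fixes p q :: "'a list \<Rightarrow>\<^sub>0 'k::field_char_0"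
  shows "keys p \<subseteq> lists X \<Longrightarrow> keys q \<subseteq> lists X \<Longrightarrow> keys (p * q) \<subseteq> lists X"
  using keys_mult[of p q] by (force simp: plus_list_def)

lemma keys_subst_letters:
  assumes h: "\<And>x. x \<in> X \<Longrightarrow> keys (h x) \<subseteq> lists Y" and p: "keys p \<subseteq> lists X"
  shows "keys (subst_letters h p) \<subseteq> lists Y"
  unfolding subst_letters_def
proof (rule keys_lin_subset)
  fix w assume w: "w \<in> keys p"
  have "keys (prod_list (map h w)) \<subseteq> lists Y" if "set w \<subseteq> X" for w
    using that
  proof (induction w)
    case (Cons x w)
    then show ?case using keys_mult_lists[OF h[of x], of "prod_list (map h w)"] by simp
  qed (simp add: zero_list_def)
  then show "keys (prod_list (map h w)) \<subseteq> lists Y" using w p by auto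
qed

definition parity :: "('a \<Rightarrow> int) \<Rightarrow> ('a list \<Rightarrow>\<^sub>0 'k::field_char_0) \<Rightarrow> 'a list \<Rightarrow>\<^sub>0 'k" where
  "parity d = lin (\<lambda>w. scl (koszul_sign (word_degree d w)) (single w 1))"

lemma linear_parity [simp]: "linear_pm (parity d)"
  by (simp add: parity_def)

lemma parity_homogeneous: "homogeneous d n p \<Longrightarrow> parity d p = scl (koszul_sign n) p"
  unfolding homogeneous_def
  by (rule linear_pm_eqI) (auto intro!: linear_pm_scl' linear_pm_id simp: parity_def)

text \<open>
  The sign is that of moving an operator of degree 1 past the first letter.
\<close>

primrec word_derivation :: "('a \<Rightarrow> int) \<Rightarrow> ('a \<Rightarrow> ('a list \<Rightarrow>\<^sub>0 'k::field_char_0)) \<Rightarrow> 'a list \<Rightarrow> 'a list \<Rightarrow>\<^sub>0 'k" where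
  "word_derivation d D [] = 0"
| "word_derivation d D (x # w) = D x * single w 1 + scl (koszul_sign (d x)) (letter x * word_derivation d D w)"

text \<open>
  The derivation of degree 1 with value \<open>D x\<close> on the letter \<open>x\<close>.
\<close>

definition derivation :: "('a \<Rightarrow> int) \<Rightarrow> ('a \<Rightarrow> ('a list \<Rightarrow>\<^sub>0 'k::field_char_0)) \<Rightarrow>
    ('a list \<Rightarrow>\<^sub>0 'k) \<Rightarrow> 'a list \<Rightarrow>\<^sub>0 'k" where
  "derivation d D = lin (word_derivation d D)"

lemma linear_derivation [simp]: "linear_pm (derivation d D)"
  by (simp add: derivation_def)

lemma derivation_letter [simp]: "derivation d D (letter x) = D x"
  by (simp add: derivation_def letter_def)

lemma derivation_one [simp]: "derivation d D 1 = 0"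
  using lin_single[of "word_derivation d D" "[]" 1] by (simp add: derivation_def)

lemma word_derivation_append:
  "word_derivation d D (u @ v) = word_derivation d D u * single v 1 +
    scl (koszul_sign (word_degree d u)) (single u 1 * word_derivation d D v)"
proof (induction u)
  case (Cons x u)
  have "single (x # u) (1::'b) = letter x * single u 1" by (simp add: letter_def)
  moreover have "single (u @ v) (1::'b) = single u 1 * single v 1" by simp
  ultimately show ?case using Cons
    by (simp add: algebra_simps koszul_sign_add scl_add_right del: single_mult)
qed simp

lemma derivation_mult: "derivation d D (p * q) = derivation d D p * q + parity d p * derivation d D q"
  by (rule linear_bilinear_eqI[of _ _ p UNIV q UNIV])
    (simp_all add: linear_pm_def linear_pm_add[OF linear_derivation] linear_pm_scl[OF linear_derivation]
      linear_pm_add[OF linear_parity] linear_pm_scl[OF linear_parity] scl_add_right algebra_simps,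
     simp add: derivation_def parity_def word_derivation_append flip: scl_mult_left)

lemma derivation_mult_homogeneous:
  "homogeneous d n p \<Longrightarrow>
    derivation d D (p * q) = derivation d D p * q + scl (koszul_sign n) (p * derivation d D q)"
  by (simp add: derivation_mult parity_homogeneous)

lemma homogeneous_derivation:
  assumes D: "\<And>x. homogeneous d (d x + 1) (D x)" and p: "homogeneous d n p"
  shows "homogeneous d (n + 1) (derivation d D p)"
  unfolding derivation_def
proof (rule homogeneous_lin)
  fix w assume w: "w \<in> keys p"
  have "homogeneous d (word_degree d w + 1) (word_derivation d D w)" for w
  proof (induction w)
    case (Cons x w)
    have "homogeneous d (d x + 1 + word_degree d w) (D x * single w 1)"
      by (intro homogeneous_mult D homogeneous_single)
    moreover have "homogeneous d (d x + (word_degree d w + 1)) (letter x * word_derivation d D w)"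
      using homogeneous_single[of d "[x]"] by (intro homogeneous_mult Cons) (simp add: letter_def)
    ultimately show ?case by (auto intro!: homogeneous_add homogeneous_scl simp: ac_simps)
  qed simp
  then show "homogeneous d (n + 1) (word_derivation d D w)" using w p by (auto simp: homogeneous_def)
qed

lemma derivation_commutator:
  assumes D: "\<And>x. homogeneous d (d x + 1) (D x)" and p: "homogeneous d i p"
  shows "derivation d D (commutator d p q) =
    commutator d (derivation d D p) q + scl (koszul_sign i) (commutator d p (derivation d D q))"
proof (induction q rule: homogeneous_sum_induct[where d = d])
  case (homogeneous j q)
  note dp = homogeneous_derivation[OF D p] and dq = homogeneous_derivation[OF D homogeneous]
  have "koszul_sign ((i + 1) * j) = koszul_sign (i * j) * (koszul_sign j :: 'b)"
    "koszul_sign (i * (j + 1)) = koszul_sign (i * j) * (koszul_sign i :: 'b)"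
    by (auto simp: koszul_sign_def)
  then show ?case
    by (simp add: commutator_homogeneous[OF p homogeneous] commutator_homogeneous[OF dp homogeneous]
        commutator_homogeneous[OF p dq] linear_pm_diff[OF linear_derivation] linear_pm_scl[OF linear_derivation]
        derivation_mult_homogeneous[OF p] derivation_mult_homogeneous[OF homogeneous] scl_add_right
        scl_diff_right mult.commute mult.left_commute)
next
  case (add q r)
  then show ?case
    by (simp add: linear_pm_add[OF linear_commutator(2)] linear_pm_add[OF linear_derivation] scl_add_right)
qed

text \<open>
  In the square of an odd derivation applied to a product the two mixed terms cancel, so the square is
  again a derivation and vanishes if it does so on letters.
\<close>

lemma derivation_square_zero:
  assumes D: "\<And>x. homogeneous d (d x + 1) (D x)" and DD: "\<And>x. derivation d D (D x) = 0"
  shows "derivation d D (derivation d D p) = 0"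
proof -
  have word: "derivation d D (derivation d D (single w 1)) = 0" for w
  proof (induction w)
    case (Cons x w)
    have x: "homogeneous d (d x) (letter x)" using homogeneous_single[of d "[x]"] by (simp add: letter_def)
    have "single (x # w) (1::'b) = letter x * single w 1" by (simp add: letter_def)
    moreover have "koszul_sign (d x + 1) = - (koszul_sign (d x) :: 'b)" by (simp add: koszul_sign_def)
    ultimately show ?case using Cons
      by (simp add: derivation_mult_homogeneous[OF x] derivation_mult_homogeneous[OF D] DD
          linear_pm_add[OF linear_derivation] linear_pm_scl[OF linear_derivation])
  qed (simp add: linear_pm_zero[OF linear_derivation])
  show ?thesis
    by (rule linear_pm_eqI[of "\<lambda>p. derivation d D (derivation d D p)" "\<lambda>_. 0" p UNIV])
      (simp_all add: linear_pm_comp linear_pm_const_zero word)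
qed

section \<open>Graded spaces and graded maps\<close>

lemma scalars_simps [simp]:
  "carrier scalars = UNIV" "add scalars = (+)" "zero scalars = 0" "mult scalars = (*)" "one scalars = 1"
  by (simp_all add: scalars_def)

lemma cring_scalars: "cring (scalars :: 'k::field_char_0 ring)"
  by (rule cringI) (auto intro!: abelian_groupI comm_monoidI simp: algebra_simps exI[of _ "- _"])

lemma minus_scalars [simp]: "\<ominus>\<^bsub>scalars\<^esub> c = - (c :: 'k::field_char_0)"
proof -
  interpret cring "scalars :: 'k ring" by (rule cring_scalars)
  show ?thesis using minus_equality[of "- c" c] by simp
qed

lemma scalar_moduleI:
  fixes V :: "('k::field_char_0, 'a, 'm) module_scheme" (structure)
  assumes "\<zero> \<in> carrier V"
    and "\<And>x y. x \<in> carrier V \<Longrightarrow> y \<in> carrier V \<Longrightarrow> x \<oplus> y \<in> carrier V"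
    and "\<And>c x. x \<in> carrier V \<Longrightarrow> c \<odot> x \<in> carrier V"
    and "\<And>x y z. x \<in> carrier V \<Longrightarrow> y \<in> carrier V \<Longrightarrow> z \<in> carrier V \<Longrightarrow> (x \<oplus> y) \<oplus> z = x \<oplus> (y \<oplus> z)"
    and "\<And>x y. x \<in> carrier V \<Longrightarrow> y \<in> carrier V \<Longrightarrow> x \<oplus> y = y \<oplus> x"
    and "\<And>x. x \<in> carrier V \<Longrightarrow> \<zero> \<oplus> x = x"
    and neg: "\<And>x. x \<in> carrier V \<Longrightarrow> (- 1) \<odot> x \<oplus> x = \<zero>"
    and "\<And>a b x. x \<in> carrier V \<Longrightarrow> (a + b) \<odot> x = a \<odot> x \<oplus> b \<odot> x"
    and "\<And>a x y. x \<in> carrier V \<Longrightarrow> y \<in> carrier V \<Longrightarrow> a \<odot> (x \<oplus> y) = a \<odot> x \<oplus> a \<odot> y"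
    and "\<And>a b x. x \<in> carrier V \<Longrightarrow> (a * b) \<odot> x = a \<odot> (b \<odot> x)"
    and "\<And>x. x \<in> carrier V \<Longrightarrow> 1 \<odot> x = x"
  shows "module (scalars :: 'k ring) V"
proof -
  have "\<exists>y\<in>carrier V. y \<oplus> x = \<zero>" if "x \<in> carrier V" for x
    using that neg assms(3) by blast
  then show ?thesis
    by (intro moduleI[OF cring_scalars abelian_groupI]) (use assms in auto)
qed

text \<open>
  All elements of the field lie in the carrier of \<open>scalars\<close>, so the module laws hold without conditions
  on the scalars.
\<close>

locale scalar_module = module "scalars :: 'k::field_char_0 ring" V
  for V :: "('k::field_char_0, 'a, 'm) module_scheme" (structure)
begin

lemma smult_mem [simp, intro]: "x \<in> carrier V \<Longrightarrow> c \<odot> x \<in> carrier V"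
  by simp

lemma smult_plus: "x \<in> carrier V \<Longrightarrow> (a + b) \<odot> x = a \<odot> x \<oplus> b \<odot> x"
  and smult_add: "x \<in> carrier V \<Longrightarrow> y \<in> carrier V \<Longrightarrow> a \<odot> (x \<oplus> y) = a \<odot> x \<oplus> a \<odot> y"
  and smult_smult: "x \<in> carrier V \<Longrightarrow> a \<odot> (b \<odot> x) = (a * b) \<odot> x"
  and smult_1 [simp]: "x \<in> carrier V \<Longrightarrow> 1 \<odot> x = x"
  and smult_0 [simp]: "x \<in> carrier V \<Longrightarrow> 0 \<odot> x = \<zero>"
  and smult_zero [simp]: "a \<odot> \<zero> = \<zero>"
  using smult_l_distr[of a b x] apply simp
  using smult_r_distr[of a x y] apply simp
  using smult_assoc1[of a b x] apply simp
  using smult_one[of x] apply simp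
  using smult_l_null[of x] apply simp
  using smult_r_null[of a] apply simp
  done

lemma minus_eq_smult: "x \<in> carrier V \<Longrightarrow> \<ominus> x = (- 1) \<odot> x"
  using smult_l_minus[of 1 x] by simp

lemma submodule_iff:
  "submodule S (scalars :: 'k ring) V \<longleftrightarrow> S \<subseteq> carrier V \<and> \<zero> \<in> S \<and>
     (\<forall>x\<in>S. \<forall>y\<in>S. x \<oplus> y \<in> S) \<and> (\<forall>c. \<forall>x\<in>S. c \<odot> x \<in> S)"
proof
  assume S: "submodule S (scalars :: 'k ring) V"
  obtain x where "x \<in> S" using submoduleE(2)[OF S] by blast
  then have "\<zero> \<in> S" using submoduleE(4)[OF S, of 0 x] submoduleE(1)[OF S] by auto
  then show "S \<subseteq> carrier V \<and> \<zero> \<in> S \<and> (\<forall>x\<in>S. \<forall>y\<in>S. x \<oplus> y \<in> S) \<and> (\<forall>c. \<forall>x\<in>S. c \<odot> x \<in> S)"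
    using submoduleE[OF S] by auto
next
  assume "S \<subseteq> carrier V \<and> \<zero> \<in> S \<and> (\<forall>x\<in>S. \<forall>y\<in>S. x \<oplus> y \<in> S) \<and> (\<forall>c. \<forall>x\<in>S. c \<odot> x \<in> S)"
  then show "submodule S (scalars :: 'k ring) V"
    by (intro submoduleI) (auto simp: minus_eq_smult subset_iff)
qed

lemma submoduleD:
  assumes "submodule S (scalars :: 'k ring) V"
  shows "S \<subseteq> carrier V" "x \<in> S \<Longrightarrow> x \<in> carrier V" "\<zero> \<in> S"
    "x \<in> S \<Longrightarrow> y \<in> S \<Longrightarrow> x \<oplus> y \<in> S" "x \<in> S \<Longrightarrow> c \<odot> x \<in> S"
  using assms[unfolded submodule_iff] by auto

lemma finsum_mem:
  assumes "submodule S (scalars :: 'k ring) V" "\<And>a. a \<in> A \<Longrightarrow> f a \<in> S"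
  shows "finsum V f A \<in> S"
  using assms(2)
proof (induction A rule: infinite_finite_induct)
  case (insert a A)
  have "finsum V f (insert a A) = f a \<oplus> finsum V f A"
    using insert submoduleD(1)[OF assms(1)] by (intro finsum_insert) auto
  then show ?case using insert submoduleD(4)[OF assms(1)] by simp
qed (use submoduleD(3)[OF assms(1)] in \<open>simp_all add: add.finprod_infinite\<close>)

lemma finsum_superset:
  assumes "finite A" "f \<in> A \<rightarrow> carrier V" "{a \<in> A. f a \<noteq> \<zero>} \<subseteq> B" "B \<subseteq> A"
  shows "finsum V f B = finsum V f A"
  by (rule add.finprod_mono_neutral_cong_left) (use assms in auto)

end

context graded_space
begin

sublocale scalar_module V ..

lemma grade_mem [simp]: "x \<in> grade V n \<Longrightarrow> x \<in> carrier V"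
  using submoduleD(2)[OF grade_submodule] .

lemma grade_zero [simp]: "\<zero> \<in> grade V n"
  and grade_add: "x \<in> grade V n \<Longrightarrow> y \<in> grade V n \<Longrightarrow> x \<oplus> y \<in> grade V n"
  and grade_smult: "x \<in> grade V n \<Longrightarrow> c \<odot> x \<in> grade V n"
  using submoduleD(3-5)[OF grade_submodule] by blast+

end

lemma is_decompositionI:
  fixes V :: "('k::field_char_0, 'a, 'm) graded_space_scheme" (structure)
  assumes "module (scalars :: 'k ring) V" "\<And>n. f n \<in> grade V n" "\<And>n. f n \<in> carrier V"
    and "finite A" "\<And>n. n \<notin> A \<Longrightarrow> f n = \<zero>" "x = finsum V f A"
  shows "is_decomposition V x f"
proof -
  interpret scalar_module V using assms(1) by (simp add: scalar_module_def)
  have fin: "finite {n. f n \<noteq> \<zero>}" by (rule finite_subset[OF _ \<open>finite A\<close>]) (use assms(5) in auto)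
  have "finsum V f {n. f n \<noteq> \<zero>} = finsum V f A"
    by (rule finsum_superset) (use assms in auto)
  then show ?thesis using assms fin by (simp add: is_decomposition_def)
qed

lemma linear_mapD:
  assumes "linear_map V W h"
  shows "x \<in> carrier V \<Longrightarrow> h x \<in> carrier W"
    and "x \<in> carrier V \<Longrightarrow> y \<in> carrier V \<Longrightarrow> h (x \<oplus>\<^bsub>V\<^esub> y) = h x \<oplus>\<^bsub>W\<^esub> h y"
    and "x \<in> carrier V \<Longrightarrow> h (c \<odot>\<^bsub>V\<^esub> x) = c \<odot>\<^bsub>W\<^esub> h x"
  using assms by (auto simp: linear_map_def)

lemma linear_mapI:
  assumes "\<And>x. x \<in> carrier V \<Longrightarrow> h x \<in> carrier W"
    and "\<And>x y. x \<in> carrier V \<Longrightarrow> y \<in> carrier V \<Longrightarrow> h (x \<oplus>\<^bsub>V\<^esub> y) = h x \<oplus>\<^bsub>W\<^esub> h y"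
    and "\<And>c x. x \<in> carrier V \<Longrightarrow> h (c \<odot>\<^bsub>V\<^esub> x) = c \<odot>\<^bsub>W\<^esub> h x"
  shows "linear_map V W h"
  using assms by (auto simp: linear_map_def)

lemma graded_mapI:
  assumes "linear_map V W h" "\<And>n x. x \<in> grade V n \<Longrightarrow> h x \<in> grade W (n + k)"
  shows "graded_map k V W h"
  using assms by (auto simp: graded_map_def)

lemma graded_mapD:
  assumes "graded_map k V W h"
  shows "linear_map V W h" and "x \<in> grade V n \<Longrightarrow> h x \<in> grade W (n + k)"
  using assms by (auto simp: graded_map_def)

lemma linear_map_zero:
  fixes V :: "('k::field_char_0, 'a, 'm) module_scheme"
  assumes "module (scalars :: 'k ring) V" "module (scalars :: 'k ring) W" "linear_map V W h"
  shows "h \<zero>\<^bsub>V\<^esub> = \<zero>\<^bsub>W\<^esub>"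
proof -
  interpret V: scalar_module V using assms by (simp add: scalar_module_def)
  interpret W: scalar_module W using assms by (simp add: scalar_module_def)
  show ?thesis using linear_mapD(1,3)[OF assms(3), of "\<zero>\<^bsub>V\<^esub>"] by (metis V.smult_0 V.zero_closed W.smult_0)
qed

lemma linear_map_finsum:
  fixes V :: "('k::field_char_0, 'a, 'm) module_scheme"
  assumes V: "module (scalars :: 'k ring) V" and W: "module (scalars :: 'k ring) W" and h: "linear_map V W h"
    and f: "f \<in> A \<rightarrow> carrier V"
  shows "h (finsum V f A) = finsum W (\<lambda>a. h (f a)) A"
proof -
  interpret V: scalar_module V using V by (simp add: scalar_module_def)
  interpret W: scalar_module W using W by (simp add: scalar_module_def)
  note [simp] = linear_map_zero[OF V W h] linear_mapD[OF h]
  show ?thesis using f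
    by (induction A rule: infinite_finite_induct)
      (auto simp: V.add.finprod_infinite W.add.finprod_infinite Pi_iff)
qed

lemma submodule_preimage:
  fixes V :: "('k::field_char_0, 'a, 'm) module_scheme"
  assumes V: "module (scalars :: 'k ring) V" and W: "module (scalars :: 'k ring) W" and h: "linear_map V W h"
    and S: "submodule S (scalars :: 'k ring) W"
  shows "submodule {x \<in> carrier V. h x \<in> S} (scalars :: 'k ring) V"
proof -
  interpret V: scalar_module V using V by (simp add: scalar_module_def)
  interpret W: scalar_module W using W by (simp add: scalar_module_def)
  note s = W.submoduleD[OF S]
  show ?thesis
    by (simp add: V.submodule_iff linear_map_zero[OF V W h] linear_mapD(2,3)[OF h] s)
qed

text \<open>
  A graded map takes decompositions to decompositions. Since the source is only required to be a module,
  the lemma serves to prove uniqueness of decompositions in a space that is yet to be shown to be graded,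
  by comparison with a graded space \<open>W\<close>.
\<close>

lemma decomposition_map:
  fixes V :: "('k::field_char_0, 'a, 'm) graded_space_scheme"
  assumes V: "module (scalars :: 'k ring) V" and sub: "\<And>n. grade V n \<subseteq> carrier V"
    and W: "graded_space W" and h: "graded_map k V W h" and x: "is_decomposition V x f"
  shows "is_decomposition W (h x) (\<lambda>n. h (f (n - k)))"
proof -
  interpret V: scalar_module V using V by (simp add: scalar_module_def)
  interpret W: graded_space W by fact
  note lin = graded_mapD(1)[OF h]
  have f: "f n \<in> grade V n" "f n \<in> carrier V" for n using x sub by (auto simp: is_decomposition_def)
  let ?A = "{n. f n \<noteq> \<zero>\<^bsub>V\<^esub>}"
  have g: "h (f (n - k)) \<in> grade W n" for n
    using graded_mapD(2)[OF h f(1), of "n - k"] by simp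
  have "h x = finsum W (\<lambda>n. h (f n)) ?A"
    using x linear_map_finsum[OF V W.module_axioms lin, of f ?A] f(2) by (simp add: is_decomposition_def)
  also have "\<dots> = finsum W (\<lambda>n. h (f (n - k))) ((\<lambda>n. n + k) ` ?A)"
    by (subst W.finsum_reindex) (auto simp: linear_mapD(1)[OF lin] f inj_on_def)
  finally have eq: "h x = finsum W (\<lambda>n. h (f (n - k))) ((\<lambda>n. n + k) ` ?A)" .
  show ?thesis
  proof (rule is_decompositionI[OF W.module_axioms g W.grade_mem[OF g] _ _ eq])
    show "finite ((\<lambda>n. n + k) ` ?A)" using x by (simp add: is_decomposition_def)
    show "h (f (n - k)) = \<zero>\<^bsub>W\<^esub>" if "n \<notin> (\<lambda>n. n + k) ` ?A" for n
    proof -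
      have "f (n - k) = \<zero>\<^bsub>V\<^esub>" using that by (metis (mono_tags) diff_add_cancel imageI mem_Collect_eq)
      then show ?thesis by (simp add: linear_map_zero[OF V W.module_axioms lin])
    qed
  qed
qed

context graded_space
begin

abbreviation comp where "comp \<equiv> homog_component V"

lemma decomposition_mem: "is_decomposition V x f \<Longrightarrow> x \<in> carrier V"
  by (auto simp: is_decomposition_def intro!: finsum_closed intro: grade_mem)

lemma comp_decomposition: "x \<in> carrier V \<Longrightarrow> is_decomposition V x (\<lambda>n. comp n x)"
  using theI'[OF direct_sum_decomposition] by (simp add: homog_component_def)

lemma comp_unique: "is_decomposition V x f \<Longrightarrow> comp n x = f n"
  using the1_equality[OF direct_sum_decomposition[OF decomposition_mem]] by (simp add: homog_component_def)

lemma comp_grade [simp]: "x \<in> carrier V \<Longrightarrow> comp n x \<in> grade V n"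
  using comp_decomposition by (auto simp: is_decomposition_def)

lemma comp_mem [simp]: "x \<in> carrier V \<Longrightarrow> comp n x \<in> carrier V"
  by (rule grade_mem, rule comp_grade)

lemma comp_finite: "x \<in> carrier V \<Longrightarrow> finite {n. comp n x \<noteq> \<zero>}"
  and comp_finsum: "x \<in> carrier V \<Longrightarrow> x = finsum V (\<lambda>n. comp n x) {n. comp n x \<noteq> \<zero>}"
  using comp_decomposition by (auto simp: is_decomposition_def)

lemma comp_homogeneous: "x \<in> grade V n \<Longrightarrow> comp m x = (if m = n then x else \<zero>)"
  by (rule comp_unique, rule is_decompositionI[OF module_axioms, where A = "{n}"]) auto

lemma comp_zero [simp]: "comp n \<zero> = \<zero>"
  using comp_homogeneous[OF grade_zero, of n n] by simp

lemma comp_mem_submodule: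
  assumes "submodule S (scalars :: 'k ring) V" "x \<in> carrier V" "\<And>n. comp n x \<in> S"
  shows "x \<in> S"
  by (subst comp_finsum[OF assms(2)], rule finsum_mem) (use assms in auto)

end

lemma graded_map_comp:
  assumes V: "graded_space V" and W: "graded_space W" and h: "graded_map k V W h" and x: "x \<in> carrier V"
  shows "h (homog_component V n x) = homog_component W (n + k) (h x)"
proof -
  interpret V: graded_space V by fact
  interpret W: graded_space W by fact
  have "is_decomposition W (h x) (\<lambda>n. h (V.comp (n - k) x))"
    by (rule decomposition_map[OF V.module_axioms _ W h V.comp_decomposition[OF x]]) auto
  from W.comp_unique[OF this, of "n + k"] show ?thesis by simp
qed

lemma graded_map_compose:
  assumes "graded_map k V W h" "graded_map l W U g"
  shows "graded_map (k + l) V U (\<lambda>x. g (h x))"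
  using assms by (auto simp: graded_map_def linear_map_def Pi_iff image_subset_iff simp flip: add.assoc)

lemma (in graded_space) graded_map_id: "graded_map 0 V V (\<lambda>x. x)"
  by (auto simp: graded_map_def linear_map_def)

lemma (in graded_space) graded_map_projection: "graded_map 0 V V (homog_component V m)"
proof -
  have dec: "is_decomposition V (x \<oplus> y) (\<lambda>n. comp n x \<oplus> comp n y)"
    if "x \<in> carrier V" "y \<in> carrier V" for x y
  proof (rule is_decompositionI[OF module_axioms])
    let ?A = "{n. comp n x \<noteq> \<zero>} \<union> {n. comp n y \<noteq> \<zero>}"
    show "finite ?A" using that comp_finite by auto
    have "finsum V (\<lambda>n. comp n z) {n. comp n z \<noteq> \<zero>} = finsum V (\<lambda>n. comp n z) ?A" if "z = x \<or> z = y" for z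
      using \<open>finite ?A\<close> \<open>x \<in> carrier V\<close> \<open>y \<in> carrier V\<close> that by (intro finsum_superset) auto
    then show "x \<oplus> y = finsum V (\<lambda>n. comp n x \<oplus> comp n y) ?A"
      using that comp_finsum[of x] comp_finsum[of y] by (subst finsum_addf) auto
  qed (use that in \<open>auto intro!: grade_add\<close>)
  have dec': "is_decomposition V (c \<odot> x) (\<lambda>n. c \<odot> comp n x)" if "x \<in> carrier V" for c x
  proof (rule is_decompositionI[OF module_axioms])
    show fin: "finite {n. comp n x \<noteq> \<zero>}" using that comp_finite by auto
    show "c \<odot> x = finsum V (\<lambda>n. c \<odot> comp n x) {n. comp n x \<noteq> \<zero>}"
      using that finsum_smult_ldistr[OF fin, of c "\<lambda>n. comp n x"] comp_finsum[of x] by auto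
  qed (use that in \<open>auto intro!: grade_smult\<close>)
  show ?thesis
    by (intro graded_mapI linear_mapI)
      (auto simp: comp_homogeneous comp_unique[OF dec] comp_unique[OF dec'])
qed

lemmas (in graded_space) comp_add = linear_mapD(2)[OF graded_mapD(1)[OF graded_map_projection]]
  and comp_smult = linear_mapD(3)[OF graded_mapD(1)[OF graded_map_projection]]

section \<open>Transport of structure and subspaces\<close>

text \<open>
  Algebraic structure is mostly established by an embedding \<open>\<nu>\<close> into a structure of the same kind: the
  equational axioms are reflected by injective homomorphisms, and a grading is inherited as soon as the
  image contains the homogeneous components of its elements.
\<close>

lemma module_embedding:
  fixes V :: "('k::field_char_0, 'a, 'm) module_scheme"
  assumes W: "module (scalars :: 'k ring) W"
    and inj: "inj_on \<nu> (carrier V)" and lin: "linear_map V W \<nu>" and zero: "\<zero>\<^bsub>V\<^esub> \<in> carrier V" "\<nu> \<zero>\<^bsub>V\<^esub> = \<zero>\<^bsub>W\<^esub>"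
    and add: "\<And>x y. x \<in> carrier V \<Longrightarrow> y \<in> carrier V \<Longrightarrow> x \<oplus>\<^bsub>V\<^esub> y \<in> carrier V"
    and smult: "\<And>c x. x \<in> carrier V \<Longrightarrow> c \<odot>\<^bsub>V\<^esub> x \<in> carrier V"
  shows "module (scalars :: 'k ring) V"
proof -
  interpret W: scalar_module W using W by (simp add: scalar_module_def)
  note s = linear_mapD[OF lin] zero add smult
  have [simp]: "(- 1) \<odot>\<^bsub>W\<^esub> x \<oplus>\<^bsub>W\<^esub> x = \<zero>\<^bsub>W\<^esub>" if "x \<in> carrier W" for x
    using W.smult_plus[of x "- 1" 1] that by simp
  show ?thesis
    by (rule scalar_moduleI; (intro inj_onD[OF inj])?)
      (auto simp: s W.smult_plus W.smult_add W.smult_smult W.a_assoc intro: W.a_comm)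
qed

lemma graded_space_transport:
  fixes V :: "('k::field_char_0, 'a, 'm) graded_space_scheme"
  assumes W: "graded_space W"
    and inj: "inj_on \<nu> (carrier V)" and lin: "linear_map V W \<nu>" and zero: "\<zero>\<^bsub>V\<^esub> \<in> carrier V" "\<nu> \<zero>\<^bsub>V\<^esub> = \<zero>\<^bsub>W\<^esub>"
    and add: "\<And>x y. x \<in> carrier V \<Longrightarrow> y \<in> carrier V \<Longrightarrow> x \<oplus>\<^bsub>V\<^esub> y \<in> carrier V"
    and smult: "\<And>c x. x \<in> carrier V \<Longrightarrow> c \<odot>\<^bsub>V\<^esub> x \<in> carrier V"
    and grade: "\<And>n. grade V n = {x \<in> carrier V. \<nu> x \<in> grade W n}"
    and comp: "\<And>n x. x \<in> carrier V \<Longrightarrow> homog_component W n (\<nu> x) \<in> \<nu> ` carrier V"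
  shows "graded_space V"
proof -
  interpret W: graded_space W by fact
  have V: "module (scalars :: 'k ring) V"
    by (rule module_embedding[OF W.module_axioms inj lin zero add smult])
  interpret V: scalar_module V using V by (simp add: scalar_module_def)
  note s = linear_mapD[OF lin] zero add smult
  have map: "graded_map 0 V W \<nu>" using grade lin by (auto simp: graded_map_def)
  show ?thesis
  proof (rule graded_space.intro[OF V graded_space_axioms.intro])
    show "submodule (grade V n) scalars V" for n
      by (auto simp: V.submodule_iff grade s W.grade_add W.grade_smult)
    fix x assume x: "x \<in> carrier V"
    define f where "f n = inv_into (carrier V) \<nu> (W.comp n (\<nu> x))" for n
    have f: "f n \<in> carrier V" "\<nu> (f n) = W.comp n (\<nu> x)" for n
      using comp[OF x, of n] by (auto simp: f_def inv_into_into f_inv_into_f)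
    have "finite {n. W.comp n (\<nu> x) \<noteq> \<zero>\<^bsub>W\<^esub>}" using x s by (simp add: W.comp_finite)
    moreover have "x = finsum V f {n. W.comp n (\<nu> x) \<noteq> \<zero>\<^bsub>W\<^esub>}"
      by (rule inj_onD[OF inj _ x V.finsum_closed])
        (subst linear_map_finsum[OF V W.module_axioms lin], use f x s in \<open>auto simp flip: W.comp_finsum\<close>)
    moreover have "f n = \<zero>\<^bsub>V\<^esub>" if "W.comp n (\<nu> x) = \<zero>\<^bsub>W\<^esub>" for n
      by (rule inj_onD[OF inj]) (use that f s in auto)
    ultimately have "is_decomposition V x f"
      using f x s by (intro is_decompositionI[OF V]) (auto simp: grade)
    moreover have "g = f" if "is_decomposition V x g" for g
    proof
      fix n
      have g: "g n \<in> carrier V" using that grade by (auto simp: is_decomposition_def)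
      have "\<nu> (g n) = W.comp n (\<nu> x)"
        using W.comp_unique[OF decomposition_map[OF V _ W map that], of n] grade by auto
      then show "g n = f n" using inj f g by (auto simp: inj_on_def)
    qed
    ultimately show "\<exists>!f. is_decomposition V x f" by blast
  qed
qed

definition graded_subspace :: "'a set \<Rightarrow> ('k::field_char_0, 'a, 'm) graded_space_scheme \<Rightarrow> bool" where
  "graded_subspace S V \<longleftrightarrow> submodule S (scalars :: 'k ring) V \<and> (\<forall>x\<in>S. \<forall>n. homog_component V n x \<in> S)"

definition subspace_of :: "('k, 'a, 'm) graded_space_scheme \<Rightarrow> 'a set \<Rightarrow> ('k, 'a, 'm) graded_space_scheme" where
  "subspace_of V S = V\<lparr>carrier := S, grade := \<lambda>n. grade V n \<inter> S\<rparr>"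

lemma subspace_of_simps [simp]:
  "carrier (subspace_of V S) = S" "grade (subspace_of V S) n = grade V n \<inter> S"
  "add (subspace_of V S) = add V" "zero (subspace_of V S) = zero V" "smult (subspace_of V S) = smult V"
  by (simp_all add: subspace_of_def)

context graded_space
begin

lemma graded_subspaceD:
  assumes "graded_subspace S V"
  shows "submodule S (scalars :: 'k ring) V" "x \<in> S \<Longrightarrow> comp n x \<in> S" "x \<in> S \<Longrightarrow> x \<in> carrier V" "\<zero> \<in> S"
    "x \<in> S \<Longrightarrow> y \<in> S \<Longrightarrow> x \<oplus> y \<in> S" "x \<in> S \<Longrightarrow> c \<odot> x \<in> S" "S \<subseteq> carrier V"
  using assms submoduleD[of S] by (auto simp: graded_subspace_def)

lemma graded_subspaceI:
  assumes "S \<subseteq> carrier V" "\<zero> \<in> S" "\<And>x y. x \<in> S \<Longrightarrow> y \<in> S \<Longrightarrow> x \<oplus> y \<in> S" "\<And>c x. x \<in> S \<Longrightarrow> c \<odot> x \<in> S"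
    "\<And>n x. x \<in> S \<Longrightarrow> comp n x \<in> S"
  shows "graded_subspace S V"
  using assms by (simp add: graded_subspace_def submodule_iff)

lemma graded_space_subspace:
  assumes "graded_subspace S V"
  shows "graded_space (subspace_of V S)"
  by (rule graded_space_transport[OF graded_space_axioms, of "\<lambda>x. x"])
    (use graded_subspaceD[OF assms] in \<open>auto intro!: linear_mapI\<close>)

lemma graded_map_subspace_inclusion:
  assumes "graded_subspace S V"
  shows "graded_map 0 (subspace_of V S) V (\<lambda>x. x)"
  using graded_subspaceD[OF assms] by (auto intro!: graded_mapI linear_mapI)

lemma comp_subspace:
  assumes "graded_subspace S V" "x \<in> S"
  shows "homog_component (subspace_of V S) n x = comp n x"
  using graded_map_comp[OF graded_space_subspace graded_space_axioms graded_map_subspace_inclusion] assms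
  by fastforce

lemma graded_subspace_preimage:
  assumes W: "graded_space W" and h: "graded_map k V W h" and S: "graded_subspace S W"
  shows "graded_subspace {x \<in> carrier V. h x \<in> S} V"
proof -
  interpret W: graded_space W by fact
  note S' = W.graded_subspaceD[OF S] and lin = linear_mapD[OF graded_mapD(1)[OF h]]
  show ?thesis
    by (rule graded_subspaceI)
      (auto simp: S' lin linear_map_zero[OF module_axioms W.module_axioms graded_mapD(1)[OF h]]
        graded_map_comp[OF graded_space_axioms W h])
qed

end

text \<open>
  Decompositions are unique because both projections are graded maps.
\<close>

lemma graded_space_direct_sum:
  assumes V: "graded_space V" and W: "graded_space W"
  shows "graded_space (direct_sum V W)"
proof -
  interpret V: graded_space V by fact
  interpret W: graded_space W by fact
  let ?S = "direct_sum V W"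
  have [simp]: "(- 1) \<odot>\<^bsub>V\<^esub> x \<oplus>\<^bsub>V\<^esub> x = \<zero>\<^bsub>V\<^esub>" if "x \<in> carrier V" for x
    using V.smult_plus[of x "- 1" 1] that by simp
  have [simp]: "(- 1) \<odot>\<^bsub>W\<^esub> x \<oplus>\<^bsub>W\<^esub> x = \<zero>\<^bsub>W\<^esub>" if "x \<in> carrier W" for x
    using W.smult_plus[of x "- 1" 1] that by simp
  have S: "module scalars ?S"
    by (rule scalar_moduleI)
      (auto simp: direct_sum_def V.a_assoc W.a_assoc V.smult_add W.smult_add V.smult_plus
        W.smult_plus V.smult_smult W.smult_smult intro: V.a_comm W.a_comm)
  interpret S: scalar_module ?S using S by (simp add: scalar_module_def)
  have fst: "graded_map 0 ?S V fst" and snd: "graded_map 0 ?S W snd"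
    by (auto intro!: graded_mapI linear_mapI simp: direct_sum_def)
  show ?thesis
  proof (rule graded_space.intro[OF S graded_space_axioms.intro])
    show "submodule (grade ?S n) scalars ?S" for n
      by (auto simp: S.submodule_iff) (auto simp: direct_sum_def V.grade_add W.grade_add V.grade_smult W.grade_smult)
    have sub: "grade ?S n \<subseteq> carrier ?S" for n by (auto simp: direct_sum_def)
    fix x assume x: "x \<in> carrier ?S"
    then have xs: "fst x \<in> carrier V" "snd x \<in> carrier W" by (auto simp: direct_sum_def)
    define f where "f n = (V.comp n (fst x), W.comp n (snd x))" for n
    let ?A = "{n. V.comp n (fst x) \<noteq> \<zero>\<^bsub>V\<^esub>} \<union> {n. W.comp n (snd x) \<noteq> \<zero>\<^bsub>W\<^esub>}"
    have fin: "finite ?A" using V.comp_finite W.comp_finite xs by simp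
    have f: "f n \<in> grade ?S n" "f n \<in> carrier ?S" for n using xs by (auto simp: f_def direct_sum_def)
    have "fst x = finsum V (\<lambda>n. V.comp n (fst x)) ?A"
      by (subst V.comp_finsum[OF xs(1)], rule V.finsum_superset) (use fin xs in auto)
    moreover have "snd x = finsum W (\<lambda>n. W.comp n (snd x)) ?A"
      by (subst W.comp_finsum[OF xs(2)], rule W.finsum_superset) (use fin xs in auto)
    ultimately have eq: "x = finsum ?S f ?A"
      using linear_map_finsum[OF S V.module_axioms graded_mapD(1)[OF fst], of f ?A]
        linear_map_finsum[OF S W.module_axioms graded_mapD(1)[OF snd], of f ?A] f
      by (intro prod_eqI) (simp_all add: f_def)
    have "f n = \<zero>\<^bsub>?S\<^esub>" if "n \<notin> ?A" for n using that by (simp add: f_def direct_sum_def)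
    from is_decompositionI[OF S f fin this eq] have "is_decomposition ?S x f" .
    moreover have "g = f" if g: "is_decomposition ?S x g" for g
    proof
      fix n show "g n = f n"
        using V.comp_unique[OF decomposition_map[OF S sub V fst g], of n]
          W.comp_unique[OF decomposition_map[OF S sub W snd g], of n] by (simp add: f_def prod_eq_iff)
    qed
    ultimately show "\<exists>!f. is_decomposition ?S x f" by blast
  qed
qed

section \<open>Homogeneous bases\<close>

definition lincomb :: "('k::field_char_0, 'a, 'm) module_scheme \<Rightarrow> ('a \<Rightarrow>\<^sub>0 'k) \<Rightarrow> 'a" where
  "lincomb V f = (\<Oplus>\<^bsub>V\<^esub>b\<in>keys f. lookup f b \<odot>\<^bsub>V\<^esub> b)"

definition independent :: "('k::field_char_0, 'a, 'm) module_scheme \<Rightarrow> 'a set \<Rightarrow> bool" where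
  "independent V B \<longleftrightarrow> B \<subseteq> carrier V \<and> (\<forall>f. keys f \<subseteq> B \<and> lincomb V f = \<zero>\<^bsub>V\<^esub> \<longrightarrow> f = 0)"

definition span_of :: "('k::field_char_0, 'a, 'm) module_scheme \<Rightarrow> 'a set \<Rightarrow> 'a set" where
  "span_of V B = lincomb V ` {f. keys f \<subseteq> B}"

context scalar_module
begin

lemma lincomb_superset:
  assumes "finite A" "keys f \<subseteq> A" "A \<subseteq> carrier V"
  shows "lincomb V f = (\<Oplus>b\<in>A. lookup f b \<odot> b)"
  unfolding lincomb_def by (rule finsum_superset) (use assms in \<open>auto simp: in_keys_iff subset_iff\<close>)

lemma lincomb_mem [simp]: "keys f \<subseteq> carrier V \<Longrightarrow> lincomb V f \<in> carrier V"
  unfolding lincomb_def by (auto intro!: finsum_closed)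

lemma lincomb_zero [simp]: "lincomb V 0 = \<zero>"
  by (simp add: lincomb_def)

lemma lincomb_add:
  assumes "keys f \<subseteq> carrier V" "keys g \<subseteq> carrier V"
  shows "lincomb V (f + g) = lincomb V f \<oplus> lincomb V g"
proof -
  let ?A = "keys f \<union> keys g"
  have A: "finite ?A" "?A \<subseteq> carrier V" using assms by auto
  have "lincomb V (f + g) = (\<Oplus>b\<in>?A. lookup (f + g) b \<odot> b)"
    by (rule lincomb_superset) (use A keys_add[of f g] in auto)
  also have "\<dots> = (\<Oplus>b\<in>?A. lookup f b \<odot> b \<oplus> lookup g b \<odot> b)"
    using A(2) by (intro finsum_cong') (auto simp: lookup_add smult_plus)
  also have "\<dots> = lincomb V f \<oplus> lincomb V g"
    using A by (subst finsum_addf) (auto simp: lincomb_superset[of ?A])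
  finally show ?thesis .
qed

lemma lincomb_scl:
  assumes "keys f \<subseteq> carrier V"
  shows "lincomb V (scl c f) = c \<odot> lincomb V f"
proof -
  have "lincomb V (scl c f) = (\<Oplus>b\<in>keys f. lookup (scl c f) b \<odot> b)"
    by (rule lincomb_superset) (use assms keys_scl[of c f] in auto)
  also have "\<dots> = (\<Oplus>b\<in>keys f. c \<odot> (lookup f b \<odot> b))"
    using assms by (intro finsum_cong') (auto simp: smult_smult)
  also have "\<dots> = c \<odot> lincomb V f"
    unfolding lincomb_def using assms by (intro finsum_smult_ldistr[symmetric]) auto
  finally show ?thesis .
qed

lemma lincomb_single [simp]: "b \<in> carrier V \<Longrightarrow> lincomb V (single b c) = c \<odot> b"
  by (simp add: lincomb_def)

lemma lincomb_minus: "keys f \<subseteq> carrier V \<Longrightarrow> lincomb V (- f) = \<ominus> lincomb V f"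
  using lincomb_scl[of f "- 1"] by (simp add: minus_eq_smult)

lemma span_of_submodule:
  assumes "B \<subseteq> carrier V"
  shows "submodule (span_of V B) (scalars :: 'k ring) V"
proof -
  have sub: "keys f \<subseteq> carrier V" if "keys f \<subseteq> B" for f :: "'a \<Rightarrow>\<^sub>0 'k" using that assms by blast
  have "lincomb V f \<oplus> lincomb V g \<in> span_of V B" if "keys f \<subseteq> B" "keys g \<subseteq> B" for f g
    using that keys_add[of f g] sub[of f] sub[of g] unfolding span_of_def
    by (intro image_eqI[of _ _ "f + g"]) (auto simp: lincomb_add)
  moreover have "c \<odot> lincomb V f \<in> span_of V B" if "keys f \<subseteq> B" for f c
    using that keys_scl[of c f] sub[of f] unfolding span_of_def
    by (intro image_eqI[of _ _ "scl c f"]) (auto simp: lincomb_scl)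
  moreover have "\<zero> \<in> span_of V B"
    unfolding span_of_def by (intro image_eqI[of _ _ 0]) auto
  ultimately show ?thesis
    using sub by (auto simp: submodule_iff) (auto simp: span_of_def)
qed

lemma span_of_superset: "B \<subseteq> carrier V \<Longrightarrow> b \<in> B \<Longrightarrow> b \<in> span_of V B"
  unfolding span_of_def by (intro image_eqI[of _ _ "single b 1"]) auto

lemma independent_insert:
  assumes B: "independent V B" and s: "s \<in> carrier V" "s \<notin> span_of V B"
  shows "independent V (insert s B)"
  unfolding independent_def
proof (intro conjI allI impI)
  show "insert s B \<subseteq> carrier V" using B s by (simp add: independent_def)
  fix f :: "'a \<Rightarrow>\<^sub>0 'k" assume f: "keys f \<subseteq> insert s B \<and> lincomb V f = \<zero>"
  define c where "c = lookup f s"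
  define g where "g = f - single s c"
  have "keys g \<subseteq> insert s B" using f keys_diff[of f "single s c"] by (auto simp: g_def split: if_splits)
  moreover have "s \<notin> keys g" by (simp add: g_def c_def in_keys_iff lookup_minus)
  ultimately have g: "keys g \<subseteq> B" by blast
  have gB: "keys g \<subseteq> carrier V" using g B by (auto simp: independent_def)
  have eq: "f = g + single s c" by (simp add: g_def)
  have zero: "lincomb V g \<oplus> c \<odot> s = \<zero>"
    using f s gB by (subst lincomb_single[symmetric], simp, subst lincomb_add[symmetric]) (auto simp flip: eq)
  show "f = 0"
  proof (cases "c = 0")
    case True
    then have "f = g" by (simp add: g_def)
    then show ?thesis using f g B by (auto simp: independent_def)
  next
    case False
    have "c \<odot> s = \<ominus> lincomb V g"
      using zero gB s by (metis a_comm lincomb_mem minus_equality smult_mem minus_minus)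
    then have "lincomb V (- g) = c \<odot> s" using gB by (simp add: lincomb_minus)
    then have "lincomb V (scl (1 / c) (- g)) = s"
      using gB s False by (subst lincomb_scl) (auto simp: smult_smult)
    moreover have "keys (scl (1 / c) (- g)) \<subseteq> B" using keys_scl[of "1 / c" "- g"] g by simp
    ultimately have "s \<in> span_of V B" unfolding span_of_def by (intro image_eqI[of _ _ "scl (1 / c) (- g)"]) auto
    then show ?thesis using s by simp
  qed
qed

lemma independent_Union_chain:
  assumes chain: "subset.chain {B. independent V B} \<C>"
  shows "independent V (\<Union>\<C>)"
  unfolding independent_def
proof (intro conjI allI impI)
  have ind: "independent V B" if "B \<in> \<C>" for B using chain that by (auto simp: subset.chain_def)
  then show "\<Union>\<C> \<subseteq> carrier V" by (auto simp: independent_def)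
  fix f :: "'a \<Rightarrow>\<^sub>0 'k" assume f: "keys f \<subseteq> \<Union>\<C> \<and> lincomb V f = \<zero>"
  show "f = 0"
  proof (cases "\<C> = {}")
    case False
    then obtain B where "B \<in> \<C>" "keys f \<subseteq> B"
      using finite_subset_Union_chain[OF _ _ False chain] f by (metis finite_keys)
    then show ?thesis using ind f by (auto simp: independent_def)
  qed (use f in auto)
qed

text \<open>
  Zorn's lemma, in the relative form: \<open>B\<close> is a maximal independent set between \<open>B0\<close> and \<open>S\<close>. Taking
  homogeneous elements for \<open>S\<close> yields homogeneous bases, and \<open>B0\<close> allows for bases adapted to a filtration.
\<close>

lemma extend_independent:
  assumes B0: "independent V B0" "B0 \<subseteq> S" and S: "S \<subseteq> carrier V"
  obtains B where "independent V B" "B0 \<subseteq> B" "B \<subseteq> S" "S \<subseteq> span_of V B"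
proof -
  define \<A> where "\<A> = {B. independent V B \<and> B0 \<subseteq> B \<and> B \<subseteq> S}"
  have "\<exists>M\<in>\<A>. \<forall>X\<in>\<A>. M \<subseteq> X \<longrightarrow> X = M"
  proof (rule subset_Zorn_nonempty)
    show "\<A> \<noteq> {}" using B0 by (auto simp: \<A>_def)
    fix \<C> assume C: "\<C> \<noteq> {}" "subset.chain \<A> \<C>"
    then have "independent V (\<Union>\<C>)"
      by (intro independent_Union_chain) (auto simp: subset.chain_def \<A>_def)
    then show "\<Union>\<C> \<in> \<A>" using C by (auto simp: \<A>_def subset.chain_def)
  qed
  then obtain B where B: "independent V B" "B0 \<subseteq> B" "B \<subseteq> S"
    and max: "\<And>X. X \<in> \<A> \<Longrightarrow> B \<subseteq> X \<Longrightarrow> X = B" by (auto simp: \<A>_def)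
  have "s \<in> span_of V B" if s: "s \<in> S" for s
  proof (rule ccontr)
    assume n: "s \<notin> span_of V B"
    then have "independent V (insert s B)" using independent_insert[OF B(1)] s S by blast
    then have "insert s B \<in> \<A>" using B s by (auto simp: \<A>_def)
    then have "s \<in> B" using max[of "insert s B"] by blast
    then show False using n span_of_superset B(1) by (auto simp: independent_def)
  qed
  then show thesis using that B by blast
qed

lemma lincomb_sum:
  assumes "\<And>a. a \<in> A \<Longrightarrow> keys (f a) \<subseteq> carrier V"
  shows "lincomb V (\<Sum>a\<in>A. f a) = (\<Oplus>a\<in>A. lincomb V (f a)) \<and> keys (\<Sum>a\<in>A. f a) \<subseteq> carrier V"
  using assms
proof (induction A rule: infinite_finite_induct)
  case (insert a A)
  then have IH: "lincomb V (\<Sum>a\<in>A. f a) = (\<Oplus>a\<in>A. lincomb V (f a))" "keys (\<Sum>a\<in>A. f a) \<subseteq> carrier V"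
    by auto
  have "(\<Oplus>a\<in>insert a A. lincomb V (f a)) = lincomb V (f a) \<oplus> (\<Oplus>a\<in>A. lincomb V (f a))"
    using insert by (intro finsum_insert) (auto intro!: lincomb_mem)
  moreover have "keys (f a + (\<Sum>a\<in>A. f a)) \<subseteq> carrier V"
    using keys_add[of "f a" "\<Sum>a\<in>A. f a"] IH(2) insert.prems by blast
  ultimately show ?case using insert IH by (simp add: lincomb_add)
qed (simp_all add: add.finprod_infinite)

end

locale homogeneous_basis = graded_space V
  for V :: "('k::field_char_0, 'a, 'm) graded_space_scheme" (structure) +
  fixes B :: "'a set" and d :: "'a \<Rightarrow> int"
  assumes indep: "independent V B"
    and basis_grade: "b \<in> B \<Longrightarrow> b \<in> grade V (d b)"
    and grade_span: "grade V n \<subseteq> span_of V B"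
begin

definition coord :: "'a \<Rightarrow> 'a \<Rightarrow>\<^sub>0 'k" where
  "coord x = (THE f. keys f \<subseteq> B \<and> lincomb V f = x)"

lemma basis_carrier: "B \<subseteq> carrier V"
  using indep by (simp add: independent_def)

lemma carrier_span: "x \<in> carrier V \<Longrightarrow> x \<in> span_of V B"
  using comp_mem_submodule[OF span_of_submodule[OF basis_carrier]] grade_span comp_grade by blast

lemma lincomb_inj:
  assumes "keys f \<subseteq> B" "keys g \<subseteq> B" "lincomb V f = lincomb V g"
  shows "f = g"
proof -
  have fg: "keys f \<subseteq> carrier V" "keys g \<subseteq> carrier V" using assms basis_carrier by auto
  have "lincomb V (f + - g) = \<zero>"
    using fg assms(3) by (subst lincomb_add) (auto simp: lincomb_minus r_neg)
  moreover have "keys (f + - g) \<subseteq> B" using keys_add[of f "- g"] assms by auto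
  ultimately have "f + - g = 0" using indep by (auto simp: independent_def)
  then show ?thesis by simp
qed

lemma coord_unique: "keys f \<subseteq> B \<Longrightarrow> coord (lincomb V f) = f"
  unfolding coord_def using lincomb_inj by (intro the_equality) auto

lemma coord_keys: "x \<in> carrier V \<Longrightarrow> keys (coord x) \<subseteq> B"
  and lincomb_coord [simp]: "x \<in> carrier V \<Longrightarrow> lincomb V (coord x) = x"
  using carrier_span[of x] by (auto simp: span_of_def coord_unique)

lemma coord_keys_carrier: "x \<in> carrier V \<Longrightarrow> keys (coord x) \<subseteq> carrier V"
  using coord_keys basis_carrier by blast

lemma coord_add: "x \<in> carrier V \<Longrightarrow> y \<in> carrier V \<Longrightarrow> coord (x \<oplus> y) = coord x + coord y"
  using coord_unique[of "coord x + coord y"] keys_add[of "coord x" "coord y"] coord_keys[of x] coord_keys[of y]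
  by (simp add: lincomb_add coord_keys_carrier) (metis Un_least order_trans)

lemma coord_smult: "x \<in> carrier V \<Longrightarrow> coord (c \<odot> x) = scl c (coord x)"
  using coord_unique[of "scl c (coord x)"] keys_scl[of c "coord x"] coord_keys[of x]
  by (simp add: lincomb_scl coord_keys_carrier)

lemma coord_zero [simp]: "coord \<zero> = 0"
  using coord_unique[of 0] by simp

lemma coord_basis [simp]: "b \<in> B \<Longrightarrow> coord b = single b 1"
  using coord_unique[of "single b 1"] basis_carrier by auto

lemma coord_inj: "x \<in> carrier V \<Longrightarrow> y \<in> carrier V \<Longrightarrow> coord x = coord y \<Longrightarrow> x = y"
  by (metis lincomb_coord)

lemma lincomb_grade:
  assumes "keys f \<subseteq> B" "\<And>b. b \<in> keys f \<Longrightarrow> d b = n"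
  shows "lincomb V f \<in> grade V n"
  unfolding lincomb_def
  by (rule finsum_mem[OF grade_submodule]) (use assms basis_grade in \<open>auto intro!: grade_smult\<close>)

text \<open>
  Grouping the coordinates by degree gives a decomposition of \<open>x\<close> into homogeneous elements, which has to
  be the trivial one. So no basis element of another degree occurs.
\<close>

lemma coord_grade:
  assumes "x \<in> grade V n" "b \<in> keys (coord x)"
  shows "d b = n"
proof -
  have x: "x \<in> carrier V" using assms by simp
  define f where "f k = filt {b. d b = k} (coord x)" for k
  have f: "keys (f k) \<subseteq> B" for k using coord_keys[OF x] by (auto simp: f_def)
  then have fc: "keys (f k) \<subseteq> carrier V" for k using basis_carrier by blast
  have "(\<Sum>k\<in>d ` keys (coord x). f k) = coord x"
    by (rule poly_mapping_eqI) (auto simp: f_def lookup_sum in_keys_iff)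
  then have "x = (\<Oplus>k\<in>d ` keys (coord x). lincomb V (f k))"
    using lincomb_sum[of "d ` keys (coord x)" f] fc x by simp
  moreover have "lincomb V (f k) = \<zero>" if "k \<notin> d ` keys (coord x)" for k
  proof -
    have "f k = 0" unfolding f_def by (rule filt_zero) (use that in auto)
    then show ?thesis by simp
  qed
  moreover have g: "lincomb V (f k) \<in> grade V k" for k
    by (rule lincomb_grade[OF f]) (auto simp: f_def)
  ultimately have "is_decomposition V x (\<lambda>k. lincomb V (f k))"
    by (intro is_decompositionI[OF module_axioms g grade_mem[OF g], of "d ` keys (coord x)"]) auto
  then have "lincomb V (f (d b)) = comp (d b) x" using comp_unique by metis
  moreover have "f (d b) \<noteq> 0"
    using assms(2) by (auto simp: f_def poly_mapping_eq_iff fun_eq_iff in_keys_iff)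
  then have "lincomb V (f (d b)) \<noteq> \<zero>" using f indep by (auto simp: independent_def)
  ultimately show ?thesis using comp_homogeneous[OF assms(1)] by metis
qed

lemma grade_iff: "x \<in> grade V n \<longleftrightarrow> x \<in> carrier V \<and> (\<forall>b\<in>keys (coord x). d b = n)"
  using coord_grade lincomb_grade[OF coord_keys, of x n] by fastforce

lemma linear_coord:
  assumes "\<And>x y. x \<in> carrier V \<Longrightarrow> y \<in> carrier V \<Longrightarrow> h (x \<oplus> y) = h x + h y"
    and "\<And>c x. x \<in> carrier V \<Longrightarrow> h (c \<odot> x) = scl c (h x)" and x: "x \<in> carrier V"
  shows "h x = lin h (coord x)"
proof -
  have zero: "h \<zero> = 0" using assms(2)[of "\<zero>" 0] by simp
  have "h (lincomb V f) = lin h f" if "keys f \<subseteq> carrier V" for f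
    using that by (induction rule: poly_mapping_linear_induct) (simp_all add: zero assms lincomb_add lin_add)
  from this[OF coord_keys_carrier[OF x]] show ?thesis using x by simp
qed

definition basis_projection :: "'a set \<Rightarrow> 'a \<Rightarrow> 'a" where
  "basis_projection A x = lincomb V (filt A (coord x))"

lemma coord_basis_projection: "x \<in> carrier V \<Longrightarrow> coord (basis_projection A x) = filt A (coord x)"
  unfolding basis_projection_def by (rule coord_unique) (use coord_keys in auto)

lemma basis_projection_mem [simp]: "x \<in> carrier V \<Longrightarrow> basis_projection A x \<in> carrier V"
  unfolding basis_projection_def by (rule lincomb_mem) (use coord_keys basis_carrier in auto)

lemma graded_map_basis_projection: "graded_map 0 V V (basis_projection A)"
proof (intro graded_mapI linear_mapI)
  fix x y c assume x: "x \<in> carrier V" and y: "y \<in> carrier V"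
  show "basis_projection A (x \<oplus> y) = basis_projection A x \<oplus> basis_projection A y"
    by (rule coord_inj) (use x y in \<open>simp_all add: coord_basis_projection coord_add linear_pm_add\<close>)
  show "basis_projection A (c \<odot> x) = c \<odot> basis_projection A x"
    by (rule coord_inj) (use x in \<open>simp_all add: coord_basis_projection coord_smult linear_pm_scl\<close>)
next
  show "x \<in> grade V n \<Longrightarrow> basis_projection A x \<in> grade V (n + 0)" for x n
    by (simp add: grade_iff coord_basis_projection)
qed simp

lemma basis_projection_id: "x \<in> carrier V \<Longrightarrow> keys (coord x) \<subseteq> A \<Longrightarrow> basis_projection A x = x"
  by (simp add: basis_projection_def filt_id)

lemma basis_projection_zero: "x \<in> carrier V \<Longrightarrow> keys (coord x) \<inter> A = {} \<Longrightarrow> basis_projection A x = \<zero>"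
  by (simp add: basis_projection_def filt_zero)

lemma graded_subspace_coord: "graded_subspace {x \<in> carrier V. keys (coord x) \<subseteq> A} V"
proof -
  have "{x \<in> carrier V. keys (coord x) \<subseteq> A} = {x \<in> carrier V. basis_projection (- A) x \<in> {\<zero>}}" (is "?L = ?R")
  proof (intro equalityI subsetI)
    fix x assume "x \<in> ?R"
    then have "x \<in> carrier V" "filt (- A) (coord x) = 0" using coord_basis_projection[of x "- A"] by auto
    moreover from this have "keys (filt (- A) (coord x)) = {}" by simp
    ultimately show "x \<in> ?L" unfolding keys_filt by auto
  qed (auto intro: basis_projection_zero)
  moreover have "graded_subspace {\<zero>} V"
    by (rule graded_subspaceI) auto
  ultimately show ?thesis
    using graded_subspace_preimage[OF graded_space_axioms graded_map_basis_projection, of "{\<zero>}" "- A"]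
    by simp
qed

end

lemma (in graded_space) extend_homogeneous_basis:
  assumes "independent V B0" "B0 \<subseteq> (\<Union>n. grade V n)"
  obtains B d where "homogeneous_basis V B d" "B0 \<subseteq> B"
proof -
  have "(\<Union>n. grade V n) \<subseteq> carrier V" by (auto dest: grade_mem)
  from extend_independent[OF assms this] obtain B where B: "independent V B" "B0 \<subseteq> B"
    "B \<subseteq> (\<Union>n. grade V n)" "(\<Union>n. grade V n) \<subseteq> span_of V B" by blast
  then have "\<forall>b\<in>B. \<exists>n. b \<in> grade V n" by blast
  then obtain d where "\<forall>b\<in>B. b \<in> grade V (d b)" by metis
  moreover have "grade V n \<subseteq> span_of V B" for n using B(4) by (simp add: UN_subset_iff)
  ultimately have "homogeneous_basis V B d" using B(1)
    by (intro homogeneous_basis.intro graded_space_axioms homogeneous_basis_axioms.intro) auto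
  then show thesis using that B by blast
qed

lemma (in graded_space) homogeneous_basis_exists: obtains B d where "homogeneous_basis V B d"
  using extend_homogeneous_basis[of "{}"] by (auto simp: independent_def)

section \<open>Graded Lie algebras\<close>

text \<open>
  The axioms of graded Lie algebras are reflected by embeddings, like those of graded spaces.
\<close>

lemma graded_lie_transport:
  fixes V :: "('k::field_char_0, 'a, 'm) graded_lie_scheme"
  assumes W: "graded_lie_algebra W"
    and inj: "inj_on \<nu> (carrier V)" and lin: "linear_map V W \<nu>" and zero: "\<zero>\<^bsub>V\<^esub> \<in> carrier V" "\<nu> \<zero>\<^bsub>V\<^esub> = \<zero>\<^bsub>W\<^esub>"
    and add: "\<And>x y. x \<in> carrier V \<Longrightarrow> y \<in> carrier V \<Longrightarrow> x \<oplus>\<^bsub>V\<^esub> y \<in> carrier V"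
    and smult: "\<And>c x. x \<in> carrier V \<Longrightarrow> c \<odot>\<^bsub>V\<^esub> x \<in> carrier V"
    and grade: "\<And>n. grade V n = {x \<in> carrier V. \<nu> x \<in> grade W n}"
    and comp: "\<And>n x. x \<in> carrier V \<Longrightarrow> homog_component W n (\<nu> x) \<in> \<nu> ` carrier V"
    and bracket: "\<And>x y. x \<in> carrier V \<Longrightarrow> y \<in> carrier V \<Longrightarrow> bracket V x y \<in> carrier V"
      "\<And>x y. x \<in> carrier V \<Longrightarrow> y \<in> carrier V \<Longrightarrow> \<nu> (bracket V x y) = bracket W (\<nu> x) (\<nu> y)"
  shows "graded_lie_algebra V"
proof -
  interpret W: graded_lie_algebra W by fact
  have "graded_space V"
    by (rule graded_space_transport[OF W.graded_space_axioms inj lin zero add smult grade comp])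
  then interpret V: graded_space V .
  have minus [simp]: "\<nu> (\<ominus>\<^bsub>V\<^esub> x) = \<ominus>\<^bsub>W\<^esub> \<nu> x" if "x \<in> carrier V" for x
    unfolding V.minus_eq_smult[OF that] W.minus_eq_smult[OF linear_mapD(1)[OF lin that]]
    by (rule linear_mapD(3)[OF lin that])
  note s = linear_mapD[OF lin] add smult bracket
    linear_mapD[OF W.bracket_linear_left] linear_mapD[OF W.bracket_linear_right]
  have g: "x \<in> carrier V" "\<nu> x \<in> grade W n" if "x \<in> grade V n" for x n
    using that[unfolded grade] by simp_all
  show ?thesis
  proof (unfold_locales; (intro linear_mapI)?; (intro inj_onD[OF inj])?)
    fix x y i j assume x: "x \<in> grade V i" and y: "y \<in> grade V j"
    show "bracket V x y \<in> grade V (i + j)"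
      unfolding grade using g(1)[OF x] g(1)[OF y] W.bracket_grade[OF g(2)[OF x] g(2)[OF y]] by (simp add: s)
    show "\<nu> (bracket V x y) = \<nu> (\<ominus>\<^bsub>V\<^esub> (koszul_sign (i * j) \<odot>\<^bsub>V\<^esub> bracket V y x))"
      using g[OF x] g[OF y] W.graded_antisymmetry[OF g(2)[OF x] g(2)[OF y]] by (simp add: s)
    fix z k assume z: "z \<in> grade V k"
    show "\<nu> (bracket V x (bracket V y z)) = \<nu> (bracket V (bracket V x y) z \<oplus>\<^bsub>V\<^esub>
        koszul_sign (i * j) \<odot>\<^bsub>V\<^esub> bracket V y (bracket V x z))"
      using g[OF x] g[OF y] g[OF z] W.graded_jacobi[OF g(2)[OF x] g(2)[OF y] g(2)[OF z]] by (simp add: s)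
  qed (auto simp: s dest!: g)
qed

lemma (in graded_lie_algebra) bracket_simps [simp]:
  "x \<in> carrier L \<Longrightarrow> y \<in> carrier L \<Longrightarrow> bracket L x y \<in> carrier L"
  "x \<in> carrier L \<Longrightarrow> y \<in> carrier L \<Longrightarrow> z \<in> carrier L \<Longrightarrow>
    bracket L (x \<oplus> y) z = bracket L x z \<oplus> bracket L y z"
  "x \<in> carrier L \<Longrightarrow> y \<in> carrier L \<Longrightarrow> bracket L (c \<odot> x) y = c \<odot> bracket L x y"
  "x \<in> carrier L \<Longrightarrow> y \<in> carrier L \<Longrightarrow> z \<in> carrier L \<Longrightarrow>
    bracket L z (x \<oplus> y) = bracket L z x \<oplus> bracket L z y"
  "x \<in> carrier L \<Longrightarrow> y \<in> carrier L \<Longrightarrow> bracket L y (c \<odot> x) = c \<odot> bracket L y x"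
  using linear_mapD[OF bracket_linear_left] linear_mapD[OF bracket_linear_right] by auto

lemma (in graded_lie_algebra) bracket_zero [simp]:
  "x \<in> carrier L \<Longrightarrow> bracket L x \<zero> = \<zero>" "x \<in> carrier L \<Longrightarrow> bracket L \<zero> x = \<zero>"
  using bracket_simps(5)[of \<zero> x 0] bracket_simps(3)[of \<zero> x 0] by simp_all

lemma graded_lie_subalgebra_iff:
  "graded_lie_subalgebra S L \<longleftrightarrow> graded_subspace S L \<and> (\<forall>x\<in>S. \<forall>y\<in>S. bracket L x y \<in> S)"
  by (auto simp: graded_lie_subalgebra_def graded_subspace_def)

lemma bracket_subspace_of [simp]: "bracket (subspace_of L S) = bracket L"
  by (simp add: subspace_of_def)

definition lie_generated :: "('k::field_char_0, 'a, 'm) graded_lie_scheme \<Rightarrow> 'a set \<Rightarrow> 'a set" where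
  "lie_generated L G = \<Inter>{S. graded_lie_subalgebra S L \<and> G \<subseteq> S}"

lemma free_lie_eq:
  "free_lie V = subspace_of (commutator_lie (tensor_algebra V))
    (lie_generated (commutator_lie (tensor_algebra V)) (tensor_inc V ` carrier V))"
  by (simp add: free_lie_def subspace_of_def lie_generated_def Let_def)

lemma lie_generated_subset: "G \<subseteq> lie_generated L G"
  and lie_generated_least: "graded_lie_subalgebra S L \<Longrightarrow> G \<subseteq> S \<Longrightarrow> lie_generated L G \<subseteq> S"
  and lie_generated_mono: "G \<subseteq> H \<Longrightarrow> lie_generated L G \<subseteq> lie_generated L H"
  by (auto simp: lie_generated_def)

context graded_lie_algebra
begin

lemma subalgebra_subspace:
  assumes "graded_lie_subalgebra S L"
  shows "graded_lie_algebra (subspace_of L S)"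
  by (rule graded_lie_transport[OF graded_lie_algebra_axioms, of "\<lambda>x. x"])
    (use assms graded_subspaceD[of S] in \<open>auto intro!: linear_mapI simp: graded_lie_subalgebra_iff\<close>)

lemma carrier_subalgebra: "graded_lie_subalgebra (carrier L) L"
  by (auto simp: graded_lie_subalgebra_iff intro!: graded_subspaceI)

lemma lie_generated_carrier: "G \<subseteq> carrier L \<Longrightarrow> lie_generated L G \<subseteq> carrier L"
  by (rule lie_generated_least[OF carrier_subalgebra])

lemma lie_generated_subalgebra:
  assumes G: "G \<subseteq> carrier L"
  shows "graded_lie_subalgebra (lie_generated L G) L"
proof -
  have *: "x \<in> S" if "x \<in> lie_generated L G" "graded_lie_subalgebra S L" "G \<subseteq> S" for x S
    using that by (auto simp: lie_generated_def)
  have "graded_subspace (lie_generated L G) L"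
  proof (rule graded_subspaceI)
    show "lie_generated L G \<subseteq> carrier L" by (rule lie_generated_carrier[OF G])
  qed (auto simp: lie_generated_def graded_lie_subalgebra_iff graded_subspaceD)
  then show ?thesis
    by (auto simp: graded_lie_subalgebra_iff) (auto simp: lie_generated_def graded_lie_subalgebra_iff)
qed

lemma lie_generated_induct [consumes 2, case_names generator zero add smult comp bracket]:
  assumes G: "G \<subseteq> carrier L" and x: "x \<in> lie_generated L G"
    and "\<And>x. x \<in> G \<Longrightarrow> P x" "P \<zero>"
    and "\<And>x y. x \<in> lie_generated L G \<Longrightarrow> y \<in> lie_generated L G \<Longrightarrow> P x \<Longrightarrow> P y \<Longrightarrow> P (x \<oplus> y)"
    and "\<And>c x. x \<in> lie_generated L G \<Longrightarrow> P x \<Longrightarrow> P (c \<odot> x)"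
    and "\<And>n x. x \<in> lie_generated L G \<Longrightarrow> P x \<Longrightarrow> P (comp n x)"
    and "\<And>x y. x \<in> lie_generated L G \<Longrightarrow> y \<in> lie_generated L G \<Longrightarrow> P x \<Longrightarrow> P y \<Longrightarrow> P (bracket L x y)"
  shows "P x"
proof -
  note sub = lie_generated_subalgebra[OF G, unfolded graded_lie_subalgebra_iff]
  note s = graded_subspaceD[OF conjunct1[OF sub]]
  let ?S = "{x \<in> lie_generated L G. P x}"
  have "graded_subspace ?S L"
    by (rule graded_subspaceI) (use s assms in auto)
  then have "graded_lie_subalgebra ?S L"
    using sub assms by (auto simp: graded_lie_subalgebra_iff)
  then have "lie_generated L G \<subseteq> ?S"
    by (rule lie_generated_least) (use lie_generated_subset[of G L] assms in auto)
  then show ?thesis using x by blast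
qed

lemma subalgebra_of_subspace:
  assumes S: "graded_lie_subalgebra S L" and T: "T \<subseteq> S"
  shows "graded_lie_subalgebra T (subspace_of L S) \<longleftrightarrow> graded_lie_subalgebra T L"
proof -
  have S': "graded_subspace S L" using S by (simp add: graded_lie_subalgebra_iff)
  interpret S: graded_lie_algebra "subspace_of L S" by (rule subalgebra_subspace[OF S])
  have "x \<in> S" if "x \<in> T" for x using that T by blast
  then show ?thesis
    using graded_subspaceD(7)[OF S'] T
    by (auto simp: graded_lie_subalgebra_iff graded_subspace_def submodule_iff S.submodule_iff comp_subspace[OF S'])
qed

end

lemma graded_lie_homD:
  assumes "graded_lie_hom A B f"
  shows "graded_map 0 A B f" "x \<in> carrier A \<Longrightarrow> y \<in> carrier A \<Longrightarrow> f (bracket A x y) = bracket B (f x) (f y)"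
    "x \<in> carrier A \<Longrightarrow> f x \<in> carrier B"
    "x \<in> carrier A \<Longrightarrow> y \<in> carrier A \<Longrightarrow> f (x \<oplus>\<^bsub>A\<^esub> y) = f x \<oplus>\<^bsub>B\<^esub> f y"
    "x \<in> carrier A \<Longrightarrow> f (c \<odot>\<^bsub>A\<^esub> x) = c \<odot>\<^bsub>B\<^esub> f x" "x \<in> grade A n \<Longrightarrow> f x \<in> grade B n"
  using assms linear_mapD[OF graded_mapD(1), of 0 A B f] graded_mapD(2)[of 0 A B f x n]
  by (auto simp: graded_lie_hom_def)

lemma graded_lie_homI:
  assumes "graded_map 0 A B f"
    "\<And>x y. x \<in> carrier A \<Longrightarrow> y \<in> carrier A \<Longrightarrow> f (bracket A x y) = bracket B (f x) (f y)"
  shows "graded_lie_hom A B f"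
  using assms by (simp add: graded_lie_hom_def)

lemma graded_lie_hom_compose:
  assumes f: "graded_lie_hom A B f" and g: "graded_lie_hom B C g"
  shows "graded_lie_hom A C (\<lambda>x. g (f x))"
  using graded_map_compose[OF graded_lie_homD(1)[OF f] graded_lie_homD(1)[OF g]]
  by (auto intro!: graded_lie_homI simp: graded_lie_homD[OF f] graded_lie_homD[OF g])

lemma graded_lie_hom_zero:
  assumes A: "graded_lie_algebra A" and B: "graded_lie_algebra B" and f: "graded_lie_hom A B f"
  shows "f \<zero>\<^bsub>A\<^esub> = \<zero>\<^bsub>B\<^esub>"
  using linear_map_zero[OF _ _ graded_mapD(1)[OF graded_lie_homD(1)[OF f]]] A B
  by (simp add: graded_lie_algebra_def graded_space_def)

lemma graded_lie_hom_comp: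
  assumes A: "graded_lie_algebra A" and B: "graded_lie_algebra B" and f: "graded_lie_hom A B f"
    and x: "x \<in> carrier A"
  shows "f (homog_component A n x) = homog_component B n (f x)"
  using graded_map_comp[OF _ _ graded_lie_homD(1)[OF f] x, of n] A B by (simp add: graded_lie_algebra_def)

lemma lie_hom_generated:
  assumes A: "graded_lie_algebra A" and B: "graded_lie_algebra B" and f: "graded_lie_hom A B f"
    and G: "G \<subseteq> carrier A" and S: "graded_lie_subalgebra S B" and fG: "f ` G \<subseteq> S"
    and x: "x \<in> lie_generated A G"
  shows "f x \<in> S"
proof -
  interpret A: graded_lie_algebra A by fact
  interpret B: graded_lie_algebra B by fact
  note s = B.graded_subspaceD[OF conjunct1[OF S[unfolded graded_lie_subalgebra_iff]]]
  have car: "y \<in> carrier A" if "y \<in> lie_generated A G" for y using A.lie_generated_carrier[OF G] that by blast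
  show ?thesis using G x
    by (induction rule: A.lie_generated_induct)
      (use fG S in \<open>auto simp: car s graded_lie_homD[OF f] graded_lie_hom_zero[OF A B f]
        graded_lie_hom_comp[OF A B f] graded_lie_subalgebra_iff\<close>)
qed

lemma (in graded_lie_algebra) lie_generated_in_subspace:
  assumes S: "graded_lie_subalgebra S L" and G: "G \<subseteq> S"
  shows "lie_generated (subspace_of L S) G = lie_generated L G"
proof -
  interpret S: graded_lie_algebra "subspace_of L S" by (rule subalgebra_subspace[OF S])
  have SL: "S \<subseteq> carrier L" using S graded_subspaceD(7) by (simp add: graded_lie_subalgebra_iff)
  have "lie_generated L G \<subseteq> S" by (rule lie_generated_least[OF S G])
  then have "graded_lie_subalgebra (lie_generated L G) (subspace_of L S)"
    using subalgebra_of_subspace[OF S] lie_generated_subalgebra G SL by blast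
  then have 1: "lie_generated (subspace_of L S) G \<subseteq> lie_generated L G"
    by (rule lie_generated_least[OF _ lie_generated_subset])
  have "lie_generated (subspace_of L S) G \<subseteq> S" using S.lie_generated_carrier G by simp
  then have "graded_lie_subalgebra (lie_generated (subspace_of L S) G) L"
    using subalgebra_of_subspace[OF S, of "lie_generated (subspace_of L S) G"]
      S.lie_generated_subalgebra[of G] G by simp
  from lie_generated_least[OF this lie_generated_subset] 1 show ?thesis by blast
qed

lemma (in graded_lie_algebra) bracket_comp_induct:
  assumes h: "linear_map L L (\<lambda>x. h x)" and S: "submodule S (scalars :: 'k ring) L"
    and x: "x \<in> carrier L" and comp: "\<And>n. h (comp n x) \<in> S"
  shows "h x \<in> S"
  using comp_mem_submodule[OF submodule_preimage[OF module_axioms module_axioms h S] x] comp x by simp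

text \<open>
  By induction over the generated subalgebra. The Leibniz rule is available only for homogeneous first
  arguments, hence brackets \<open>[y, z]\<close> are treated by passing to the components of \<open>y\<close>, which are again in
  the subalgebra.
\<close>

lemma (in graded_lie_algebra) derivation_lie_generated:
  assumes D: "graded_map 1 L L D" and leib: "leibniz L D" and G: "G \<subseteq> carrier L"
    and DG: "\<And>g. g \<in> G \<Longrightarrow> D g \<in> lie_generated L G" and x: "x \<in> lie_generated L G"
  shows "D x \<in> lie_generated L G"
proof -
  let ?S = "lie_generated L G"
  note sub = lie_generated_subalgebra[OF G, unfolded graded_lie_subalgebra_iff]
  note s = graded_subspaceD[OF conjunct1[OF sub]]
  have br: "bracket L y z \<in> ?S" if "y \<in> ?S" "z \<in> ?S" for y z using sub that by blast
  note lin = linear_mapD[OF graded_mapD(1)[OF D]]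
  show ?thesis using G x
  proof (induction rule: lie_generated_induct)
    case zero
    show ?case using linear_map_zero[OF module_axioms module_axioms graded_mapD(1)[OF D]] s(4) by simp
  next
    case (comp n x)
    then show ?case using graded_map_comp[OF graded_space_axioms graded_space_axioms D, of x n] s(2,3) by simp
  next
    case (bracket y z)
    note c = s(3)[OF bracket(1)] s(3)[OF bracket(2)]
    show ?case
    proof (rule bracket_comp_induct[OF _ s(1) c(1)])
      show "linear_map L L (\<lambda>y. D (bracket L y z))" by (rule linear_mapI) (use c lin in simp_all)
      fix n
      have "D (comp n y) \<in> ?S"
        using graded_map_comp[OF graded_space_axioms graded_space_axioms D c(1), of n] s(2) bracket by simp
      moreover have "D (bracket L (comp n y) z) =
          bracket L (D (comp n y)) z \<oplus> koszul_sign n \<odot> bracket L (comp n y) (D z)"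
        using leib comp_grade[OF c(1), of n] c(2) unfolding leibniz_def by blast
      ultimately show "D (bracket L (comp n y) z) \<in> ?S"
        using s(2)[OF bracket(1)] bracket(2,4) by (simp add: br s(5,6))
    qed
  qed (use DG s lin in simp_all)
qed

lemma (in graded_lie_algebra) derivations_agree:
  assumes D: "graded_map k L L D" "leibniz L D" and D': "graded_map k L L D'" "leibniz L D'"
    and G: "G \<subseteq> carrier L" and DG: "\<And>g. g \<in> G \<Longrightarrow> D g = D' g" and x: "x \<in> lie_generated L G"
  shows "D x = D' x"
proof -
  note lin = linear_mapD[OF graded_mapD(1)[OF D(1)]] linear_mapD[OF graded_mapD(1)[OF D'(1)]]
  note zero = linear_map_zero[OF module_axioms module_axioms graded_mapD(1)]
  note comp = graded_map_comp[OF graded_space_axioms graded_space_axioms]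
  have car: "y \<in> carrier L" if "y \<in> lie_generated L G" for y using lie_generated_carrier[OF G] that by blast
  show ?thesis using G x
  proof (induction rule: lie_generated_induct)
    case (bracket y z)
    note c = car[OF bracket(1)] car[OF bracket(2)]
    have "linear_map L L (\<lambda>y. D (bracket L y z) \<oplus> (- 1) \<odot> D' (bracket L y z))"
      by (rule linear_mapI) (use c lin in \<open>simp_all add: smult_add smult_smult a_ac mult.commute\<close>)
    moreover have "submodule {\<zero>} (scalars :: 'k ring) L" by (simp add: submodule_iff)
    moreover have "D (bracket L (comp n y) z) \<oplus> (- 1) \<odot> D' (bracket L (comp n y) z) \<in> {\<zero>}" for n
    proof -
      have "D (comp n y) = D' (comp n y)"
        using comp[OF D(1) c(1), of n] comp[OF D'(1) c(1), of n] bracket(3) by simp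
      then have "D (bracket L (comp n y) z) = D' (bracket L (comp n y) z)"
        using D(2) D'(2) comp_grade[OF c(1), of n] c(2) bracket(4) unfolding leibniz_def by metis
      then show ?thesis using c lin smult_plus[of "D' (bracket L (comp n y) z)" 1 "- 1"] by simp
    qed
    ultimately have "D (bracket L y z) \<oplus> (- 1) \<odot> D' (bracket L y z) = \<zero>"
      using bracket_comp_induct[OF _ _ c(1)] by blast
    then have "D (bracket L y z) \<oplus> \<ominus> D' (bracket L y z) = \<zero>" using c lin by (simp add: minus_eq_smult)
    then show ?case using c lin minus_equality[of "D (bracket L y z)" "\<ominus> D' (bracket L y z)"] by simp
  qed (use DG lin zero[OF D(1)] zero[OF D'(1)] comp[OF D(1)] comp[OF D'(1)] car in simp_all)
qed

section \<open>Ideals and quotients\<close>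

lemma graded_lie_ideal_iff:
  "graded_lie_ideal I L \<longleftrightarrow> graded_subspace I L \<and>
    (\<forall>x\<in>carrier L. \<forall>y\<in>I. bracket L x y \<in> I \<and> bracket L y x \<in> I)"
  by (auto simp: graded_lie_ideal_def graded_subspace_def)

context graded_lie_algebra
begin

lemma lie_ideal_generated_ideal:
  assumes G: "G \<subseteq> carrier L"
  shows "graded_lie_ideal (lie_ideal_generated L G) L"
proof -
  have car: "graded_lie_ideal (carrier L) L"
    by (auto simp: graded_lie_ideal_iff intro!: graded_subspaceI)
  have "graded_subspace (lie_ideal_generated L G) L"
  proof (rule graded_subspaceI)
    show "lie_ideal_generated L G \<subseteq> carrier L" using car G by (auto simp: lie_ideal_generated_def)
  qed (auto simp: lie_ideal_generated_def graded_lie_ideal_iff graded_subspaceD)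
  then show ?thesis
    by (auto simp: graded_lie_ideal_iff) (auto simp: lie_ideal_generated_def graded_lie_ideal_iff)
qed

context
  fixes I assumes I: "graded_lie_ideal I L"
begin

lemma ideal_graded_subspace: "graded_subspace I L"
  using I by (simp add: graded_lie_ideal_iff)

lemmas ideal_simps = graded_subspaceD[OF ideal_graded_subspace]

lemma ideal_bracket: "x \<in> carrier L \<Longrightarrow> y \<in> I \<Longrightarrow> bracket L x y \<in> I"
    "x \<in> carrier L \<Longrightarrow> y \<in> I \<Longrightarrow> bracket L y x \<in> I"
  using I by (auto simp: graded_lie_ideal_iff)

lemma abelian_subgroup_ideal: "abelian_subgroup I L"
proof -
  have "subgroup I (add_monoid L)" using ideal_simps(1) by (simp add: submodule_def)
  then show ?thesis
    by (intro abelian_subgroupI3 additive_subgroupI) (auto intro: abelian_group_axioms)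
qed

text \<open>
  All operations of a graded Lie algebra, including the projections to homogeneous components, respect
  congruence modulo a graded ideal. In this form the ideal enters the later inductions over generators.
\<close>

lemma coset_eq_iff:
  assumes "x \<in> carrier L" "y \<in> carrier L"
  shows "I +> x = I +> y \<longleftrightarrow> x \<ominus> y \<in> I"
proof -
  interpret abelian_subgroup I L by (rule abelian_subgroup_ideal)
  show ?thesis using assms a_rcos_module[of y x] a_rcos_self[of x]
      a_repr_independence[OF _ _ a_subgroup, of x y]
    by (metis minus_eq)
qed

lemma coset_mem_iff: "x \<in> carrier L \<Longrightarrow> y \<in> I +> x \<longleftrightarrow> y \<in> carrier L \<and> I +> y = I +> x"
proof -
  interpret abelian_subgroup I L by (rule abelian_subgroup_ideal)
  assume "x \<in> carrier L"
  then show ?thesis using a_rcos_self a_repr_independence[OF _ _ a_subgroup, of y x] a_r_coset_subset_G[of I x]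
      ideal_simps(7) by blast
qed

lemma diff_eq_smult: "x \<in> carrier L \<Longrightarrow> y \<in> carrier L \<Longrightarrow> x \<ominus> y = x \<oplus> (- 1) \<odot> y"
  by (simp add: a_minus_def minus_eq_smult)

lemma coset_add:
  "x \<in> carrier L \<Longrightarrow> y \<in> carrier L \<Longrightarrow> (I +> x) <+> (I +> y) = I +> (x \<oplus> y)"
  using abelian_subgroup.a_rcos_sum[OF abelian_subgroup_ideal] .

lemma coset_add_cong:
  assumes "x \<in> carrier L" "x' \<in> carrier L" "y \<in> carrier L" "y' \<in> carrier L"
    and eq: "I +> x = I +> x'" "I +> y = I +> y'"
  shows "I +> (x \<oplus> y) = I +> (x' \<oplus> y')"
  using coset_add[of x y] coset_add[of x' y'] assms by simp

lemma coset_smult_cong: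
  "x \<in> carrier L \<Longrightarrow> y \<in> carrier L \<Longrightarrow> I +> x = I +> y \<Longrightarrow> I +> c \<odot> x = I +> c \<odot> y"
  using ideal_simps(6)[of "x \<ominus> y" c]
  by (simp add: coset_eq_iff diff_eq_smult smult_add smult_smult mult.commute)

lemma coset_comp_cong:
  "x \<in> carrier L \<Longrightarrow> y \<in> carrier L \<Longrightarrow> I +> x = I +> y \<Longrightarrow> I +> comp n x = I +> comp n y"
  using ideal_simps(2)[of "x \<ominus> y" n] by (simp add: coset_eq_iff diff_eq_smult comp_add comp_smult)

lemma coset_bracket_cong:
  assumes "x \<in> carrier L" "x' \<in> carrier L" "y \<in> carrier L" "y' \<in> carrier L"
    and eq: "I +> x = I +> x'" "I +> y = I +> y'"
  shows "I +> bracket L x y = I +> bracket L x' y'"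
proof -
  have "bracket L (x \<ominus> x') y \<in> I" "bracket L x' (y \<ominus> y') \<in> I"
    using eq assms ideal_bracket by (auto simp: coset_eq_iff)
  then have "I +> bracket L x y = I +> bracket L x' y" "I +> bracket L x' y = I +> bracket L x' y'"
    using assms by (simp_all add: coset_eq_iff diff_eq_smult)
  then show ?thesis by simp
qed

end

end

lemma lie_quotient_hom:
  fixes L :: "('k::field_char_0, 'a) graded_lie" (structure)
  assumes L: "graded_lie_algebra L" and I: "graded_lie_ideal I L"
  shows "graded_lie_hom L (lie_quotient L I) (\<lambda>x. I +> x)"
proof -
  interpret graded_lie_algebra L by fact
  have mem: "y \<in> carrier L" "I +> y = I +> x" if "x \<in> carrier L" "y \<in> I +> x" for x y
    using coset_mem_iff[OF I that(1), of y] that(2) by auto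
  have self: "x \<in> I +> x" if "x \<in> carrier L" for x using coset_mem_iff[OF I that] that by simp
  have smult: "(\<Union>x'\<in>I +> x. I +> c \<odot> x') = I +> c \<odot> x" if x: "x \<in> carrier L" for c x
  proof -
    have "I +> c \<odot> x' = I +> c \<odot> x" if "x' \<in> I +> x" for x'
      by (rule coset_smult_cong[OF I mem(1)[OF x that] x mem(2)[OF x that]])
    then show ?thesis using self[OF x] by (intro SUP_eq_const) blast+
  qed
  have bracket: "(\<Union>x'\<in>I +> x. \<Union>y'\<in>I +> y. I +> bracket L x' y') = I +> bracket L x y"
    if x: "x \<in> carrier L" and y: "y \<in> carrier L" for x y
  proof -
    have "I +> bracket L x' y' = I +> bracket L x y" if "x' \<in> I +> x" "y' \<in> I +> y" for x' y'
      by (rule coset_bracket_cong[OF I mem(1)[OF x that(1)] x mem(1)[OF y that(2)] y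
          mem(2)[OF x that(1)] mem(2)[OF y that(2)]])
    then show ?thesis using self[OF x] self[OF y] by (intro SUP_eq_const) blast+
  qed
  show ?thesis
    by (intro graded_lie_homI graded_mapI linear_mapI)
      (auto simp: lie_quotient_def coset_add[OF I] smult bracket A_RCOSETS_def')
qed

section \<open>The tensor algebra\<close>

text \<open>
  The free associative algebra on a set of letters with degrees, as a graded Lie algebra under the graded
  commutator. Its homogeneous components are restrictions to the words of a given degree.
\<close>

definition poly_lie :: "('a \<Rightarrow> int) \<Rightarrow> 'a set \<Rightarrow> ('k::field_char_0, 'a list \<Rightarrow>\<^sub>0 'k) graded_lie" where
  "poly_lie d X = \<lparr>carrier = {p. keys p \<subseteq> lists X}, mult = (*), one = 1, zero = 0, add = (+), smult = scl,
     grade = (\<lambda>n. {p. keys p \<subseteq> lists X \<and> homogeneous d n p}), bracket = commutator d\<rparr>"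

lemma keys_add_subset: "keys p \<subseteq> A \<Longrightarrow> keys q \<subseteq> A \<Longrightarrow> keys (p + q) \<subseteq> A"
  and keys_diff_subset: "keys p \<subseteq> A \<Longrightarrow> keys r \<subseteq> A \<Longrightarrow> keys (p - r) \<subseteq> (A :: 'a set)"
  and keys_scl_subset: "keys s \<subseteq> A \<Longrightarrow> keys (scl c s) \<subseteq> A"
  using keys_add[of p q] keys_diff[of p r] keys_scl[of c s] by blast+

lemma poly_lie_simps [simp]:
  "carrier (poly_lie d X) = {p. keys p \<subseteq> lists X}" "zero (poly_lie d X) = 0" "add (poly_lie d X) = (+)"
  "smult (poly_lie d X) = scl" "bracket (poly_lie d X) = commutator d"
  "grade (poly_lie d X) n = {p. keys p \<subseteq> lists X \<and> homogeneous d n p}"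
  by (simp_all add: poly_lie_def)

lemma poly_lie_module: "module (scalars :: 'k::field_char_0 ring) (poly_lie d X)"
  by (rule scalar_moduleI)
    (auto simp: scl_add_left scl_add_right scl_minus_one algebra_simps
      dest!: subsetD[OF keys_add] subsetD[OF keys_scl])

lemma poly_lie_finsum:
  assumes "\<And>a. a \<in> A \<Longrightarrow> keys (f a) \<subseteq> lists X"
  shows "finsum (poly_lie d X) f A = (\<Sum>a\<in>A. f a)"
proof -
  interpret scalar_module "poly_lie d X" by (simp add: scalar_module_def poly_lie_module)
  show ?thesis using assms
  proof (induction A rule: infinite_finite_induct)
    case (insert a A)
    have "finsum (poly_lie d X) f (insert a A) = f a + finsum (poly_lie d X) f A"
      using insert by (subst finsum_insert) auto
    then show ?case using insert by simp
  qed (simp_all add: add.finprod_infinite)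
qed

lemma poly_lie_decomposition:
  fixes p :: "'a list \<Rightarrow>\<^sub>0 'k::field_char_0"
  assumes p: "keys p \<subseteq> lists X"
  shows "is_decomposition (poly_lie d X) p f \<longleftrightarrow> f = (\<lambda>n. component d n p)"
proof
  assume f: "is_decomposition (poly_lie d X) p f"
  then have hom: "homogeneous d n (f n)" "keys (f n) \<subseteq> lists X" for n by (auto simp: is_decomposition_def)
  have eq: "p = (\<Sum>n\<in>{n. f n \<noteq> 0}. f n)" and fin: "finite {n. f n \<noteq> 0}"
    using f hom by (auto simp: is_decomposition_def poly_lie_finsum)
  show "f = (\<lambda>n. component d n p)"
  proof
    fix n
    have "component d n p = (\<Sum>m\<in>{m. f m \<noteq> 0}. component d n (f m))"
      by (subst eq) (simp add: linear_pm_sum)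
    also have "\<dots> = (\<Sum>m\<in>{m. f m \<noteq> 0}. if n = m then f m else 0)"
      by (simp add: component_homogeneous[OF hom(1)])
    also have "\<dots> = f n" using fin by simp
    finally show "f n = component d n p" by simp
  qed
next
  assume "f = (\<lambda>n. component d n p)"
  moreover have "is_decomposition (poly_lie d X) p (\<lambda>n. component d n p)"
  proof (rule is_decompositionI[OF poly_lie_module])
    show "component d n p = \<zero>\<^bsub>poly_lie d X\<^esub>" if "n \<notin> word_degree d ` keys p" for n
      using that by (auto intro!: filt_zero)
    show "p = finsum (poly_lie d X) (\<lambda>n. component d n p) (word_degree d ` keys p)"
      using p by (subst poly_lie_finsum) (auto simp: component_sum)
  qed (use p in \<open>auto intro!: homogeneous_component\<close>)
  ultimately show "is_decomposition (poly_lie d X) p f" by simp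
qed

lemma poly_lie_comp: "keys p \<subseteq> lists X \<Longrightarrow> homog_component (poly_lie d X) n p = component d n p"
  by (simp add: homog_component_def poly_lie_decomposition)

lemma graded_lie_algebra_poly_lie:
  "graded_lie_algebra (poly_lie d X :: ('k::field_char_0, 'a list \<Rightarrow>\<^sub>0 'k) graded_lie)" (is "graded_lie_algebra ?P")
proof -
  interpret P: scalar_module ?P by (simp add: scalar_module_def poly_lie_module)
  have "graded_space ?P"
  proof (rule graded_space.intro[OF P.module_axioms graded_space_axioms.intro])
    show "submodule (grade ?P n) scalars ?P" for n
      by (auto simp: P.submodule_iff homogeneous_add homogeneous_scl
          dest!: subsetD[OF keys_add] subsetD[OF keys_scl])
  qed (simp add: poly_lie_decomposition)
  then interpret P: graded_space ?P .
  have minus: "\<ominus>\<^bsub>?P\<^esub> p = - p" if "keys p \<subseteq> lists X" for p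
    using P.minus_eq_smult[of p] that by (simp add: scl_minus_one)
  have kc: "keys (commutator d p q) \<subseteq> lists X" if "keys p \<subseteq> lists X" "keys q \<subseteq> lists X"
    for p q :: "'a list \<Rightarrow>\<^sub>0 'k" using keys_commutator[OF that] .
  show ?thesis
  proof (rule graded_lie_algebra.intro[OF P.graded_space_axioms graded_lie_algebra_axioms.intro])
    fix p q r i j k assume p: "p \<in> grade ?P i" and q: "q \<in> grade ?P j"
    show "bracket ?P p q \<in> grade ?P (i + j)"
      using p q homogeneous_commutator[of d i p j q] keys_commutator[of p X q d] by simp
    show "bracket ?P p q = \<ominus>\<^bsub>?P\<^esub> (koszul_sign (i * j) \<odot>\<^bsub>?P\<^esub> bracket ?P q p)"
      using p q commutator_antisymmetry[of d i p j q] keys_commutator[of q X p d]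
        keys_scl_subset[OF keys_commutator[of q X p d]] by (simp add: minus)
    assume r: "r \<in> grade ?P k"
    show "bracket ?P p (bracket ?P q r) = bracket ?P (bracket ?P p q) r \<oplus>\<^bsub>?P\<^esub>
        koszul_sign (i * j) \<odot>\<^bsub>?P\<^esub> bracket ?P q (bracket ?P p r)"
      using p q r commutator_jacobi[of d i p j q k r] by simp
  qed (use kc in \<open>simp_all add: linear_map_def Pi_iff linear_pm_add[OF linear_commutator(1)]
      linear_pm_add[OF linear_commutator(2)] linear_pm_scl[OF linear_commutator(1)]
      linear_pm_scl[OF linear_commutator(2)]\<close>)
qed

lemma free_algebra_simps [simp]:
  "carrier (free_algebra X) = {p. keys p \<subseteq> lists X}" "zero (free_algebra X) = 0" "add (free_algebra X) = (+)"
  "mult (free_algebra X) = (*)" "one (free_algebra X) = 1"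
  by (simp_all add: free_algebra_def)

lemma free_algebra_ring: "ring (free_algebra X :: ('a list \<Rightarrow>\<^sub>0 'k::field_char_0) ring)"
proof (rule ringI)
  have "\<exists>y. keys y \<subseteq> lists X \<and> y + x = 0" if "keys x \<subseteq> lists X" for x :: "'a list \<Rightarrow>\<^sub>0 'k"
    by (rule exI[of _ "- x"]) (use that in simp)
  then show "abelian_group (free_algebra X :: ('a list \<Rightarrow>\<^sub>0 'k) ring)"
    by (intro abelian_groupI) (auto simp: algebra_simps dest!: subsetD[OF keys_add])
  show "monoid (free_algebra X :: ('a list \<Rightarrow>\<^sub>0 'k) ring)"
    by (rule monoidI) (use keys_mult_lists[of _ X] in \<open>simp_all add: zero_list_def mult.assoc\<close>)
qed (auto simp: algebra_simps)

lemma free_algebra_minus [simp]: "keys p \<subseteq> lists X \<Longrightarrow> \<ominus>\<^bsub>free_algebra X\<^esub> p = - (p :: 'a list \<Rightarrow>\<^sub>0 'k::field_char_0)"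
proof -
  interpret ring "free_algebra X :: ('a list \<Rightarrow>\<^sub>0 'k) ring" by (rule free_algebra_ring)
  assume "keys p \<subseteq> lists X"
  then show ?thesis using minus_equality[of "- p" p] by simp
qed

lemma keys_letter [simp]: "keys (letter x :: 'a list \<Rightarrow>\<^sub>0 'k::field_char_0) = {[x]}"
  and keys_const: "keys (const_poly c) \<subseteq> {[]}"
  by (simp_all add: letter_def const_poly_def)

lemma commutator_lie_simps [simp]:
  "carrier (commutator_lie A) = carrier A" "zero (commutator_lie A) = zero A" "add (commutator_lie A) = add A"
  "smult (commutator_lie A) = smult A" "grade (commutator_lie A) = grade A"
  "bracket (commutator_lie A) = graded_commutator A"
  by (simp_all add: commutator_lie_def graded_space.defs)

text \<open>
  Replacing each letter by its expansion in the basis defines an endomorphism \<open>reduce\<close> of the free algebra.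
  Its kernel is the ideal of the linearity relations: it kills them, and \<open>p\<close> is congruent to \<open>reduce p\<close> by
  \<open>diff_reduce_J\<close>. So \<open>reduce\<close> computes normal forms, and the normal form \<open>\<nu> t\<close> of a tensor \<open>t\<close> embeds the tensor
  algebra into the free algebra on the basis.
\<close>

context homogeneous_basis
begin

abbreviation expansion :: "'a \<Rightarrow> 'a list \<Rightarrow>\<^sub>0 'k" where
  "expansion x \<equiv> lin letter (coord x)"

abbreviation reduce :: "('a list \<Rightarrow>\<^sub>0 'k) \<Rightarrow> 'a list \<Rightarrow>\<^sub>0 'k" where
  "reduce \<equiv> subst_letters expansion"

abbreviation "polys \<equiv> {p :: 'a list \<Rightarrow>\<^sub>0 'k. keys p \<subseteq> lists (carrier V)}"

lemma lists_basis: "lists B \<subseteq> lists (carrier V)"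
  using basis_carrier by (rule lists_mono)

lemma keys_expansion: "x \<in> carrier V \<Longrightarrow> keys (expansion x) \<subseteq> lists B"
  using coord_keys[of x] by (intro keys_lin_subset) auto

lemma keys_reduce: "p \<in> polys \<Longrightarrow> keys (reduce p) \<subseteq> lists B"
  by (rule keys_subst_letters[of "carrier V"]) (auto simp: keys_expansion)

lemma reduce_basis: "keys p \<subseteq> lists B \<Longrightarrow> reduce p = p"
proof -
  assume p: "keys p \<subseteq> lists B"
  have "reduce (single w 1) = single w 1" if "w \<in> lists B" for w
    using that
  proof induction
    case (Cons x w)
    have "single (x # w) (1 :: 'k) = letter x * single w 1" by (simp add: letter_def)
    then show ?case using Cons by (simp add: subst_letters_mult del: single_mult)
  qed simp
  then show ?thesis using linear_pm_eqI[OF linear_subst_letters linear_pm_id p] by simp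
qed

lemma homogeneous_expansion:
  assumes "x \<in> grade V n" shows "homogeneous d n (expansion x)"
proof (rule homogeneous_lin)
  fix b assume "b \<in> keys (coord x)"
  then have "d b = n" using coord_grade[OF assms] by simp
  then show "homogeneous d n (letter b)" by (simp add: homogeneous_def)
qed

abbreviation "J \<equiv> tensor_ideal V"

abbreviation "F \<equiv> free_algebra (carrier V) :: ('a list \<Rightarrow>\<^sub>0 'k) ring"

lemma relations_polys: "linearity_relations V \<subseteq> polys"
proof -
  have l: "keys (letter x :: 'a list \<Rightarrow>\<^sub>0 'k) \<subseteq> lists (carrier V)" if "x \<in> carrier V" for x using that by simp
  have c: "keys (const_poly c :: 'a list \<Rightarrow>\<^sub>0 'k) \<subseteq> lists (carrier V)" for c using keys_const[of c] by auto
  have "keys (letter (x \<oplus> y) - letter x - letter y :: 'a list \<Rightarrow>\<^sub>0 'k) \<subseteq> lists (carrier V)"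
    if "x \<in> carrier V" "y \<in> carrier V" for x y
    using that by (intro keys_diff_subset l) auto
  moreover have "keys (letter (c \<odot> x) - const_poly c * letter x :: 'a list \<Rightarrow>\<^sub>0 'k) \<subseteq> lists (carrier V)"
    if "x \<in> carrier V" for x c
    using that by (intro keys_diff_subset keys_mult_lists l c) auto
  ultimately show ?thesis unfolding linearity_relations_def by blast
qed

lemma ideal_J: "ideal J F"
  unfolding tensor_ideal_def
  by (rule ring.genideal_ideal[OF free_algebra_ring]) (use relations_polys in auto)

lemma J_relations: "linearity_relations V \<subseteq> J"
  unfolding tensor_ideal_def
  by (rule ring.genideal_self[OF free_algebra_ring]) (use relations_polys in auto)

lemma J_simps:
  "0 \<in> J" "p \<in> J \<Longrightarrow> p \<in> polys" "p \<in> J \<Longrightarrow> q \<in> J \<Longrightarrow> p + q \<in> J"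
  "p \<in> J \<Longrightarrow> q \<in> polys \<Longrightarrow> p * q \<in> J" "p \<in> J \<Longrightarrow> q \<in> polys \<Longrightarrow> q * p \<in> J" "p \<in> J \<Longrightarrow> scl c p \<in> J"
proof -
  interpret ideal J F by (rule ideal_J)
  show "0 \<in> J" using additive_subgroup.zero_closed[OF is_additive_subgroup] by simp
  show "p \<in> J \<Longrightarrow> p \<in> polys" for p using a_subset by auto
  show "p \<in> J \<Longrightarrow> q \<in> J \<Longrightarrow> p + q \<in> J" for p q using additive_subgroup.a_closed[OF is_additive_subgroup, of p q] by simp
  show "p \<in> J \<Longrightarrow> q \<in> polys \<Longrightarrow> p * q \<in> J" for p q using I_r_closed[of p q] by simp
  show l: "p \<in> J \<Longrightarrow> q \<in> polys \<Longrightarrow> q * p \<in> J" for p q using I_l_closed[of p q] by simp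
  have "const_poly c \<in> polys" using keys_const[of c] by auto
  then show "p \<in> J \<Longrightarrow> scl c p \<in> J" for p using l[of p "const_poly c"] by (simp add: scl_eq_mult)
qed

lemma J_reduce:
  assumes "p \<in> J" shows "reduce p = 0"
proof -
  have kernel: "a_kernel F (free_algebra UNIV) reduce = {p \<in> polys. reduce p = 0}"
    unfolding a_kernel_def' by (simp only: free_algebra_simps)
  interpret ring_hom_ring F "free_algebra UNIV :: ('a list \<Rightarrow>\<^sub>0 'k) ring" reduce
    by (rule ring_hom_ringI2[OF free_algebra_ring free_algebra_ring])
      (auto simp: ring_hom_def subst_letters_add subst_letters_mult)
  have add: "reduce (letter (x \<oplus> y) - letter x - letter y) = 0" if "x \<in> carrier V" "y \<in> carrier V" for x y
    using that by (simp add: subst_letters_diff coord_add lin_add)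
  have smult: "reduce (letter (c \<odot> x) - const_poly c * letter x) = 0" if "x \<in> carrier V" for c x
    unfolding scl_eq_mult[symmetric] using that by (simp add: subst_letters_diff subst_letters_scl coord_smult lin_scl)
  have "reduce r = 0" if "r \<in> linearity_relations V" for r
  proof -
    from that consider (add) x y where "r = letter (x \<oplus> y) - letter x - letter y" "x \<in> carrier V" "y \<in> carrier V"
      | (smult) c x where "r = letter (c \<odot> x) - const_poly c * letter x" "x \<in> carrier V"
      unfolding linearity_relations_def by blast
    then show ?thesis by cases (simp_all only: add smult)
  qed
  then have "linearity_relations V \<subseteq> a_kernel F (free_algebra UNIV) reduce"
    unfolding kernel using relations_polys by blast
  then have "J \<subseteq> a_kernel F (free_algebra UNIV) reduce"
    unfolding tensor_ideal_def by (intro R.genideal_minimal kernel_is_ideal)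
  then show ?thesis using assms kernel by auto
qed

text \<open>
  The linearity relations extend from sums and multiples of two vectors to linear combinations.
\<close>

lemma letter_expansion_J:
  assumes "x \<in> carrier V" shows "letter x - expansion x \<in> J"
proof -
  have rel: "letter (x \<oplus> y) - letter x - letter y \<in> J" if "x \<in> carrier V" "y \<in> carrier V" for x y
    using that J_relations by (auto simp: linearity_relations_def)
  have rel': "letter (c \<odot> x) - scl c (letter x) \<in> J" if "x \<in> carrier V" for x c
    using that J_relations by (auto simp: linearity_relations_def scl_eq_mult)
  have "letter (lincomb V f) - lin letter f \<in> J" if "keys f \<subseteq> carrier V" for f
    using that
  proof (induction rule: poly_mapping_linear_induct)
    case zero
    then show ?case using rel'[of \<zero> 0] by simp
  next
    case (add f g)
    have "letter (lincomb V f \<oplus> lincomb V g) - letter (lincomb V f) - letter (lincomb V g) \<in> J"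
      using add by (intro rel lincomb_mem)
    from J_simps(3)[OF this J_simps(3)[OF add(3,4)]] show ?case
      using add by (simp add: lincomb_add lin_add algebra_simps)
  qed (simp add: rel')
  from this[OF coord_keys_carrier[OF assms]] show ?thesis using assms by simp
qed

lemma diff_reduce_J:
  assumes "p \<in> polys" shows "p - reduce p \<in> J"
proof -
  have single_polys: "single w 1 \<in> polys" if "w \<in> lists (carrier V)" for w using that by simp
  have word: "single w 1 - reduce (single w 1) \<in> J" if "w \<in> lists (carrier V)" for w
    using that
  proof induction
    case Nil
    then show ?case by (simp add: J_simps)
  next
    case (Cons x w)
    have "(letter x - expansion x) * single w 1 + expansion x * (single w 1 - reduce (single w 1)) \<in> J"
      by (intro J_simps(3-5) letter_expansion_J Cons single_polys)
        (use Cons keys_expansion[of x] lists_basis in auto)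
    moreover have "single (x # w) (1 :: 'k) = letter x * single w 1" by (simp add: letter_def)
    ultimately show ?case by (simp add: subst_letters_mult algebra_simps del: single_mult)
  qed
  have "keys p \<subseteq> lists (carrier V)" using assms by simp
  then show ?thesis
  proof (induction rule: poly_mapping_linear_induct)
    case (single w c)
    have "single w c = scl c (single w 1)" by simp
    then show ?case using J_simps(6)[OF word[OF single], of c]
      by (simp only: subst_letters_scl scl_diff_right)
  next
    case (add p q)
    from J_simps(3)[OF add(3,4)] show ?case by (simp add: subst_letters_add algebra_simps)
  qed (simp add: J_simps)
qed

lemma tensor_class_eq_iff:
  assumes p: "p \<in> polys" and q: "q \<in> polys"
  shows "tensor_class V p = tensor_class V q \<longleftrightarrow> reduce p = reduce q"
proof -
  interpret ideal J F by (rule ideal_J)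
  have "p \<in> J +>\<^bsub>F\<^esub> q \<longleftrightarrow> p - q \<in> J" using a_rcos_module[of q p] p q by simp
  moreover have "p \<in> J +>\<^bsub>F\<^esub> p" using a_rcos_self[of p] p by simp
  moreover have "p \<in> J +>\<^bsub>F\<^esub> q \<Longrightarrow> J +>\<^bsub>F\<^esub> q = J +>\<^bsub>F\<^esub> p"
    using a_repr_independence[OF _ _ a_subgroup, of p q] q by simp
  ultimately have "tensor_class V p = tensor_class V q \<longleftrightarrow> p - q \<in> J"
    unfolding tensor_class_def by metis
  also have "\<dots> \<longleftrightarrow> reduce p = reduce q"
  proof
    assume "p - q \<in> J"
    from J_reduce[OF this] show "reduce p = reduce q" by (simp add: subst_letters_diff)
  next
    assume eq: "reduce p = reduce q"
    have "(p - reduce p) + scl (- 1) (q - reduce q) \<in> J"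
      by (intro J_simps diff_reduce_J p q)
    then show "p - q \<in> J" using eq by (simp add: scl_minus_one)
  qed
  finally show ?thesis .
qed

abbreviation "T \<equiv> tensor_algebra V"

lemma tensor_algebra_simps:
  "carrier T = tensor_class V ` polys" "zero T = tensor_class V 0" "one T = tensor_class V 1"
  "p \<in> polys \<Longrightarrow> q \<in> polys \<Longrightarrow> tensor_class V p \<oplus>\<^bsub>T\<^esub> tensor_class V q = tensor_class V (p + q)"
  "p \<in> polys \<Longrightarrow> q \<in> polys \<Longrightarrow> tensor_class V p \<otimes>\<^bsub>T\<^esub> tensor_class V q = tensor_class V (p * q)"
  "p \<in> polys \<Longrightarrow> c \<odot>\<^bsub>T\<^esub> tensor_class V p = tensor_class V (scl c p)"
  "grade T n = tensor_class V ` {p. keys p \<subseteq> homog_words V n}"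
proof -
  interpret ideal J F by (rule ideal_J)
  show "carrier T = tensor_class V ` polys"
    by (auto simp: tensor_algebra_def Let_def FactRing_def A_RCOSETS_def' tensor_class_def)
  show "zero T = tensor_class V 0"
    using a_coset_add_zero[of J] a_subset by (simp add: tensor_algebra_def Let_def FactRing_def tensor_class_def)
  show "one T = tensor_class V 1"
    by (simp add: tensor_algebra_def Let_def FactRing_def tensor_class_def)
  show "grade T n = tensor_class V ` {p. keys p \<subseteq> homog_words V n}"
    by (simp add: tensor_algebra_def Let_def)
  show "tensor_class V p \<oplus>\<^bsub>T\<^esub> tensor_class V q = tensor_class V (p + q)" if "p \<in> polys" "q \<in> polys" for p q
    using a_rcos_sum[of p q] that by (simp add: tensor_algebra_def Let_def FactRing_def tensor_class_def)
  have mult: "tensor_class V p \<otimes>\<^bsub>F Quot J\<^esub> tensor_class V q = tensor_class V (p * q)"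
    if "p \<in> polys" "q \<in> polys" for p q
    using rcoset_mult_add[of p q] that by (simp add: FactRing_def tensor_class_def)
  then show "tensor_class V p \<otimes>\<^bsub>T\<^esub> tensor_class V q = tensor_class V (p * q)" if "p \<in> polys" "q \<in> polys" for p q
    using that by (simp add: tensor_algebra_def Let_def)
  have "const_poly c \<in> polys" for c using keys_const[of c] by auto
  then show "c \<odot>\<^bsub>T\<^esub> tensor_class V p = tensor_class V (scl c p)" if "p \<in> polys" for p c
    using that mult[of "const_poly c" p] by (simp add: tensor_algebra_def Let_def scl_eq_mult)
qed

definition \<nu> :: "('a list \<Rightarrow>\<^sub>0 'k) set \<Rightarrow> 'a list \<Rightarrow>\<^sub>0 'k" where
  "\<nu> t = reduce (SOME p. p \<in> polys \<and> t = tensor_class V p)"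

lemma \<nu>_class [simp]:
  assumes "p \<in> polys" shows "\<nu> (tensor_class V p) = reduce p"
proof -
  let ?q = "SOME q. q \<in> polys \<and> tensor_class V p = tensor_class V q"
  have "?q \<in> polys \<and> tensor_class V p = tensor_class V ?q" using assms by (intro someI) auto
  then have "reduce p = reduce ?q" using tensor_class_eq_iff[OF assms, of ?q] by blast
  then show ?thesis by (simp add: \<nu>_def)
qed

lemma \<nu>_inj: "x \<in> carrier T \<Longrightarrow> y \<in> carrier T \<Longrightarrow> \<nu> x = \<nu> y \<Longrightarrow> x = y"
  unfolding tensor_algebra_simps by (elim imageE) (simp only: \<nu>_class tensor_class_eq_iff)

lemma \<nu>_keys: "x \<in> carrier T \<Longrightarrow> keys (\<nu> x) \<subseteq> lists B"
  unfolding tensor_algebra_simps by (elim imageE) (simp only: \<nu>_class keys_reduce)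

lemma class_basis:
  assumes "keys p \<subseteq> lists B"
  shows "tensor_class V p \<in> carrier T" "\<nu> (tensor_class V p) = p"
proof -
  have "p \<in> polys" using assms lists_basis by auto
  then show "tensor_class V p \<in> carrier T" "\<nu> (tensor_class V p) = p"
    using reduce_basis[OF assms] by (auto simp: tensor_algebra_simps)
qed

lemma class_\<nu> [simp]: "x \<in> carrier T \<Longrightarrow> tensor_class V (\<nu> x) = x"
  by (rule \<nu>_inj) (auto simp: class_basis \<nu>_keys)

lemma tensor_closed [simp]:
  "\<zero>\<^bsub>T\<^esub> \<in> carrier T" "\<one>\<^bsub>T\<^esub> \<in> carrier T"
  "x \<in> carrier T \<Longrightarrow> y \<in> carrier T \<Longrightarrow> x \<oplus>\<^bsub>T\<^esub> y \<in> carrier T"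
  "x \<in> carrier T \<Longrightarrow> y \<in> carrier T \<Longrightarrow> x \<otimes>\<^bsub>T\<^esub> y \<in> carrier T"
  "x \<in> carrier T \<Longrightarrow> c \<odot>\<^bsub>T\<^esub> x \<in> carrier T"
  by (auto simp: tensor_algebra_simps zero_list_def keys_add_subset keys_mult_lists keys_scl_subset intro!: imageI)

lemma \<nu>_simps [simp]:
  "\<nu> \<zero>\<^bsub>T\<^esub> = 0" "\<nu> \<one>\<^bsub>T\<^esub> = 1"
  "x \<in> carrier T \<Longrightarrow> y \<in> carrier T \<Longrightarrow> \<nu> (x \<oplus>\<^bsub>T\<^esub> y) = \<nu> x + \<nu> y"
  "x \<in> carrier T \<Longrightarrow> y \<in> carrier T \<Longrightarrow> \<nu> (x \<otimes>\<^bsub>T\<^esub> y) = \<nu> x * \<nu> y"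
  "x \<in> carrier T \<Longrightarrow> \<nu> (c \<odot>\<^bsub>T\<^esub> x) = scl c (\<nu> x)"
  by (auto simp: tensor_algebra_simps zero_list_def keys_add_subset keys_mult_lists keys_scl_subset
      subst_letters_add subst_letters_mult subst_letters_scl)

lemma tensor_inc_mem [simp]: "x \<in> carrier V \<Longrightarrow> tensor_inc V x \<in> carrier T"
  and \<nu>_tensor_inc [simp]: "x \<in> carrier V \<Longrightarrow> \<nu> (tensor_inc V x) = expansion x"
  by (auto simp: tensor_inc_def tensor_algebra_simps intro!: imageI)

lemma homog_words_reduce:
  assumes "w \<in> homog_words V n"
  shows "w \<in> lists (carrier V)" "homogeneous d n (reduce (single w 1))"
proof -
  from assms obtain ds where ds: "list_all2 (\<lambda>x d. x \<in> grade V d) w ds" "sum_list ds = n"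
    by (auto simp: homog_words_def)
  from ds(1) have "w \<in> lists (carrier V) \<and> homogeneous d (sum_list ds) (reduce (single w 1))"
  proof induction
    case Nil
    then show ?case by (simp add: homogeneous_def zero_list_def)
  next
    case (Cons x w k ks)
    have "single (x # w) (1 :: 'k) = letter x * single w 1" by (simp add: letter_def)
    then have "reduce (single (x # w) 1) = expansion x * reduce (single w 1)"
      by (simp only: subst_letters_mult subst_letters_letter)
    then show ?case using Cons homogeneous_mult[OF homogeneous_expansion[OF Cons(1)]] grade_mem[OF Cons(1)] by auto
  qed
  then show "w \<in> lists (carrier V)" "homogeneous d n (reduce (single w 1))" using ds by auto
qed

lemma basis_words: "w \<in> lists B \<Longrightarrow> w \<in> homog_words V (word_degree d w)"
  unfolding homog_words_def word_degree_def
  by (intro CollectI exI[of _ "map d w"]) (auto simp: list_all2_conv_all_nth basis_grade in_lists_conv_set)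

lemma \<nu>_grade: "grade T n = {x \<in> carrier T. homogeneous d n (\<nu> x)}"
proof (intro equalityI subsetI)
  fix x assume "x \<in> grade T n"
  then obtain p where p: "keys p \<subseteq> homog_words V n" "x = tensor_class V p" by (auto simp: tensor_algebra_simps)
  have pp: "p \<in> polys" using p homog_words_reduce by auto
  have "homogeneous d n (reduce p)"
    unfolding subst_letters_def
    by (rule homogeneous_lin) (use p homog_words_reduce(2)[of _ n] in \<open>auto simp: subst_letters_def\<close>)
  then show "x \<in> {x \<in> carrier T. homogeneous d n (\<nu> x)}" using pp p(2) by (auto simp: tensor_algebra_simps)
next
  fix x assume x: "x \<in> {x \<in> carrier T. homogeneous d n (\<nu> x)}"
  then have "keys (\<nu> x) \<subseteq> homog_words V n"
    using \<nu>_keys[of x] basis_words by (force simp: homogeneous_def)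
  then show "x \<in> grade T n" using x by (auto simp: tensor_algebra_simps(7) intro!: image_eqI[of _ _ "\<nu> x"])
qed

abbreviation "P \<equiv> poly_lie d B :: ('k, 'a list \<Rightarrow>\<^sub>0 'k) graded_lie"

lemma linear_map_\<nu>: "linear_map T P \<nu>"
  by (rule linear_mapI) (simp_all add: \<nu>_keys)

lemma inj_on_\<nu>: "inj_on \<nu> (carrier T)"
  by (rule inj_onI) (rule \<nu>_inj)

lemma component_\<nu>: "x \<in> carrier T \<Longrightarrow> homog_component P n (\<nu> x) \<in> \<nu> ` carrier T"
proof -
  assume x: "x \<in> carrier T"
  have "keys (component d n (\<nu> x)) \<subseteq> lists B" using \<nu>_keys[OF x] by auto
  from class_basis[OF this] show ?thesis
    by (simp add: poly_lie_comp \<nu>_keys x) (metis imageI)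
qed

lemma \<nu>_grade_P: "grade T n = {x \<in> carrier T. \<nu> x \<in> grade P n}"
  by (simp add: \<nu>_grade \<nu>_keys cong: conj_cong)

lemma graded_space_T: "graded_space T"
  by (rule graded_space_transport[OF graded_lie_algebra.axioms(1)[OF graded_lie_algebra_poly_lie, of d B]
        inj_on_\<nu> linear_map_\<nu>])
    (simp_all add: \<nu>_grade_P component_\<nu> del: poly_lie_simps(6))

lemma graded_map_\<nu>: "graded_map 0 T P \<nu>"
  by (rule graded_mapI[OF linear_map_\<nu>]) (auto simp: \<nu>_grade \<nu>_keys)

lemma \<nu>_comp: "x \<in> carrier T \<Longrightarrow> \<nu> (homog_component T n x) = component d n (\<nu> x)"
  using graded_map_comp[OF graded_space_T graded_lie_algebra.axioms(1)[OF graded_lie_algebra_poly_lie] graded_map_\<nu>]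
  by (simp add: poly_lie_comp \<nu>_keys)

lemma \<nu>_finsum: "(\<And>a. a \<in> A \<Longrightarrow> f a \<in> carrier T) \<Longrightarrow> \<nu> (finsum T f A) = (\<Sum>a\<in>A. \<nu> (f a))"
  using linear_map_finsum[OF graded_space.axioms(1)[OF graded_space_T] poly_lie_module linear_map_\<nu>, of f A]
  by (simp add: poly_lie_finsum \<nu>_keys Pi_iff)

lemma \<nu>_minus:
  assumes "x \<in> carrier T" "y \<in> carrier T"
  shows "x \<ominus>\<^bsub>T\<^esub> y \<in> carrier T" "\<nu> (x \<ominus>\<^bsub>T\<^esub> y) = \<nu> x - \<nu> y"
proof -
  interpret T: graded_space T by (rule graded_space_T)
  show "x \<ominus>\<^bsub>T\<^esub> y \<in> carrier T" "\<nu> (x \<ominus>\<^bsub>T\<^esub> y) = \<nu> x - \<nu> y"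
    using assms by (simp_all add: a_minus_def T.minus_eq_smult scl_minus_one)
qed

text \<open>
  The commutator in the tensor algebra is a sum over the degrees that occur in both arguments; under \<open>\<nu>\<close>
  it becomes the corresponding sum for the commutator of words.
\<close>

lemma graded_commutator_T:
  assumes x: "x \<in> carrier T" and y: "y \<in> carrier T"
  shows "graded_commutator T x y \<in> carrier T" "\<nu> (graded_commutator T x y) = commutator d (\<nu> x) (\<nu> y)"
proof -
  interpret T: graded_space T by (rule graded_space_T)
  let ?t = "\<lambda>i j. (T.comp i x \<otimes>\<^bsub>T\<^esub> T.comp j y) \<ominus>\<^bsub>T\<^esub> (koszul_sign (i * j) \<odot>\<^bsub>T\<^esub> (T.comp j y \<otimes>\<^bsub>T\<^esub> T.comp i x))"
  have t: "?t i j \<in> carrier T" for i j using x y by (intro \<nu>_minus) simp_all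
  then have s: "(\<Oplus>\<^bsub>T\<^esub>j\<in>A. ?t i j) \<in> carrier T" for i A by (intro T.finsum_closed) simp
  show "graded_commutator T x y \<in> carrier T" unfolding graded_commutator_def
    by (intro T.finsum_closed) (use s in simp)
  have supp: "word_degree d w \<in> {i. T.comp i z \<noteq> \<zero>\<^bsub>T\<^esub>}" if w: "w \<in> keys (\<nu> z)" and z: "z \<in> carrier T" for w z
  proof (rule CollectI, rule notI)
    assume "T.comp (word_degree d w) z = \<zero>\<^bsub>T\<^esub>"
    then have "component d (word_degree d w) (\<nu> z) = 0" using \<nu>_comp[OF z] by (metis \<nu>_simps(1))
    then have "keys (component d (word_degree d w) (\<nu> z)) = {}" by simp
    then show False using w unfolding keys_filt by blast
  qed
  show "\<nu> (graded_commutator T x y) = commutator d (\<nu> x) (\<nu> y)"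
    unfolding graded_commutator_def
    by (subst commutator_components[OF T.comp_finite[OF x] supp[OF _ x] T.comp_finite[OF y] supp[OF _ y]])
      (simp_all add: \<nu>_finsum s t \<nu>_minus x y \<nu>_comp)
qed

abbreviation "TL \<equiv> commutator_lie T"

lemma linear_map_\<nu>_TL: "linear_map TL P \<nu>"
  by (rule linear_mapI) (simp_all add: \<nu>_keys)

lemma graded_lie_algebra_TL: "graded_lie_algebra TL"
  by (rule graded_lie_transport[OF graded_lie_algebra_poly_lie[of d B], of \<nu>])
    (simp_all add: component_\<nu> inj_on_\<nu> linear_map_\<nu>_TL graded_commutator_T \<nu>_grade_P del: poly_lie_simps(6))

end

section \<open>Free graded Lie algebras\<close>

text \<open>
  A linear map from \<open>V\<close> into an associative algebra extends to the tensor algebra. If the target is a graded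
  algebra and the map has degree 0, then so has the extension, which therefore respects graded
  commutators.
\<close>

lemma tensor_algebra_extension:
  fixes V :: "('k::field_char_0, 'a, 'm) graded_space_scheme" and W :: "('k, 'b, 'n) graded_space_scheme"
  assumes V: "graded_space V" and W: "graded_space W" and g: "graded_map 0 V (tensor_algebra W) g"
  obtains \<Phi> where "graded_lie_hom (commutator_lie (tensor_algebra V)) (commutator_lie (tensor_algebra W)) \<Phi>"
    "\<And>x. x \<in> carrier V \<Longrightarrow> \<Phi> (tensor_inc V x) = g x"
proof -
  obtain B d where "homogeneous_basis V B d" using graded_space.homogeneous_basis_exists[OF V] .
  then interpret V: homogeneous_basis V B d .
  obtain B' d' where "homogeneous_basis W B' d'" using graded_space.homogeneous_basis_exists[OF W] .
  then interpret W: homogeneous_basis W B' d' .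
  note lin = linear_mapD[OF graded_mapD(1)[OF g]]
  define h where "h b = W.\<nu> (g b)" for b
  define \<Phi> where "\<Phi> x = tensor_class W (subst_letters h (V.\<nu> x))" for x
  have h: "homogeneous d' (d b) (h b)" "keys (h b) \<subseteq> lists B'" if "b \<in> B" for b
    using graded_mapD(2)[OF g V.basis_grade[OF that]] W.\<nu>_grade W.\<nu>_keys lin(1)[of b] V.basis_carrier that
    by (auto simp: h_def)
  have keys: "keys (subst_letters h (V.\<nu> x)) \<subseteq> lists B'" if "x \<in> carrier (tensor_algebra V)" for x
    using that by (intro keys_subst_letters[OF h(2) V.\<nu>_keys])
  have \<Phi>: "\<Phi> x \<in> carrier (tensor_algebra W)" "W.\<nu> (\<Phi> x) = subst_letters h (V.\<nu> x)"
    if "x \<in> carrier (tensor_algebra V)" for x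
    unfolding \<Phi>_def by (rule W.class_basis[OF keys[OF that]])+
  have "graded_lie_hom V.TL W.TL \<Phi>"
  proof (intro graded_lie_homI graded_mapI linear_mapI)
    fix x y c assume x: "x \<in> carrier V.TL" and y: "y \<in> carrier V.TL"
    show "\<Phi> (x \<oplus>\<^bsub>V.TL\<^esub> y) = \<Phi> x \<oplus>\<^bsub>W.TL\<^esub> \<Phi> y"
      by (rule W.\<nu>_inj) (use x y in \<open>simp_all add: \<Phi> subst_letters_add\<close>)
    show "\<Phi> (c \<odot>\<^bsub>V.TL\<^esub> x) = c \<odot>\<^bsub>W.TL\<^esub> \<Phi> x"
      by (rule W.\<nu>_inj) (use x in \<open>simp_all add: \<Phi> subst_letters_scl\<close>)
    show "\<Phi> (bracket V.TL x y) = bracket W.TL (\<Phi> x) (\<Phi> y)"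
      by (rule W.\<nu>_inj)
        (use x y in \<open>simp_all add: \<Phi> V.graded_commutator_T W.graded_commutator_T V.\<nu>_keys
          subst_letters_commutator[of B d' d h, OF h(1)]\<close>)
  next
    show "\<Phi> x \<in> carrier W.TL" if "x \<in> carrier V.TL" for x using that \<Phi> by simp
    show "\<Phi> x \<in> grade W.TL (n + 0)" if "x \<in> grade V.TL n" for n x
      using that homogeneous_subst_letters[of B d' d h, OF h(1)] V.\<nu>_keys[of x]
      by (simp add: V.\<nu>_grade W.\<nu>_grade \<Phi>)
  qed
  moreover have "\<Phi> (tensor_inc V x) = g x" if x: "x \<in> carrier V" for x
  proof (rule W.\<nu>_inj)
    have "linear_pm (\<lambda>p. subst_letters h (lin letter p))" by (rule linear_pm_comp) simp_all
    then have "subst_letters h (lin letter (V.coord x)) = lin h (V.coord x)"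
      by (rule lin_eq) simp
    also have "\<dots> = W.\<nu> (g x)"
      using V.linear_coord[of "\<lambda>x. W.\<nu> (g x)", OF _ _ x] by (simp add: h_def[abs_def] lin)
    finally show "W.\<nu> (\<Phi> (tensor_inc V x)) = W.\<nu> (g x)" using x \<Phi> by simp
  qed (use x \<Phi> lin in simp_all)
  ultimately show thesis by (rule that)
qed

lemma graded_lie_hom_subspaces:
  assumes A: "graded_lie_algebra A" and B: "graded_lie_algebra B" and f: "graded_lie_hom A B f"
    and S: "graded_lie_subalgebra S A" and fS: "\<And>x. x \<in> S \<Longrightarrow> f x \<in> S'"
  shows "graded_lie_hom (subspace_of A S) (subspace_of B S') f"
proof -
  interpret A: graded_lie_algebra A by fact
  have "S \<subseteq> carrier A" using S A.graded_subspaceD(7) by (simp add: graded_lie_subalgebra_iff)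
  then show ?thesis
    using graded_lie_homD[OF f] fS by (intro graded_lie_homI graded_mapI linear_mapI) (auto simp: subset_iff)
qed

context graded_space
begin

lemma graded_lie_algebra_tensor: "graded_lie_algebra (commutator_lie (tensor_algebra V))"
proof -
  obtain B d where "homogeneous_basis V B d" using homogeneous_basis_exists .
  then show ?thesis by (rule homogeneous_basis.graded_lie_algebra_TL)
qed

lemma graded_map_tensor_inc: "graded_map 0 V (commutator_lie (tensor_algebra V)) (tensor_inc V)"
proof -
  obtain B d where "homogeneous_basis V B d" using homogeneous_basis_exists .
  then interpret homogeneous_basis V B d .
  show ?thesis
    by (intro graded_mapI linear_mapI; (rule \<nu>_inj)?)
      (auto simp: \<nu>_grade lin_add lin_scl coord_add coord_smult homogeneous_expansion)
qed

lemma tensor_inc_image: "tensor_inc V ` carrier V \<subseteq> carrier (commutator_lie (tensor_algebra V))"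
  using linear_mapD(1)[OF graded_mapD(1)[OF graded_map_tensor_inc]] by blast

lemma free_lie_subalgebra:
  "graded_lie_subalgebra (carrier (free_lie V)) (commutator_lie (tensor_algebra V))"
  unfolding free_lie_eq
  using graded_lie_algebra.lie_generated_subalgebra[OF graded_lie_algebra_tensor tensor_inc_image] by simp

lemma graded_lie_algebra_free_lie: "graded_lie_algebra (free_lie V)"
  using graded_lie_algebra.subalgebra_subspace[OF graded_lie_algebra_tensor free_lie_subalgebra]
  by (simp add: free_lie_eq)

lemma free_lie_generated: "lie_generated (free_lie V) (tensor_inc V ` carrier V) = carrier (free_lie V)"
  using graded_lie_algebra.lie_generated_in_subspace[OF graded_lie_algebra_tensor free_lie_subalgebra,
      of "tensor_inc V ` carrier V"]
    lie_generated_subset[of "tensor_inc V ` carrier V" "commutator_lie (tensor_algebra V)"]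
  by (simp add: free_lie_eq)

lemma free_lie_inc: "graded_map 0 V (free_lie V) (tensor_inc V)"
proof -
  have "tensor_inc V x \<in> carrier (free_lie V)" if "x \<in> carrier V" for x
    using that lie_generated_subset[of "tensor_inc V ` carrier V"] by (auto simp: free_lie_eq)
  then show ?thesis
    using graded_map_tensor_inc by (auto simp: free_lie_eq graded_map_def linear_map_def)
qed

end

text \<open>
  The extension to tensor algebras maps Lie subalgebras generated by vectors into Lie subalgebras that
  contain the images of these vectors.
\<close>

lemma free_lie_extension:
  fixes V :: "('k::field_char_0, 'a, 'm) graded_space_scheme" and W :: "('k, 'b, 'n) graded_space_scheme"
  assumes V: "graded_space V" and W: "graded_space W" and g: "graded_map 0 V (free_lie W) g"
  obtains \<Phi> where "graded_lie_hom (free_lie V) (free_lie W) \<Phi>"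
    "\<And>x. x \<in> carrier V \<Longrightarrow> \<Phi> (tensor_inc V x) = g x"
proof -
  interpret V: graded_space V by fact
  interpret W: graded_space W by fact
  let ?TV = "commutator_lie (tensor_algebra V)" and ?TW = "commutator_lie (tensor_algebra W)"
  note TV = V.graded_lie_algebra_tensor and TW = W.graded_lie_algebra_tensor
  have sub: "carrier (free_lie W) \<subseteq> carrier ?TW"
    using graded_lie_algebra.lie_generated_carrier[OF TW W.tensor_inc_image] by (simp add: free_lie_eq)
  have "graded_map 0 V (tensor_algebra W) g"
    using g sub by (auto simp: graded_map_def linear_map_def free_lie_eq)
  from tensor_algebra_extension[OF V W this] obtain \<Phi> where \<Phi>: "graded_lie_hom ?TV ?TW \<Phi>"
    "\<And>x. x \<in> carrier V \<Longrightarrow> \<Phi> (tensor_inc V x) = g x" by blast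
  have "\<Phi> x \<in> carrier (free_lie W)" if "x \<in> carrier (free_lie V)" for x
  proof (rule lie_hom_generated[OF TV TW \<Phi>(1) V.tensor_inc_image W.free_lie_subalgebra])
    show "\<Phi> ` tensor_inc V ` carrier V \<subseteq> carrier (free_lie W)"
      using \<Phi>(2) linear_mapD(1)[OF graded_mapD(1)[OF g]] by auto
    show "x \<in> lie_generated ?TV (tensor_inc V ` carrier V)" using that by (simp add: free_lie_eq)
  qed
  then have "graded_lie_hom (subspace_of ?TV (carrier (free_lie V))) (subspace_of ?TW (carrier (free_lie W))) \<Phi>"
    by (rule graded_lie_hom_subspaces[OF TV TW \<Phi>(1) V.free_lie_subalgebra])
  then have "graded_lie_hom (free_lie V) (free_lie W) \<Phi>" by (simp add: free_lie_eq)
  then show thesis using that \<Phi>(2) by blast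
qed

section \<open>Adjoining free generators\<close>

lemma graded_subspace_image:
  assumes V: "graded_space V" and W: "graded_space W" and h: "graded_map 0 V W h" and S: "graded_subspace S V"
  shows "graded_subspace (h ` S) W"
proof -
  interpret V: graded_space V by fact
  interpret W: graded_space W by fact
  note s = V.graded_subspaceD[OF S] and lin = linear_mapD[OF graded_mapD(1)[OF h]]
  show ?thesis
  proof (rule W.graded_subspaceI)
    show "\<zero>\<^bsub>W\<^esub> \<in> h ` S"
      using linear_map_zero[OF V.module_axioms W.module_axioms graded_mapD(1)[OF h]] s(4) by force
    show "y \<oplus>\<^bsub>W\<^esub> z \<in> h ` S" if yz: "y \<in> h ` S" "z \<in> h ` S" for y z
    proof -
      from yz obtain a b where ab: "a \<in> S" "b \<in> S" "y = h a" "z = h b" by blast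
      then have "y \<oplus>\<^bsub>W\<^esub> z = h (a \<oplus>\<^bsub>V\<^esub> b)" using lin(2) s(3) by simp
      then show ?thesis using s(5)[OF ab(1,2)] by blast
    qed
    show "c \<odot>\<^bsub>W\<^esub> y \<in> h ` S" if y: "y \<in> h ` S" for c y
    proof -
      from y obtain a where a: "a \<in> S" "y = h a" by blast
      then have "c \<odot>\<^bsub>W\<^esub> y = h (c \<odot>\<^bsub>V\<^esub> a)" using lin(3) s(3) by simp
      then show ?thesis using s(6)[OF a(1)] by blast
    qed
    show "W.comp n y \<in> h ` S" if y: "y \<in> h ` S" for n y
    proof -
      from y obtain a where a: "a \<in> S" "y = h a" by blast
      then have "W.comp n y = h (V.comp n a)" using graded_map_comp[OF V W h s(3)] by simp
      then show ?thesis using s(2)[OF a(1)] by blast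
    qed
  qed (use lin(1) s(3) in auto)
qed

lemma (in scalar_module) lincomb_submodule:
  "submodule S (scalars :: 'k ring) V \<Longrightarrow> keys f \<subseteq> S \<Longrightarrow> lincomb V f \<in> S"
  unfolding lincomb_def by (rule finsum_mem) (auto simp: submoduleD)

definition with_diff :: "('k::field_char_0, 'a) graded_lie \<Rightarrow> ('a \<Rightarrow> 'a) \<Rightarrow> ('k, 'a) dg_lie" where
  "with_diff L D = graded_lie.extend L \<lparr>diff = D\<rparr>"

lemma with_diff_simps [simp]:
  "carrier (with_diff L D) = carrier L" "add (with_diff L D) = add L" "zero (with_diff L D) = zero L"
  "smult (with_diff L D) = smult L" "grade (with_diff L D) = grade L" "bracket (with_diff L D) = bracket L"
  "diff (with_diff L D) = D"
  by (simp_all add: with_diff_def graded_lie.defs)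

lemma graded_lie_algebra_with_diff:
  assumes "graded_lie_algebra L" shows "graded_lie_algebra (with_diff L D)"
proof -
  interpret graded_lie_algebra L by fact
  show ?thesis
    by (rule graded_lie_transport[OF assms, of "\<lambda>x. x"]) (auto intro!: linear_mapI)
qed

lemma subalgebra_with_diff:
  assumes "graded_lie_algebra L"
  shows "graded_lie_subalgebra S (with_diff L D) \<longleftrightarrow> graded_lie_subalgebra S L"
proof -
  interpret L: graded_lie_algebra L by fact
  interpret M: graded_lie_algebra "with_diff L D" by (rule graded_lie_algebra_with_diff[OF assms])
  have "graded_map 0 (with_diff L D) L (\<lambda>x. x)" by (auto intro!: graded_mapI linear_mapI)
  from graded_map_comp[OF M.graded_space_axioms L.graded_space_axioms this]
  have "homog_component (with_diff L D) n x = homog_component L n x" if "x \<in> carrier L" for n x using that by simp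
  then show ?thesis
    by (auto simp: graded_lie_subalgebra_iff graded_subspace_def M.submodule_iff L.submodule_iff subset_iff)
qed

lemma diff_subspace_of [simp]: "diff (subspace_of M S) = diff M"
  by (simp add: subspace_of_def)

lemma (in dg_lie_algebra) dg_subalgebra:
  assumes S: "graded_lie_subalgebra S L" and D: "\<And>x. x \<in> S \<Longrightarrow> diff L x \<in> S"
  shows "dg_lie_algebra (subspace_of L S)"
proof -
  have S': "graded_subspace S L" using S by (simp add: graded_lie_subalgebra_iff)
  note s = graded_subspaceD[OF S']
  show ?thesis
    by (rule dg_lie_algebra.intro[OF subalgebra_subspace[OF S] dg_lie_algebra_axioms.intro])
      (use diff_graded_map diff_square diff_leibniz D s in
        \<open>auto simp: graded_map_def linear_map_def leibniz_def image_subset_iff\<close>)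
qed

lemma lie_homs_agree:
  assumes A: "graded_lie_algebra A" and B: "graded_lie_algebra B"
    and f: "graded_lie_hom A B f" and g: "graded_lie_hom A B g"
    and G: "G \<subseteq> carrier A" and fg: "\<And>x. x \<in> G \<Longrightarrow> f x = g x" and x: "x \<in> lie_generated A G"
  shows "f x = g x"
proof -
  interpret A: graded_lie_algebra A by fact
  have car: "y \<in> carrier A" if "y \<in> lie_generated A G" for y using A.lie_generated_carrier[OF G] that by blast
  show ?thesis using G x
    by (induction rule: A.lie_generated_induct)
      (use fg in \<open>auto simp: car graded_lie_homD[OF f] graded_lie_homD[OF g] graded_lie_hom_zero[OF A B f]
        graded_lie_hom_zero[OF A B g] graded_lie_hom_comp[OF A B f] graded_lie_hom_comp[OF A B g]\<close>)
qed

lemma kernel_graded_lie_ideal: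
  assumes A: "graded_lie_algebra A" and B: "graded_lie_algebra B" and f: "graded_lie_hom A B f"
  shows "graded_lie_ideal {x \<in> carrier A. f x = \<zero>\<^bsub>B\<^esub>} A"
proof -
  interpret A: graded_lie_algebra A by fact
  interpret B: graded_lie_algebra B by fact
  have "graded_subspace {x \<in> carrier A. f x = \<zero>\<^bsub>B\<^esub>} A"
    by (rule A.graded_subspaceI)
      (auto simp: graded_lie_homD[OF f] graded_lie_hom_zero[OF A B f] graded_lie_hom_comp[OF A B f])
  then show ?thesis
    by (auto simp: graded_lie_ideal_iff graded_lie_homD[OF f])
qed

text \<open>
  Injectivity follows by applying \<open>\<psi>\<close>, which is well defined on \<open>F / I\<close> and left inverse to \<open>\<chi>\<close>.
  Surjectivity holds, degree by degree, since the coset of \<open>f\<close> is the image of \<open>\<psi> f\<close>.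
\<close>

lemma graded_lie_iso_quotient:
  fixes F :: "('k::field_char_0, 'b) graded_lie" (structure)
  assumes F: "graded_lie_algebra F" and A: "graded_lie_algebra A" and I: "graded_lie_ideal I F"
    and \<chi>: "graded_lie_hom A F \<chi>" and \<psi>: "graded_lie_hom F A \<psi>"
    and I\<psi>: "\<And>x. x \<in> I \<Longrightarrow> \<psi> x = \<zero>\<^bsub>A\<^esub>"
    and \<psi>\<chi>: "\<And>x. x \<in> carrier A \<Longrightarrow> \<psi> (\<chi> x) = x"
    and \<chi>\<psi>: "\<And>x. x \<in> carrier F \<Longrightarrow> I +> \<chi> (\<psi> x) = I +> x"
  shows "graded_lie_iso A (lie_quotient F I) (\<lambda>x. I +> \<chi> x)"
proof -
  interpret F: graded_lie_algebra F by fact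
  interpret A: graded_lie_algebra A by fact
  have hom: "graded_lie_hom A (lie_quotient F I) (\<lambda>x. I +> \<chi> x)"
    by (rule graded_lie_hom_compose[OF \<chi> lie_quotient_hom[OF F I]])
  have inj: "inj_on (\<lambda>x. I +> \<chi> x) (carrier A)"
  proof (rule inj_onI)
    fix x y assume x: "x \<in> carrier A" and y: "y \<in> carrier A" and "I +> \<chi> x = I +> \<chi> y"
    then have "\<chi> x \<oplus> (- 1) \<odot> \<chi> y \<in> I"
      using F.coset_eq_iff[OF I] graded_lie_homD(3)[OF \<chi>] by (simp add: F.diff_eq_smult[OF I])
    from I\<psi>[OF this] have "x \<oplus>\<^bsub>A\<^esub> (- 1) \<odot>\<^bsub>A\<^esub> y = \<zero>\<^bsub>A\<^esub>"
      using x y graded_lie_homD(3)[OF \<chi>] by (simp add: graded_lie_homD[OF \<psi>] \<psi>\<chi>)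
    then have "x \<oplus>\<^bsub>A\<^esub> \<ominus>\<^bsub>A\<^esub> y = \<zero>\<^bsub>A\<^esub>" using x y by (simp add: A.minus_eq_smult)
    then show "x = y" using x y A.minus_equality[of x "\<ominus>\<^bsub>A\<^esub> y"] by simp
  qed
  have grade: "grade (lie_quotient F I) n \<subseteq> (\<lambda>x. I +> \<chi> x) ` grade A n" for n
  proof
    fix X assume "X \<in> grade (lie_quotient F I) n"
    then obtain f where f: "f \<in> grade F n" "X = I +> f" by (auto simp: lie_quotient_def)
    then have "X = I +> \<chi> (\<psi> f)" using \<chi>\<psi> F.grade_mem[OF f(1)] by simp
    then show "X \<in> (\<lambda>x. I +> \<chi> x) ` grade A n" using graded_lie_homD(6)[OF \<psi> f(1)] by blast
  qed
  have "carrier (lie_quotient F I) \<subseteq> (\<lambda>x. I +> \<chi> x) ` carrier A"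
  proof
    fix X assume "X \<in> carrier (lie_quotient F I)"
    then obtain f where f: "f \<in> carrier F" "X = I +> f" by (auto simp: lie_quotient_def A_RCOSETS_def')
    then have "X = I +> \<chi> (\<psi> f)" using \<chi>\<psi> by simp
    then show "X \<in> (\<lambda>x. I +> \<chi> x) ` carrier A" using graded_lie_homD(3)[OF \<psi> f(1)] by blast
  qed
  then have "bij_betw (\<lambda>x. I +> \<chi> x) (carrier A) (carrier (lie_quotient F I))"
    using inj graded_lie_homD(3)[OF hom] by (auto simp: bij_betw_def)
  moreover have "(\<lambda>x. I +> \<chi> x) ` grade A n = grade (lie_quotient F I) n" for n
    using grade graded_lie_homD(6)[OF hom] by blast
  ultimately show ?thesis using hom by (simp add: graded_lie_iso_def)
qed

context homogeneous_basis
begin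

abbreviation "L \<equiv> free_lie V"

abbreviation "\<iota> \<equiv> tensor_inc V"

definition sub_lie :: "'a set \<Rightarrow> ('a list \<Rightarrow>\<^sub>0 'k) set set" where
  "sub_lie X = lie_generated L (\<iota> ` X)"

lemmas inc_simps = linear_mapD[OF graded_mapD(1)[OF free_lie_inc]] graded_mapD(2)[OF free_lie_inc]

sublocale L: graded_lie_algebra L by (rule graded_lie_algebra_free_lie)

lemma inc_zero: "\<iota> \<zero> = \<zero>\<^bsub>L\<^esub>"
  by (rule linear_map_zero[OF module_axioms L.module_axioms graded_mapD(1)[OF free_lie_inc]])

lemma inc_carrier: "X \<subseteq> B \<Longrightarrow> \<iota> ` X \<subseteq> carrier L"
  using basis_carrier inc_simps(1) by blast

lemma sub_lie_subalgebra: "X \<subseteq> B \<Longrightarrow> graded_lie_subalgebra (sub_lie X) L"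
  unfolding sub_lie_def by (rule L.lie_generated_subalgebra[OF inc_carrier])

lemma sub_lie_graded: "X \<subseteq> B \<Longrightarrow> graded_subspace (sub_lie X) L"
  using sub_lie_subalgebra by (simp add: graded_lie_subalgebra_iff)

lemma sub_lie_mono: "X \<subseteq> Y \<Longrightarrow> sub_lie X \<subseteq> sub_lie Y"
  unfolding sub_lie_def by (intro lie_generated_mono image_mono)

lemma graded_subspace_span_induct:
  assumes W: "graded_space W" and h: "graded_map k V W h" and S: "graded_subspace S W"
    and X: "\<And>b. b \<in> X \<Longrightarrow> h b \<in> S" and x: "x \<in> carrier V" "keys (coord x) \<subseteq> X"
  shows "h x \<in> S"
proof -
  have sub: "submodule {x \<in> carrier V. h x \<in> S} scalars V"
    using graded_subspace_preimage[OF W h S] by (simp add: graded_subspace_def)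
  have "lincomb V (coord x) \<in> {x \<in> carrier V. h x \<in> S}"
    by (rule lincomb_submodule[OF sub]) (use X x coord_keys_carrier[OF x(1)] in auto)
  then show ?thesis using x by simp
qed

lemma inc_sub_lie:
  assumes X: "X \<subseteq> B" and x: "x \<in> carrier V" "keys (coord x) \<subseteq> X"
  shows "\<iota> x \<in> sub_lie X"
  by (rule graded_subspace_span_induct[OF L.graded_space_axioms free_lie_inc sub_lie_graded[OF X] _ x])
    (use lie_generated_subset[of "\<iota> ` X" L] in \<open>auto simp: sub_lie_def\<close>)

end

lemma graded_map_pair:
  assumes "graded_map 0 U V f" "graded_map 0 U W g"
  shows "graded_map 0 U (direct_sum V W) (\<lambda>x. (f x, g x))"
  using assms by (auto simp: graded_map_def linear_map_def direct_sum_def Pi_iff image_subset_iff)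

text \<open>
  A differential \<open>D\<close> on the free Lie algebra on \<open>V\<close>, and basis elements \<open>B1 \<subseteq> B2\<close> such that \<open>D\<close> maps both
  the subalgebra generated by \<open>B1\<close> and the generators in \<open>B2\<close> into the former. Then \<open>A1\<close> and \<open>A2\<close> are DG-Lie
  algebras, and \<open>VZ\<close> is the graded space spanned by the new generators.
\<close>

locale adjoined_generators = homogeneous_basis V B d
  for V :: "('k::field_char_0, 'a, 'm) graded_space_scheme" (structure) and B d +
  fixes B1 B2 :: "'a set" and D :: "('a list \<Rightarrow>\<^sub>0 'k) set \<Rightarrow> ('a list \<Rightarrow>\<^sub>0 'k) set"
  assumes B12: "B1 \<subseteq> B2" "B2 \<subseteq> B"
    and dg: "dg_lie_algebra (with_diff (free_lie V) D)"
    and D_B1: "\<And>x. x \<in> sub_lie B1 \<Longrightarrow> D x \<in> sub_lie B1"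
    and D_B2: "\<And>b. b \<in> B2 \<Longrightarrow> D (\<iota> b) \<in> sub_lie B1"
begin

abbreviation "M \<equiv> with_diff L D"

definition "A1 = subspace_of M (sub_lie B1)"

definition "A2 = subspace_of M (sub_lie B2)"

definition "Z = \<iota> ` {x \<in> carrier V. keys (coord x) \<subseteq> B2 - B1}"

definition VZ :: "('k, ('a list \<Rightarrow>\<^sub>0 'k) set) graded_space" where
  "VZ = \<lparr>carrier = Z, mult = undefined, one = undefined, zero = zero L, add = add L, smult = smult L,
     grade = (\<lambda>n. grade L n \<inter> Z)\<rparr>"

lemma Bs: "B1 \<subseteq> B" "B2 \<subseteq> B" "B2 - B1 \<subseteq> B" "B2 - B1 \<subseteq> B2"
  using B12 by auto

lemma graded_Z: "graded_subspace Z L"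
  unfolding Z_def
  by (rule graded_subspace_image[OF graded_space_axioms L.graded_space_axioms free_lie_inc graded_subspace_coord])

lemma Z_sub_lie: "Z \<subseteq> sub_lie B2"
  unfolding Z_def using inc_sub_lie[OF Bs(2)] by auto

sublocale M: dg_lie_algebra M by (rule dg)

lemma graded_map_D: "graded_map 1 L L D" and leibniz_D: "leibniz L D"
  using M.diff_graded_map M.diff_leibniz by (auto simp: graded_map_def linear_map_def leibniz_def)

lemma D_sub_lie_B2: "x \<in> sub_lie B2 \<Longrightarrow> D x \<in> sub_lie B2"
  unfolding sub_lie_def
  by (rule L.derivation_lie_generated[OF graded_map_D leibniz_D inc_carrier[OF Bs(2)]])
    (use D_B2 sub_lie_mono[OF B12(1)] in \<open>auto simp: sub_lie_def\<close>)

lemma dg_A1: "dg_lie_algebra A1"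
  unfolding A1_def
  by (rule M.dg_subalgebra) (simp_all only: subalgebra_with_diff[OF L.graded_lie_algebra_axioms] sub_lie_subalgebra[OF Bs(1)] with_diff_simps D_B1)

lemma dg_A2: "dg_lie_algebra A2"
  unfolding A2_def
  by (rule M.dg_subalgebra) (simp_all only: subalgebra_with_diff[OF L.graded_lie_algebra_axioms] sub_lie_subalgebra[OF Bs(2)] with_diff_simps D_sub_lie_B2)

end

lemma direct_sum_simps [simp]:
  "carrier (direct_sum V W) = carrier V \<times> carrier W" "zero (direct_sum V W) = (zero V, zero W)"
  "grade (direct_sum V W) n = grade V n \<times> grade W n"
  "(a, b) \<oplus>\<^bsub>direct_sum V W\<^esub> (a', b') = (a \<oplus>\<^bsub>V\<^esub> a', b \<oplus>\<^bsub>W\<^esub> b')"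
  "c \<odot>\<^bsub>direct_sum V W\<^esub> (a, b) = (c \<odot>\<^bsub>V\<^esub> a, c \<odot>\<^bsub>W\<^esub> b)"
  by (simp_all add: direct_sum_def)

lemma graded_map_zero:
  assumes "graded_space W" shows "graded_map 0 V W (\<lambda>_. \<zero>\<^bsub>W\<^esub>)"
proof -
  interpret graded_space W by fact
  show ?thesis by (auto intro!: graded_mapI linear_mapI)
qed

context adjoined_generators
begin

lemma A1_simps [simp]:
  "carrier A1 = sub_lie B1" "zero A1 = zero L" "add A1 = add L" "smult A1 = smult L" "bracket A1 = bracket L"
  "grade A1 n = grade L n \<inter> sub_lie B1" "diff A1 = D"
  and A2_simps [simp]:
  "carrier A2 = sub_lie B2" "zero A2 = zero L" "add A2 = add L" "smult A2 = smult L" "bracket A2 = bracket L"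
  "grade A2 n = grade L n \<inter> sub_lie B2" "diff A2 = D"
  and VZ_simps [simp]:
  "carrier VZ = Z" "zero VZ = zero L" "add VZ = add L" "smult VZ = smult L" "grade VZ n = grade L n \<inter> Z"
  by (simp_all add: A1_def A2_def VZ_def)

lemma graded_space_VZ: "graded_space VZ"
  by (rule graded_space_transport[OF L.graded_space_axioms, of "\<lambda>x. x"])
    (use L.graded_subspaceD[OF graded_Z] in \<open>auto intro!: linear_mapI\<close>)

lemma sub_lie_carrier: "X \<subseteq> B \<Longrightarrow> x \<in> sub_lie X \<Longrightarrow> x \<in> carrier L"
  by (rule L.graded_subspaceD(3)[OF sub_lie_graded])

text \<open>
  The isomorphism from \<open>A2\<close> to the coproduct is induced by a homomorphism \<open>\<chi>\<close> into the free Lie algebra \<open>F\<close> on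
  the sum of \<open>A1\<close> and the free Lie algebra on \<open>VZ\<close>, of which the coproduct is the quotient by the ideal \<open>I\<close>.
  The universal property of \<open>F\<close> provides \<open>\<psi>\<close> in the other direction, and all identities between \<open>\<chi>\<close> and
  \<open>\<psi>\<close> are checked on generators.
\<close>

theorem elementary_extension: "elementary_semifree_extension A1 A2 (\<lambda>x. x)"
proof -
  let ?LV = "free_lie VZ"
  let ?W = "direct_sum A1 ?LV"
  let ?F = "free_lie ?W"
  let ?I = "coproduct_ideal A1 ?LV"
  interpret A1: dg_lie_algebra A1 by (rule dg_A1)
  interpret A2: dg_lie_algebra A2 by (rule dg_A2)
  interpret VZ: graded_space VZ by (rule graded_space_VZ)
  interpret LV: graded_lie_algebra ?LV by (rule VZ.graded_lie_algebra_free_lie)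
  interpret W: graded_space ?W
    by (rule graded_space_direct_sum[OF A1.graded_space_axioms LV.graded_space_axioms])
  interpret F: graded_lie_algebra ?F by (rule W.graded_lie_algebra_free_lie)
  note s1 = sub_lie_carrier[OF Bs(1)] and s2 = sub_lie_carrier[OF Bs(2)]
  have s12: "x \<in> sub_lie B2" if "x \<in> sub_lie B1" for x using that sub_lie_mono[OF B12(1)] by blast
  have incl1: "graded_lie_hom A1 L (\<lambda>x. x)" and incl2: "graded_lie_hom A2 L (\<lambda>x. x)"
    by (auto intro!: graded_lie_homI graded_mapI linear_mapI simp: s1 s2)
  have incl12: "graded_lie_hom A1 A2 (\<lambda>x. x)"
    by (auto intro!: graded_lie_homI graded_mapI linear_mapI simp: s12)

  (* The inclusions of the summands into F are linear, and homomorphisms only modulo I. *)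
  define \<alpha> where "\<alpha> a = tensor_inc ?W (a, \<zero>\<^bsub>?LV\<^esub>)" for a
  define \<beta> where "\<beta> v = tensor_inc ?W (\<zero>\<^bsub>L\<^esub>, v)" for v
  have \<alpha>: "graded_map 0 A1 ?F \<alpha>"
    using graded_map_compose[OF graded_map_pair[OF A1.graded_map_id graded_map_zero[OF LV.graded_space_axioms]]
      W.free_lie_inc] by (simp add: \<alpha>_def[abs_def])
  have \<beta>: "graded_map 0 ?LV ?F \<beta>"
    using graded_map_compose[OF graded_map_pair[OF graded_map_zero[OF A1.graded_space_axioms] LV.graded_map_id]
      W.free_lie_inc] by (simp add: \<beta>_def[abs_def])
  note \<alpha>s = linear_mapD[OF graded_mapD(1)[OF \<alpha>], simplified] and \<beta>s = linear_mapD[OF graded_mapD(1)[OF \<beta>]]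
  have inc_W: "tensor_inc ?W (a, v) = \<alpha> a \<oplus>\<^bsub>?F\<^esub> \<beta> v" if "a \<in> sub_lie B1" "v \<in> carrier ?LV" for a v
    using linear_mapD(2)[OF graded_mapD(1)[OF W.free_lie_inc], of "(a, \<zero>\<^bsub>?LV\<^esub>)" "(\<zero>\<^bsub>L\<^esub>, v)"] that s1
      A1.zero_closed by (simp add: \<alpha>_def \<beta>_def)

  define X where "X = {bracket ?F (\<alpha> a) (\<alpha> a') \<ominus>\<^bsub>?F\<^esub> \<alpha> (bracket A1 a a') | a a'. a \<in> carrier A1 \<and> a' \<in> carrier A1} \<union>
    {bracket ?F (\<beta> b) (\<beta> b') \<ominus>\<^bsub>?F\<^esub> \<beta> (bracket ?LV b b') | b b'. b \<in> carrier ?LV \<and> b' \<in> carrier ?LV}"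
  have I_eq: "?I = lie_ideal_generated ?F X"
    by (simp add: coproduct_ideal_def X_def \<alpha>_def[abs_def] \<beta>_def[abs_def] Let_def)
  have "bracket L a a' \<in> sub_lie B1" if "a \<in> sub_lie B1" "a' \<in> sub_lie B1" for a a'
    using A1.bracket_simps(1)[of a a'] that by simp
  note br1 = this
  have "X \<subseteq> carrier ?F"
    unfolding X_def by (auto intro!: F.minus_closed F.bracket_simps \<alpha>s \<beta>s br1 LV.bracket_simps)
  then have I: "graded_lie_ideal ?I ?F" unfolding I_eq by (rule F.lie_ideal_generated_ideal)
  have XI: "x \<in> ?I" if "x \<in> X" for x using that unfolding I_eq by (auto simp: lie_ideal_generated_def)
  have \<alpha>_rel: "?I +>\<^bsub>?F\<^esub> \<alpha> (bracket L a a') = ?I +>\<^bsub>?F\<^esub> bracket ?F (\<alpha> a) (\<alpha> a')"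
    if a: "a \<in> sub_lie B1" "a' \<in> sub_lie B1" for a a'
  proof (rule sym, rule F.coset_eq_iff[OF I, THEN iffD2])
    have "bracket ?F (\<alpha> a) (\<alpha> a') \<ominus>\<^bsub>?F\<^esub> \<alpha> (bracket A1 a a') \<in> X" unfolding X_def using a by auto
    from XI[OF this] show "bracket ?F (\<alpha> a) (\<alpha> a') \<ominus>\<^bsub>?F\<^esub> \<alpha> (bracket L a a') \<in> ?I" by simp
  qed (simp_all add: \<alpha>s br1 a)
  have \<beta>_rel: "?I +>\<^bsub>?F\<^esub> \<beta> (bracket ?LV b b') = ?I +>\<^bsub>?F\<^esub> bracket ?F (\<beta> b) (\<beta> b')"
    if b: "b \<in> carrier ?LV" "b' \<in> carrier ?LV" for b b'
  proof (rule sym, rule F.coset_eq_iff[OF I, THEN iffD2])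
    have "bracket ?F (\<beta> b) (\<beta> b') \<ominus>\<^bsub>?F\<^esub> \<beta> (bracket ?LV b b') \<in> X" unfolding X_def using b by auto
    from XI[OF this] show "bracket ?F (\<beta> b) (\<beta> b') \<ominus>\<^bsub>?F\<^esub> \<beta> (bracket ?LV b b') \<in> ?I" .
  qed (simp_all add: \<beta>s b)

  (* The map chi sends old generators to the first summand and new ones to the second. *)
  let ?pr1 = "basis_projection B1" and ?pr2 = "basis_projection (B2 - B1)"
  have pr1: "\<iota> (?pr1 x) \<in> sub_lie B1" if "x \<in> carrier V" for x
    by (rule inc_sub_lie[OF Bs(1)]) (use that in \<open>auto simp: coord_basis_projection\<close>)
  have pr2: "\<iota> (?pr2 x) \<in> Z" if "x \<in> carrier V" for x
    using that by (auto simp: Z_def coord_basis_projection)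
  have "graded_map 0 V A1 (\<lambda>x. \<iota> (?pr1 x))"
    using graded_map_compose[OF graded_map_basis_projection free_lie_inc, of B1] pr1
    by (auto simp: graded_map_def linear_map_def)
  moreover have "graded_map 0 V VZ (\<lambda>x. \<iota> (?pr2 x))"
    using graded_map_compose[OF graded_map_basis_projection free_lie_inc, of "B2 - B1"] pr2
    by (auto simp: graded_map_def linear_map_def)
  from graded_map_compose[OF this VZ.free_lie_inc]
  have "graded_map 0 V ?LV (\<lambda>x. tensor_inc VZ (\<iota> (?pr2 x)))" by simp
  ultimately have "graded_map 0 V ?F (\<lambda>x. tensor_inc ?W (\<iota> (?pr1 x), tensor_inc VZ (\<iota> (?pr2 x))))"
    using graded_map_compose[OF graded_map_pair W.free_lie_inc] by fastforce
  from free_lie_extension[OF graded_space_axioms W.graded_space_axioms this]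
  obtain \<chi> where \<chi>: "graded_lie_hom L ?F \<chi>"
    and \<chi>_inc: "\<And>x. x \<in> carrier V \<Longrightarrow> \<chi> (\<iota> x) = tensor_inc ?W (\<iota> (?pr1 x), tensor_inc VZ (\<iota> (?pr2 x)))"
    by blast
  note \<chi>s = graded_lie_homD[OF \<chi>]

  (* The map psi is the inclusion on A1 and the extension j of the inclusion of VZ on the other summand. *)
  have "graded_map 0 VZ L (\<lambda>z. z)"
    using L.graded_subspaceD[OF graded_Z] by (auto intro!: graded_mapI linear_mapI)
  from free_lie_extension[OF graded_space_VZ graded_space_axioms this]
  obtain j where j: "graded_lie_hom ?LV L j" and j_inc: "\<And>z. z \<in> Z \<Longrightarrow> j (tensor_inc VZ z) = z" by auto
  note js = graded_lie_homD[OF j]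
  have "graded_map 0 ?W L (\<lambda>(a, v). a \<oplus>\<^bsub>L\<^esub> j v)"
    by (intro graded_mapI linear_mapI)
      (auto simp: js s1 L.a_ac L.smult_add intro!: L.grade_add)
  from free_lie_extension[OF W.graded_space_axioms graded_space_axioms this]
  obtain \<psi> where \<psi>: "graded_lie_hom ?F L \<psi>"
    and \<psi>_inc': "\<And>w. w \<in> carrier ?W \<Longrightarrow> \<psi> (tensor_inc ?W w) = (case w of (a, v) \<Rightarrow> a \<oplus>\<^bsub>L\<^esub> j v)"
    by blast
  note \<psi>s = graded_lie_homD[OF \<psi>]
  have \<psi>_inc: "\<psi> (tensor_inc ?W (a, v)) = a \<oplus>\<^bsub>L\<^esub> j v" if "a \<in> sub_lie B1" "v \<in> carrier ?LV" for a v
    using \<psi>_inc'[of "(a, v)"] that by simp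
  have j0: "j \<zero>\<^bsub>?LV\<^esub> = \<zero>\<^bsub>L\<^esub>"
    by (rule graded_lie_hom_zero[OF LV.graded_lie_algebra_axioms L.graded_lie_algebra_axioms j])
  have zero1: "\<zero>\<^bsub>L\<^esub> \<in> sub_lie B1" using A1.zero_closed by simp
  have \<psi>\<alpha>: "\<psi> (\<alpha> a) = a" if "a \<in> sub_lie B1" for a
    using that s1 by (simp add: \<alpha>_def \<psi>_inc j0)
  have \<psi>\<beta>: "\<psi> (\<beta> v) = j v" if "v \<in> carrier ?LV" for v
    using that zero1 by (simp add: \<beta>_def \<psi>_inc js)

  have incV: "tensor_inc VZ z \<in> carrier ?LV" if "z \<in> Z" for z
    using linear_mapD(1)[OF graded_mapD(1)[OF VZ.free_lie_inc]] that by simp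
  have inc_img: "tensor_inc VZ ` carrier VZ \<subseteq> carrier ?LV" using incV by auto
  have img_W: "tensor_inc ?W ` carrier ?W \<subseteq> carrier ?F"
    using linear_mapD(1)[OF graded_mapD(1)[OF W.free_lie_inc]] by auto
  have j_sub: "j v \<in> sub_lie B2" if "v \<in> carrier ?LV" for v
    by (rule lie_hom_generated[OF LV.graded_lie_algebra_axioms L.graded_lie_algebra_axioms j inc_img
          sub_lie_subalgebra[OF Bs(2)]])
      (use that Z_sub_lie j_inc VZ.free_lie_generated in auto)
  have \<psi>_sub: "\<psi> f \<in> sub_lie B2" if "f \<in> carrier ?F" for f
  proof (rule lie_hom_generated[OF F.graded_lie_algebra_axioms L.graded_lie_algebra_axioms \<psi> img_W
        sub_lie_subalgebra[OF Bs(2)]])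
    show "\<psi> ` tensor_inc ?W ` carrier ?W \<subseteq> sub_lie B2"
      using A2.a_closed by (auto simp: \<psi>_inc s12 j_sub)
    show "f \<in> lie_generated ?F (tensor_inc ?W ` carrier ?W)" using that W.free_lie_generated by simp
  qed

  have \<psi>\<chi>: "\<psi> (\<chi> x) = x" if x: "x \<in> sub_lie B2" for x
  proof (rule lie_homs_agree[OF L.graded_lie_algebra_axioms L.graded_lie_algebra_axioms
        graded_lie_hom_compose[OF \<chi> \<psi>] _ inc_carrier[OF Bs(2)] _ x[unfolded sub_lie_def]])
    show "graded_lie_hom L L (\<lambda>x. x)" by (rule graded_lie_homI[OF L.graded_map_id]) simp
    fix y assume "y \<in> \<iota> ` B2"
    then obtain b where b: "b \<in> B2" "y = \<iota> b" by blast
    have bc: "b \<in> carrier V" "b \<in> B" using b Bs basis_carrier by auto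
    have "\<psi> (\<chi> y) = \<iota> (?pr1 b) \<oplus>\<^bsub>L\<^esub> \<iota> (?pr2 b)"
      using bc b by (simp add: \<chi>_inc \<psi>_inc pr1 pr2 incV j_inc)
    also have "\<dots> = y"
      using bc b by (cases "b \<in> B1") (simp_all add: basis_projection_id basis_projection_zero inc_zero inc_simps)
    finally show "\<psi> (\<chi> y) = y" .
  qed

  have \<psi>_I: "\<psi> x = \<zero>\<^bsub>L\<^esub>" if "x \<in> ?I" for x
  proof -
    have "X \<subseteq> {x \<in> carrier ?F. \<psi> x = \<zero>\<^bsub>L\<^esub>}"
    proof
      fix x assume x: "x \<in> X"
      then have xF: "x \<in> carrier ?F" using \<open>X \<subseteq> carrier ?F\<close> by blast
      have diff: "\<psi> (f \<ominus>\<^bsub>?F\<^esub> g) = \<zero>\<^bsub>L\<^esub>" if "f \<in> carrier ?F" "g \<in> carrier ?F" "\<psi> f = \<psi> g" for f g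
        using that L.smult_plus[of "\<psi> g" 1 "- 1"] \<psi>s(3)[of g]
        by (simp add: F.diff_eq_smult[OF I] \<psi>s)
      from x consider
        (1) a a' where "x = bracket ?F (\<alpha> a) (\<alpha> a') \<ominus>\<^bsub>?F\<^esub> \<alpha> (bracket L a a')" "a \<in> sub_lie B1" "a' \<in> sub_lie B1"
      | (2) b b' where "x = bracket ?F (\<beta> b) (\<beta> b') \<ominus>\<^bsub>?F\<^esub> \<beta> (bracket ?LV b b')" "b \<in> carrier ?LV" "b' \<in> carrier ?LV"
        by (auto simp: X_def)
      then have "\<psi> x = \<zero>\<^bsub>L\<^esub>"
      proof cases
        case 1
        then show ?thesis by (simp add: diff \<alpha>s br1 \<psi>s \<psi>\<alpha>)
      next
        case 2
        then show ?thesis by (simp add: diff \<beta>s \<psi>s \<psi>\<beta> js)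
      qed
      then show "x \<in> {x \<in> carrier ?F. \<psi> x = \<zero>\<^bsub>L\<^esub>}" using xF by simp
    qed
    then have "?I \<subseteq> {x \<in> carrier ?F. \<psi> x = \<zero>\<^bsub>L\<^esub>}"
      unfolding I_eq lie_ideal_generated_def
      using kernel_graded_lie_ideal[OF F.graded_lie_algebra_axioms L.graded_lie_algebra_axioms \<psi>] by blast
    then show ?thesis using that by blast
  qed

  have comp1: "homog_component A1 n a = L.comp n a" if "a \<in> sub_lie B1" for n a
    using graded_lie_hom_comp[OF A1.graded_lie_algebra_axioms L.graded_lie_algebra_axioms incl1] that by simp
  (* Both sides are homomorphisms on A1 modulo I, so they agree if they agree on the generators of A1. *)
  have \<chi>\<alpha>: "?I +>\<^bsub>?F\<^esub> \<chi> a = ?I +>\<^bsub>?F\<^esub> \<alpha> a" if a: "a \<in> sub_lie B1" for a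
    using a
  proof (induction rule: L.lie_generated_induct[OF inc_carrier[OF Bs(1)], folded sub_lie_def,
      consumes 1, case_names generator zero add smult comp bracket])
    case (generator y)
    then obtain b where b: "b \<in> B1" "y = \<iota> b" by blast
    have bc: "b \<in> carrier V" "b \<in> B" using b Bs basis_carrier by auto
    have "tensor_inc VZ (\<iota> (?pr2 b)) = \<zero>\<^bsub>?LV\<^esub>"
      using bc b linear_map_zero[OF VZ.module_axioms LV.module_axioms graded_mapD(1)[OF VZ.free_lie_inc]]
      by (simp add: basis_projection_zero inc_zero)
    then show ?case using bc b by (simp add: \<chi>_inc \<alpha>_def basis_projection_id)
  next
    case zero
    then show ?case
      using graded_lie_hom_zero[OF L.graded_lie_algebra_axioms F.graded_lie_algebra_axioms \<chi>]
        linear_map_zero[OF A1.module_axioms F.module_axioms graded_mapD(1)[OF \<alpha>]] by simp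
  next
    case (add x y)
    then show ?case using F.coset_add_cong[OF I, of "\<chi> x" "\<alpha> x" "\<chi> y" "\<alpha> y"]
      by (simp add: \<chi>s \<alpha>s s1)
  next
    case (smult c x)
    then show ?case using F.coset_smult_cong[OF I, of "\<chi> x" "\<alpha> x" c] by (simp add: \<chi>s \<alpha>s s1)
  next
    case (comp n x)
    have "\<chi> (L.comp n x) = F.comp n (\<chi> x)"
      using graded_lie_hom_comp[OF L.graded_lie_algebra_axioms F.graded_lie_algebra_axioms \<chi> s1[OF comp(1)]] .
    moreover have "\<alpha> (L.comp n x) = F.comp n (\<alpha> x)"
      using graded_map_comp[OF A1.graded_space_axioms F.graded_space_axioms \<alpha>, of x n] comp(1) comp1 by simp
    ultimately show ?case using F.coset_comp_cong[OF I, of "\<chi> x" "\<alpha> x" n] comp \<chi>s(3) \<alpha>s(1) s1 by simp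
  next
    case (bracket x y)
    then show ?case
      using F.coset_bracket_cong[OF I, of "\<chi> x" "\<alpha> x" "\<chi> y" "\<alpha> y"] \<chi>s(3) \<alpha>s(1) s1
      by (simp add: \<alpha>_rel \<chi>s(2))
  qed
  have \<chi>\<beta>: "?I +>\<^bsub>?F\<^esub> \<chi> (j v) = ?I +>\<^bsub>?F\<^esub> \<beta> v" if v: "v \<in> carrier ?LV" for v
    using v
  proof (induction rule: LV.lie_generated_induct[OF inc_img, unfolded VZ.free_lie_generated,
      consumes 1, case_names generator zero add smult comp bracket])
    case (generator v)
    then obtain z where z: "z \<in> Z" "v = tensor_inc VZ z" by auto
    then obtain y where y: "z = \<iota> y" "y \<in> carrier V" "keys (coord y) \<subseteq> B2 - B1" by (auto simp: Z_def)
    have "\<chi> (j v) = tensor_inc ?W (\<iota> (?pr1 y), tensor_inc VZ (\<iota> (?pr2 y)))"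
      using z y \<chi>_inc j_inc by simp
    moreover have "?pr1 y = \<zero>" by (rule basis_projection_zero) (use y in auto)
    moreover have "?pr2 y = y" by (rule basis_projection_id) (use y in auto)
    ultimately show ?case using z y by (simp add: \<beta>_def inc_zero)
  next
    case zero
    then show ?case
      using graded_lie_hom_zero[OF L.graded_lie_algebra_axioms F.graded_lie_algebra_axioms \<chi>] j0
        linear_map_zero[OF LV.module_axioms F.module_axioms graded_mapD(1)[OF \<beta>]] by simp
  next
    case (add x y)
    then show ?case using F.coset_add_cong[OF I, of "\<chi> (j x)" "\<beta> x" "\<chi> (j y)" "\<beta> y"]
      by (simp add: \<chi>s \<beta>s js)
  next
    case (smult c x)
    then show ?case using F.coset_smult_cong[OF I, of "\<chi> (j x)" "\<beta> x" c] by (simp add: \<chi>s \<beta>s js)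
  next
    case (comp n x)
    have "\<chi> (j (LV.comp n x)) = F.comp n (\<chi> (j x))"
      using graded_lie_hom_comp[OF LV.graded_lie_algebra_axioms F.graded_lie_algebra_axioms
          graded_lie_hom_compose[OF j \<chi>] comp(1)] .
    moreover have "\<beta> (LV.comp n x) = F.comp n (\<beta> x)"
      using graded_map_comp[OF LV.graded_space_axioms F.graded_space_axioms \<beta>, of x n] comp(1) by simp
    ultimately show ?case
      using F.coset_comp_cong[OF I, of "\<chi> (j x)" "\<beta> x" n] comp \<chi>s(3) js(3) \<beta>s(1) by simp
  next
    case (bracket x y)
    then show ?case
      using F.coset_bracket_cong[OF I, of "\<chi> (j x)" "\<beta> x" "\<chi> (j y)" "\<beta> y"] \<chi>s(3) js(3) \<beta>s(1)
      by (simp add: \<beta>_rel \<chi>s(2) js(2))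
  qed
  have \<chi>\<psi>: "?I +>\<^bsub>?F\<^esub> \<chi> (\<psi> f) = ?I +>\<^bsub>?F\<^esub> f" if f: "f \<in> carrier ?F" for f
    using f
  proof (induction rule: F.lie_generated_induct[OF img_W, unfolded W.free_lie_generated,
      consumes 1, case_names generator zero add smult comp bracket])
    case (generator f)
    then obtain a v where av: "a \<in> sub_lie B1" "v \<in> carrier ?LV" "f = tensor_inc ?W (a, v)" by auto
    have "\<chi> (\<psi> f) = \<chi> a \<oplus>\<^bsub>?F\<^esub> \<chi> (j v)" using av s1 by (simp add: \<psi>_inc \<chi>s js)
    moreover have "?I +>\<^bsub>?F\<^esub> (\<chi> a \<oplus>\<^bsub>?F\<^esub> \<chi> (j v)) = ?I +>\<^bsub>?F\<^esub> (\<alpha> a \<oplus>\<^bsub>?F\<^esub> \<beta> v)"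
      using F.coset_add_cong[OF I, of "\<chi> a" "\<alpha> a" "\<chi> (j v)" "\<beta> v"] av
      by (simp add: \<chi>\<alpha> \<chi>\<beta> \<chi>s js \<alpha>s \<beta>s s1)
    ultimately show ?case using av by (simp add: inc_W)
  next
    case zero
    then show ?case
      using graded_lie_hom_zero[OF F.graded_lie_algebra_axioms F.graded_lie_algebra_axioms
        graded_lie_hom_compose[OF \<psi> \<chi>]] by simp
  next
    case (add x y)
    then show ?case using F.coset_add_cong[OF I, of "\<chi> (\<psi> x)" x "\<chi> (\<psi> y)" y]
      by (simp add: \<chi>s \<psi>s)
  next
    case (smult c x)
    then show ?case using F.coset_smult_cong[OF I, of "\<chi> (\<psi> x)" x c] by (simp add: \<chi>s \<psi>s)
  next
    case (comp n x)
    have "\<chi> (\<psi> (F.comp n x)) = F.comp n (\<chi> (\<psi> x))"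
      using graded_lie_hom_comp[OF F.graded_lie_algebra_axioms F.graded_lie_algebra_axioms
          graded_lie_hom_compose[OF \<psi> \<chi>] comp(1)] .
    then show ?case using F.coset_comp_cong[OF I, of "\<chi> (\<psi> x)" x n] comp \<chi>s(3) \<psi>s(3) by simp
  next
    case (bracket x y)
    then show ?case
      using F.coset_bracket_cong[OF I, of "\<chi> (\<psi> x)" x "\<chi> (\<psi> y)" y] \<chi>s(3) \<psi>s(3)
      by (simp add: \<chi>s(2) \<psi>s(2))
  qed

  let ?\<phi> = "\<lambda>x. ?I +>\<^bsub>?F\<^esub> \<chi> x"
  have \<chi>2: "graded_lie_hom A2 ?F \<chi>" by (rule graded_lie_hom_compose[OF incl2 \<chi>])
  have \<psi>2: "graded_lie_hom ?F A2 \<psi>"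
    using \<psi> \<psi>_sub F.grade_mem by (auto simp: graded_lie_hom_def graded_map_def linear_map_def)
  have iso: "graded_lie_iso A2 (lie_coproduct A1 ?LV) ?\<phi>"
    unfolding lie_coproduct_def
    by (rule graded_lie_iso_quotient[OF F.graded_lie_algebra_axioms A2.graded_lie_algebra_axioms I \<chi>2 \<psi>2])
      (use \<psi>_I \<psi>\<chi> \<chi>\<psi> in simp_all)
  have inl: "?\<phi> a = coproduct_inl A1 ?LV a" if "a \<in> sub_lie B1" for a
    using \<chi>\<alpha>[OF that] by (simp add: coproduct_inl_def \<alpha>_def)
  have inr: "?\<phi> z = coproduct_inr A1 ?LV (tensor_inc VZ z)" if "z \<in> Z" for z
    using \<chi>\<beta>[OF incV[OF that]] j_inc[OF that] by (simp add: coproduct_inr_def \<beta>_def)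
  have D_Z: "D z \<in> sub_lie B1" if z: "z \<in> Z" for z
  proof -
    from z obtain y where y: "z = \<iota> y" "y \<in> carrier V" "keys (coord y) \<subseteq> B2 - B1" by (auto simp: Z_def)
    have "graded_map 1 L L D" using M.diff_graded_map by (auto simp: graded_map_def linear_map_def)
    from graded_subspace_span_induct[OF L.graded_space_axioms graded_map_compose[OF free_lie_inc this]
        sub_lie_graded[OF Bs(1)] _ y(2,3)] show ?thesis using D_B2 y by auto
  qed
  have "?\<phi> (diff A2 (inv_into (carrier A2) ?\<phi> (coproduct_inr A1 ?LV (tensor_inc VZ z))))
      \<in> coproduct_inl A1 ?LV ` carrier A1" if z: "z \<in> carrier VZ" for z
  proof -
    have "inj_on ?\<phi> (carrier A2)" using iso by (simp add: graded_lie_iso_def bij_betw_def)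
    then have "inv_into (carrier A2) ?\<phi> (?\<phi> z) = z" using z Z_sub_lie by (intro inv_into_f_f) auto
    then show ?thesis using inr[of z] inl[OF D_Z] D_Z z by auto
  qed
  moreover have "dg_lie_hom A1 A2 (\<lambda>x. x)" using incl12 by (simp add: dg_lie_hom_def)
  ultimately show ?thesis
    unfolding elementary_semifree_extension_def
    using dg_A1 dg_A2 graded_space_VZ iso inl by (intro conjI exI[of _ VZ] exI[of _ ?\<phi>]) auto
qed

end

section \<open>Coproducts in coordinates\<close>

definition pairs :: "'a set \<Rightarrow> 'a list set" where
  "pairs X = {w \<in> lists X. length w = 2}"

lemma pairs_iff: "w \<in> pairs X \<longleftrightarrow> (\<exists>a\<in>X. \<exists>b\<in>X. w = [a, b])"
  by (auto simp: pairs_def length_Suc_conv numeral_2_eq_2)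

text \<open>
  The twist of \<open>V \<otimes> V\<close> on words of length two in basis elements.
\<close>

definition swap_letters :: "('a \<Rightarrow> int) \<Rightarrow> 'a list \<Rightarrow> 'a list \<Rightarrow>\<^sub>0 'k::field_char_0" where
  "swap_letters d w = scl (koszul_sign (d (w!0) * d (w!1))) (single [w!1, w!0] 1)"

lemma (in homogeneous_basis) expansion_product:
  assumes "x \<in> carrier V" "y \<in> carrier V"
  shows "keys (expansion x * expansion y) \<subseteq> pairs B"
proof -
  have one: "w \<in> lists B \<and> length w = 1" if "z \<in> carrier V" "w \<in> keys (expansion z)" for z w
  proof -
    have "keys (expansion z) \<subseteq> {w \<in> lists B. length w = 1}"
      using coord_keys[OF that(1)] by (intro keys_lin_subset) auto
    then show ?thesis using that(2) by blast
  qed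
  show ?thesis
  proof
    fix w assume "w \<in> keys (expansion x * expansion y)"
    then obtain u v where "u \<in> keys (expansion x)" "v \<in> keys (expansion y)" "w = u @ v"
      using keys_mult[of "expansion x" "expansion y"] by (auto simp: plus_list_def)
    then show "w \<in> pairs B" using one[OF assms(1), of u] one[OF assms(2), of v] by (simp add: pairs_def)
  qed
qed

lemma lin_expansion_product:
  assumes "\<And>a b. a \<in> X \<Longrightarrow> b \<in> X \<Longrightarrow> K [a, b] = f a * g b" and "keys p \<subseteq> X" "keys q \<subseteq> X"
  shows "lin K (lin letter p * lin letter q) = lin f p * (lin g q :: 'b list \<Rightarrow>\<^sub>0 'k::field_char_0)"
  by (rule linear_bilinear_eqI[OF _ _ _ _ assms(2,3)])
    (simp_all add: linear_pm_def lin_add lin_scl algebra_simps letter_def assms)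

context homogeneous_basis
begin

abbreviation "T2 \<equiv> tensor_power V 2"

lemma T2_simps [simp]: "add T2 = add T" "smult T2 = smult T" "zero T2 = zero T"
  by (simp_all add: tensor_power_def)

lemma T2_carrier: "carrier T2 = {t \<in> carrier T. keys (\<nu> t) \<subseteq> pairs B}"
proof (intro equalityI subsetI)
  fix t assume "t \<in> carrier T2"
  then obtain p where p: "keys p \<subseteq> {w. w \<in> lists (carrier V) \<and> length w = 2}" "t = tensor_class V p"
    by (auto simp: tensor_power_def)
  have pp: "p \<in> polys" using p by auto
  have deg: "word_degree (\<lambda>_. 1) w = int (length w)" for w :: "'a list" by (induction w) auto
  (* If all letters have degree 1, then the degree of a word is its length. *)
  have "homogeneous (\<lambda>_. 1) 2 (reduce p)"
  proof (rule homogeneous_subst_letters[where X = "carrier V" and d = "\<lambda>_. 1"])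
    show "homogeneous (\<lambda>_. 1) 1 (expansion x)" for x
      by (rule homogeneous_lin) (simp add: homogeneous_def)
  qed (use p in \<open>auto simp: homogeneous_def deg\<close>)
  then have "keys (reduce p) \<subseteq> pairs B"
    using keys_reduce[OF pp] by (auto simp: homogeneous_def deg pairs_def)
  then show "t \<in> {t \<in> carrier T. keys (\<nu> t) \<subseteq> pairs B}" using p pp by (auto simp: tensor_algebra_simps)
next
  fix t assume t: "t \<in> {t \<in> carrier T. keys (\<nu> t) \<subseteq> pairs B}"
  then have "keys (\<nu> t) \<subseteq> {w. w \<in> lists (carrier V) \<and> length w = 2}" using lists_basis by (auto simp: pairs_def)
  moreover have "t = tensor_class V (\<nu> t)" using t by simp
  ultimately show "t \<in> carrier T2" by (auto simp: tensor_power_def)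
qed

lemma T2_closed:
  "t \<in> carrier T2 \<Longrightarrow> u \<in> carrier T2 \<Longrightarrow> t \<oplus>\<^bsub>T\<^esub> u \<in> carrier T2"
  "t \<in> carrier T2 \<Longrightarrow> c \<odot>\<^bsub>T\<^esub> t \<in> carrier T2"
  by (simp_all add: T2_carrier keys_add_subset keys_scl_subset)

lemma tensor_T2:
  assumes "x \<in> carrier V" "y \<in> carrier V"
  shows "tensor x V y \<in> carrier T2" "\<nu> (tensor x V y) = expansion x * expansion y" "tensor x V y \<in> carrier T"
  using assms expansion_product[OF assms] by (simp_all add: T2_carrier)

lemma class_T2:
  assumes "keys p \<subseteq> pairs B"
  shows "tensor_class V p \<in> carrier T2" "\<nu> (tensor_class V p) = p"
proof -
  have "keys p \<subseteq> lists B" using assms by (auto simp: pairs_def)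
  from class_basis[OF this] show "tensor_class V p \<in> carrier T2" "\<nu> (tensor_class V p) = p"
    using assms by (simp_all add: T2_carrier)
qed

text \<open>
  The tensors of length two are spanned by products of basis elements, so linear maps on them are
  determined there. This is the uniqueness part in the descriptions of \<open>tensor_map\<close> and \<open>twist\<close>, and \<open>T2_lin\<close>
  is the existence part.
\<close>

lemma T2_linear_eq:
  assumes h: "linear_map T2 T h" and h': "linear_map T2 T h'"
    and eq: "\<And>a b. a \<in> B \<Longrightarrow> b \<in> B \<Longrightarrow> h (tensor a V b) = h' (tensor a V b)" and t: "t \<in> carrier T2"
  shows "h t = h' t"
proof (rule \<nu>_inj)
  note s = linear_mapD[OF h, simplified] linear_mapD[OF h', simplified]
  show "h t \<in> carrier T" "h' t \<in> carrier T" using s t by auto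
  have "\<nu> (h (tensor_class V p)) = \<nu> (h' (tensor_class V p))" if "keys p \<subseteq> pairs B" for p
    using that
  proof (induction rule: poly_mapping_linear_induct)
    case zero
    have z: "\<zero>\<^bsub>T\<^esub> \<in> carrier T2" by (simp add: T2_carrier)
    have z0: "k \<zero>\<^bsub>T\<^esub> = \<zero>\<^bsub>T\<^esub>" if "linear_map T2 T k" for k
    proof -
      interpret T: graded_space T by (rule graded_space_T)
      have "0 \<odot>\<^bsub>T\<^esub> \<zero>\<^bsub>T\<^esub> = \<zero>\<^bsub>T\<^esub>" by simp
      then show ?thesis using linear_mapD(3)[OF that z, of 0] linear_mapD(1)[OF that z] by simp
    qed
    show ?case using z0[OF h] z0[OF h'] unfolding tensor_algebra_simps(2)[symmetric] by simp
  next
    case (single w c)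
    then obtain a b where ab: "a \<in> B" "b \<in> B" "w = [a, b]" by (auto simp: pairs_iff)
    have "a \<in> carrier V" "b \<in> carrier V" using ab basis_carrier by auto
    note t = tensor_T2[OF this]
    have "tensor_class V (single w c) = c \<odot>\<^bsub>T\<^esub> tensor a V b"
      by (rule \<nu>_inj) (use t ab class_T2[of "single w c"] single T2_carrier in \<open>auto simp: letter_def\<close>)
    then show ?case using s(3,6)[OF t(1), of c] eq[OF ab(1,2)] by simp
  next
    case (add p q)
    have "pairs B \<subseteq> lists (carrier V)" using lists_basis by (auto simp: pairs_def)
    then have "p \<in> polys" "q \<in> polys" using add(1,2) by simp_all
    then have "tensor_class V (p + q) = tensor_class V p \<oplus>\<^bsub>T\<^esub> tensor_class V q"
      by (simp add: tensor_algebra_simps)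
    then show ?case using class_T2[OF add(1)] class_T2[OF add(2)] add(3,4) s by simp
  qed
  from this[of "\<nu> t"] show "\<nu> (h t) = \<nu> (h' t)" using t by (simp add: T2_carrier)
qed

lemma T2_lin:
  assumes K: "\<And>w. w \<in> pairs B \<Longrightarrow> keys (K w) \<subseteq> lists B"
  defines "h \<equiv> restrict (\<lambda>t. tensor_class V (lin K (\<nu> t))) (carrier T2)"
  shows "linear_map T2 T h" "h \<in> extensional (carrier T2)" "t \<in> carrier T2 \<Longrightarrow> \<nu> (h t) = lin K (\<nu> t)"
proof -
  have keys: "keys (lin K (\<nu> t)) \<subseteq> lists B" if "t \<in> carrier T2" for t
    by (rule keys_lin_subset) (use that K in \<open>auto simp: T2_carrier\<close>)
  note c = class_basis[OF keys]
  show "t \<in> carrier T2 \<Longrightarrow> \<nu> (h t) = lin K (\<nu> t)" using c by (simp add: h_def)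
  have T2T: "t \<in> carrier T" if "t \<in> carrier T2" for t using that by (simp add: T2_carrier)
  have hm: "h t \<in> carrier T" "\<nu> (h t) = lin K (\<nu> t)" if "t \<in> carrier T2" for t
    using c that by (simp_all add: h_def)
  show "linear_map T2 T h"
    by (rule linear_mapI; (rule \<nu>_inj)?) (simp_all add: hm T2_closed T2T lin_add lin_scl)
  show "h \<in> extensional (carrier T2)" by (simp add: h_def)
qed

text \<open>
  Prescribing \<open>f a \<otimes> g b\<close> on basis elements determines a linear map, and by bilinearity it has the
  required value on all pairs of vectors.
\<close>

lemma tensor_map_\<nu>:
  assumes f: "linear_map V T f" and g: "linear_map V T g" and t: "t \<in> carrier T2"
  shows "linear_map T2 T (tensor_map V f g)" "\<nu> (tensor_map V f g t) = lin (\<lambda>w. \<nu> (f (w!0)) * \<nu> (g (w!1))) (\<nu> t)"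
proof -
  define K where "K w = \<nu> (f (w!0)) * \<nu> (g (w!1))" for w
  define h where "h = restrict (\<lambda>t. tensor_class V (lin K (\<nu> t))) (carrier T2)"
  have K: "keys (K w) \<subseteq> lists B" if "w \<in> pairs B" for w
  proof -
    from that obtain a b where ab: "a \<in> B" "b \<in> B" "w = [a, b]" by (auto simp: pairs_iff)
    then have "f a \<in> carrier T" "g b \<in> carrier T"
      using basis_carrier linear_mapD(1)[OF f] linear_mapD(1)[OF g] by auto
    then show ?thesis unfolding K_def using ab by (simp add: keys_mult_lists \<nu>_keys)
  qed
  note h = T2_lin[of K, OF K, folded h_def]
  have \<nu>_coord: "\<nu> (k x) = lin (\<lambda>b. \<nu> (k b)) (coord x)" if "linear_map V T k" "x \<in> carrier V" for k x
    using linear_coord[of "\<lambda>x. \<nu> (k x)", OF _ _ that(2)] linear_mapD[OF that(1)] by simp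
  have val: "h (tensor x V y) = f x \<otimes>\<^bsub>T\<^esub> g y" if "x \<in> carrier V" "y \<in> carrier V" for x y
  proof (rule \<nu>_inj)
    show "h (tensor x V y) \<in> carrier T" using linear_mapD(1)[OF h(1)] tensor_T2[OF that] by blast
    show "\<nu> (h (tensor x V y)) = \<nu> (f x \<otimes>\<^bsub>T\<^esub> g y)"
      using that linear_mapD(1)[OF f] linear_mapD(1)[OF g] tensor_T2[OF that] coord_keys
      by (simp add: h(3) \<nu>_coord[OF f] \<nu>_coord[OF g])
        (rule lin_expansion_product[of B], auto simp: K_def)
  qed (use that linear_mapD(1)[OF f] linear_mapD(1)[OF g] in simp)
  have "tensor_map V f g = h"
    unfolding tensor_map_def
  proof (rule the_equality)
    show "h \<in> extensional (carrier T2) \<and> linear_map T2 T h \<and>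
       (\<forall>x\<in>carrier V. \<forall>y\<in>carrier V. h (tensor x V y) = f x \<otimes>\<^bsub>T\<^esub> g y)"
      using h val by blast
    fix h' assume h': "h' \<in> extensional (carrier T2) \<and> linear_map T2 T h' \<and>
       (\<forall>x\<in>carrier V. \<forall>y\<in>carrier V. h' (tensor x V y) = f x \<otimes>\<^bsub>T\<^esub> g y)"
    show "h' = h"
    proof (rule extensionalityI[of _ "carrier T2"])
      show "h' t = h t" if "t \<in> carrier T2" for t
      proof (rule T2_linear_eq[OF _ h(1) _ that])
        fix a b assume "a \<in> B" "b \<in> B"
        then have ab: "a \<in> carrier V" "b \<in> carrier V" using basis_carrier by auto
        show "h' (tensor a V b) = h (tensor a V b)" using h' ab val[OF ab] by metis
      qed (use h' in blast)
    qed (use h h' in auto)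
  qed
  then show "linear_map T2 T (tensor_map V f g)" "\<nu> (tensor_map V f g t) = lin (\<lambda>w. \<nu> (f (w!0)) * \<nu> (g (w!1))) (\<nu> t)"
    using h t by (simp_all add: K_def[abs_def])
qed

lemma swap_letters_product:
  assumes "keys p \<subseteq> {b \<in> X. d b = i}" "keys q \<subseteq> {b \<in> X. d b = j}"
  shows "lin (swap_letters d) (lin letter p * lin letter q) =
    scl (koszul_sign (i * j)) (lin letter q * (lin letter p :: 'a list \<Rightarrow>\<^sub>0 'k))"
  by (rule linear_bilinear_eqI[OF _ _ _ _ assms])
    (auto simp: linear_pm_def lin_add lin_scl algebra_simps scl_add_right letter_def swap_letters_def)

lemma twist_\<nu>:
  assumes t: "t \<in> carrier T2"
  shows "\<nu> (twist V t) = lin (swap_letters d) (\<nu> t)"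
proof -
  define h where "h = restrict (\<lambda>t. tensor_class V (lin (swap_letters d) (\<nu> t))) (carrier T2)"
  have K: "keys (swap_letters d w :: 'a list \<Rightarrow>\<^sub>0 'k) \<subseteq> pairs B" if "w \<in> pairs B" for w
    using that by (auto simp: swap_letters_def pairs_iff split: if_splits)
  then have K': "keys (swap_letters d w :: 'a list \<Rightarrow>\<^sub>0 'k) \<subseteq> lists B" if "w \<in> pairs B" for w
    using that by (force simp: pairs_def)
  note h = T2_lin[of "swap_letters d", OF K', folded h_def]
  have "h t \<in> carrier T2" if "t \<in> carrier T2" for t
  proof -
    have "keys (lin (swap_letters d) (\<nu> t)) \<subseteq> pairs B"
      by (rule keys_lin_subset) (use that K in \<open>auto simp: T2_carrier\<close>)
    from class_T2(1)[OF this] show ?thesis using that by (simp add: h_def)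
  qed
  then have h2: "linear_map T2 T2 h" using h(1) by (auto simp: linear_map_def)
  have val: "h (tensor x V y) = koszul_sign (i * j) \<odot>\<^bsub>T\<^esub> tensor y V x" if xy: "x \<in> grade V i" "y \<in> grade V j" for x y i j
  proof (rule \<nu>_inj)
    have c: "x \<in> carrier V" "y \<in> carrier V" using xy by auto
    show "h (tensor x V y) \<in> carrier T" using linear_mapD(1)[OF h(1)] tensor_T2[OF c] by blast
    have "keys (coord x) \<subseteq> {b \<in> B. d b = i}" "keys (coord y) \<subseteq> {b \<in> B. d b = j}"
      using coord_keys[OF c(1)] coord_keys[OF c(2)] coord_grade[OF xy(1)] coord_grade[OF xy(2)] by auto
    from swap_letters_product[OF this]
    show "\<nu> (h (tensor x V y)) = \<nu> (koszul_sign (i * j) \<odot>\<^bsub>T\<^esub> tensor y V x)"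
      using c tensor_T2[OF c] tensor_T2[OF c(2,1)] by (simp add: h(3))
  qed (use xy in simp)
  have "twist V = h"
    unfolding twist_def
  proof (rule the_equality)
    show "h \<in> extensional (carrier T2) \<and> linear_map T2 T2 h \<and> (\<forall>i j. \<forall>x\<in>grade V i. \<forall>y\<in>grade V j.
        h (tensor x V y) = koszul_sign (i * j) \<odot>\<^bsub>T\<^esub> tensor y V x)"
      using h(2) h2 val by blast
    fix h' assume h': "h' \<in> extensional (carrier T2) \<and> linear_map T2 T2 h' \<and> (\<forall>i j. \<forall>x\<in>grade V i. \<forall>y\<in>grade V j.
        h' (tensor x V y) = koszul_sign (i * j) \<odot>\<^bsub>T\<^esub> tensor y V x)"
    then have lin': "linear_map T2 T h'" by (auto simp: linear_map_def T2_carrier)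
    show "h' = h"
    proof (rule extensionalityI[of _ "carrier T2"])
      show "h' t = h t" if "t \<in> carrier T2" for t
      proof (rule T2_linear_eq[OF lin' h(1) _ that])
        fix a b assume ab: "a \<in> B" "b \<in> B"
        have "h' (tensor a V b) = koszul_sign (d a * d b) \<odot>\<^bsub>T\<^esub> tensor b V a"
          using h' basis_grade[OF ab(1)] basis_grade[OF ab(2)] by blast
        then show "h' (tensor a V b) = h (tensor a V b)"
          using val[OF basis_grade[OF ab(1)] basis_grade[OF ab(2)]] by simp
      qed
    qed (use h h' in auto)
  qed
  then show ?thesis using h(3) t by simp
qed

end

text \<open>
  The map dual to multiplication by \<open>a\<close> from the left. It serves to compare coefficients in
  \<open>\<Sum> a \<otimes> q\<^sub>a\<close>, where \<open>a\<close> ranges over letters.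
\<close>

definition strip_letter :: "'a \<Rightarrow> ('a list \<Rightarrow>\<^sub>0 'k::field_char_0) \<Rightarrow> 'a list \<Rightarrow>\<^sub>0 'k" where
  "strip_letter a = lin (\<lambda>w. if w \<noteq> [] \<and> hd w = a then single (tl w) 1 else 0)"

lemma linear_strip_letter: "linear_pm (strip_letter a)"
  by (simp add: strip_letter_def)

lemma strip_letter_mult: "strip_letter a (letter b * q) = (if b = a then q else 0)"
proof -
  have "strip_letter a (letter b * q) = lin (\<lambda>w. if b = a then single w 1 else 0) q"
    by (rule lin_eq)
      (simp_all add: strip_letter_def linear_pm_def distrib_left lin_add lin_scl letter_def)
  then show ?thesis by (simp add: lin_def poly_mapping_monomials)
qed

locale coalgebra_basis = graded_coalgebra C \<Delta> + homogeneous_basis C B d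
  for C :: "('k::field_char_0, 'a) graded_space" (structure) and \<Delta> B d
begin

text \<open>
  The coproduct in coordinates. Its coefficient at the word \<open>[a, b]\<close> is that of \<open>a \<otimes> b\<close>.
\<close>

definition cop :: "'a \<Rightarrow> 'a list \<Rightarrow>\<^sub>0 'k" where
  "cop x = \<nu> (\<Delta> x)"

lemma linear_\<Delta>: "linear_map C T2 \<Delta>" "linear_map C T \<Delta>"
  using graded_mapD(1)[OF coproduct_graded_map] by (auto simp: linear_map_def T2_carrier)

lemma linear_inc: "linear_map C T (tensor_inc C)"
  using graded_mapD(1)[OF graded_map_tensor_inc] by (simp add: linear_map_def)

lemma \<Delta>_mem: "x \<in> carrier C \<Longrightarrow> \<Delta> x \<in> carrier T2" "x \<in> carrier C \<Longrightarrow> \<Delta> x \<in> carrier T"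
  using linear_mapD(1)[OF linear_\<Delta>(1)] linear_mapD(1)[OF linear_\<Delta>(2)] by auto

lemma cop_keys: "x \<in> carrier C \<Longrightarrow> keys (cop x) \<subseteq> pairs B"
  using \<Delta>_mem(1) by (simp add: cop_def T2_carrier)

lemma cop_letters: "x \<in> carrier C \<Longrightarrow> w \<in> keys (\<nu> (\<Delta> x)) \<Longrightarrow> w!0 \<in> B \<and> w!1 \<in> B"
  using cop_keys[of x] unfolding cop_def by (force simp: pairs_iff)

lemma \<nu>_inc_basis: "b \<in> B \<Longrightarrow> \<nu> (tensor_inc C b) = letter b"
  using basis_carrier by (subst \<nu>_tensor_inc) auto

lemma cop_add: "x \<in> carrier C \<Longrightarrow> y \<in> carrier C \<Longrightarrow> cop (x \<oplus> y) = cop x + cop y"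
  and cop_smult: "x \<in> carrier C \<Longrightarrow> cop (c \<odot> x) = scl c (cop x)"
  using linear_mapD[OF linear_\<Delta>(2)] by (simp_all add: cop_def)

lemma cop_homogeneous:
  assumes "x \<in> grade C n" shows "homogeneous d n (cop x)"
proof -
  have "\<Delta> x \<in> grade T n"
    using graded_mapD(2)[OF coproduct_graded_map assms] by (simp add: tensor_power_def)
  then show ?thesis by (simp add: cop_def \<nu>_grade)
qed

lemma cop_coassociative:
  assumes x: "x \<in> carrier C"
  shows "lin (\<lambda>w. cop (w!0) * letter (w!1)) (cop x) = lin (\<lambda>w. letter (w!0) * cop (w!1)) (cop x)"
proof -
  note m = tensor_map_\<nu>(2)[OF linear_\<Delta>(2) linear_inc \<Delta>_mem(1)[OF x]]
    tensor_map_\<nu>(2)[OF linear_inc linear_\<Delta>(2) \<Delta>_mem(1)[OF x]]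
  have "lin (\<lambda>w. cop (w!0) * letter (w!1)) (cop x) = lin (\<lambda>w. \<nu> (\<Delta> (w!0)) * \<nu> (tensor_inc C (w!1))) (\<nu> (\<Delta> x))"
    unfolding cop_def by (rule lin_cong) (simp add: \<nu>_inc_basis cop_letters[OF x, simplified])
  also have "\<dots> = lin (\<lambda>w. \<nu> (tensor_inc C (w!0)) * \<nu> (\<Delta> (w!1))) (\<nu> (\<Delta> x))"
    using m coassociative[OF x] by simp
  also have "\<dots> = lin (\<lambda>w. letter (w!0) * cop (w!1)) (cop x)"
    unfolding cop_def by (rule lin_cong) (simp add: \<nu>_inc_basis cop_letters[OF x, simplified])
  finally show ?thesis .
qed

lemma cop_cocommutative:
  assumes "cocommutative C \<Delta>" "x \<in> carrier C"
  shows "lin (swap_letters d) (cop x) = cop x"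
  using assms twist_\<nu>[OF \<Delta>_mem(1)[OF assms(2)]] by (simp add: cocommutative_def cop_def)

lemma linear_iterated_coproduct: "linear_map C T (iterated_coproduct C \<Delta> n)"
proof (induction n)
  case (Suc n)
  have m: "linear_map T2 T (tensor_map C (tensor_inc C) (iterated_coproduct C \<Delta> n))"
    using tensor_map_\<nu>(1)[OF linear_inc Suc \<Delta>_mem(1)[OF zero_closed]] .
  show ?case
    using linear_mapD[OF m] linear_mapD[OF linear_\<Delta>(1)] by (intro linear_mapI) simp_all
qed (simp add: linear_inc)

lemma iterated_coproduct_\<nu>:
  assumes x: "x \<in> carrier C"
  shows "\<nu> (iterated_coproduct C \<Delta> (Suc n) x) =
    lin (\<lambda>w. letter (w!0) * \<nu> (iterated_coproduct C \<Delta> n (w!1))) (cop x)"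
proof -
  have "\<nu> (iterated_coproduct C \<Delta> (Suc n) x) =
      lin (\<lambda>w. \<nu> (tensor_inc C (w!0)) * \<nu> (iterated_coproduct C \<Delta> n (w!1))) (\<nu> (\<Delta> x))"
    using tensor_map_\<nu>(2)[OF linear_inc linear_iterated_coproduct[of n] \<Delta>_mem(1)[OF x]] by simp
  also have "\<dots> = lin (\<lambda>w. letter (w!0) * \<nu> (iterated_coproduct C \<Delta> n (w!1))) (cop x)"
    unfolding cop_def by (rule lin_cong) (simp add: \<nu>_inc_basis cop_letters[OF x, simplified])
  finally show ?thesis .
qed

text \<open>
  The coordinates of \<open>\<Sum>\<^sub>b c\<^sub>a\<^sub>b b\<close> if \<open>\<Delta> x = \<Sum> c\<^sub>a\<^sub>b a \<otimes> b\<close>.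
\<close>

definition right_factor :: "'a \<Rightarrow> 'a \<Rightarrow> 'a \<Rightarrow>\<^sub>0 'k" where
  "right_factor x a = lin (\<lambda>w. if w!0 = a then single (w!1) 1 else 0) (cop x)"

lemma lookup_right_factor:
  assumes x: "x \<in> carrier C" shows "lookup (right_factor x a) b = lookup (cop x) [a, b]"
proof -
  have "lookup (lin (\<lambda>w. if w!0 = a then single (w!1) 1 else 0) p) b = lookup p [a, b]"
    if "keys p \<subseteq> pairs B" for p :: "'a list \<Rightarrow>\<^sub>0 'k"
    using that by (induction rule: poly_mapping_linear_induct)
      (auto simp: lin_add lookup_add pairs_iff lookup_single when_def)
  from this[OF cop_keys[OF x]] show ?thesis by (simp add: right_factor_def)
qed

lemma right_factor_keys: "x \<in> carrier C \<Longrightarrow> b \<in> keys (right_factor x a) \<longleftrightarrow> [a, b] \<in> keys (cop x)"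
  by (simp add: in_keys_iff lookup_right_factor)

lemma right_factor_basis: "x \<in> carrier C \<Longrightarrow> keys (right_factor x a) \<subseteq> B"
  using cop_keys[of x] by (auto simp: right_factor_keys pairs_iff dest!: subsetD)

text \<open>
  From \<open>\<Delta>\<^sup>n\<^sup>+\<^sup>1 = (Id \<otimes> \<Delta>\<^sup>n) \<Delta>\<close> it follows that \<open>\<Delta>\<^sup>n\<^sup>+\<^sup>1 x = \<Sum>\<^sub>a a \<otimes> \<Delta>\<^sup>n (\<Sum>\<^sub>b c\<^sub>a\<^sub>b b)\<close>, and the basis elements \<open>a\<close> are
  independent.
\<close>

lemma right_factor_conilpotent:
  assumes x: "x \<in> carrier C" and zero: "iterated_coproduct C \<Delta> (Suc n) x = \<zero>\<^bsub>T\<^esub>"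
  shows "iterated_coproduct C \<Delta> n (lincomb C (right_factor x a)) = \<zero>\<^bsub>T\<^esub>"
proof (rule \<nu>_inj)
  let ?I = "\<lambda>x. \<nu> (iterated_coproduct C \<Delta> n x)"
  have car: "keys (right_factor x a) \<subseteq> carrier C" using right_factor_basis[OF x] basis_carrier by blast
  note lin = linear_mapD[OF linear_iterated_coproduct[of n]]
  show "iterated_coproduct C \<Delta> n (lincomb C (right_factor x a)) \<in> carrier T" using lin(1) car by simp
  have "?I (lincomb C (right_factor x a)) = lin ?I (right_factor x a)"
    using linear_coord[of ?I "lincomb C (right_factor x a)"] car right_factor_basis[OF x]
    by (simp add: lin coord_unique)
  also have "\<dots> = lin (\<lambda>w. if w!0 = a then ?I (w!1) else 0) (cop x)"
    unfolding right_factor_def by (rule lin_eq[OF linear_pm_comp[OF linear_pm_lin linear_pm_lin]]) simp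
  also have "\<dots> = strip_letter a (lin (\<lambda>w. letter (w!0) * ?I (w!1)) (cop x))"
    by (rule lin_eq[OF linear_pm_comp[OF linear_strip_letter linear_pm_lin], symmetric])
      (simp add: strip_letter_mult)
  also have "\<dots> = 0" using zero iterated_coproduct_\<nu>[OF x, of n] by (simp add: strip_letter_def)
  finally show "?I (lincomb C (right_factor x a)) = \<nu> \<zero>\<^bsub>T\<^esub>" by simp
qed simp

lemma right_factor_grade:
  assumes x: "x \<in> grade C n"
  shows "lincomb C (right_factor x a) \<in> grade C (n - d a)"
proof (rule lincomb_grade)
  show "keys (right_factor x a) \<subseteq> B" using right_factor_basis x by simp
  fix b assume "b \<in> keys (right_factor x a)"
  then have "[a, b] \<in> keys (cop x)" using x by (simp add: right_factor_keys)
  then have "word_degree d [a, b] = n" using cop_homogeneous[OF x] unfolding homogeneous_def by blast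
  then show "d b = n - d a" by simp
qed

lemma cop_swap:
  assumes "cocommutative C \<Delta>" "x \<in> carrier C" "[a, b] \<in> keys (cop x)"
  shows "[b, a] \<in> keys (cop x)"
proof -
  have "[a, b] \<in> keys (lin (swap_letters d) (cop x))" using cop_cocommutative[OF assms(1,2)] assms(3) by simp
  then obtain w where w: "w \<in> keys (cop x)" "[a, b] \<in> keys (swap_letters d w :: 'a list \<Rightarrow>\<^sub>0 'k)"
    using keys_lin[of "swap_letters d" "cop x"] by blast
  moreover have "keys (swap_letters d w :: 'a list \<Rightarrow>\<^sub>0 'k) \<subseteq> {[w!1, w!0]}"
    unfolding swap_letters_def by (rule order_trans[OF keys_scl]) simp
  ultimately have "[a, b] = [w!1, w!0]" by blast
  moreover have "w \<in> pairs B" using w(1) cop_keys[OF assms(2)] by blast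
  then obtain u v where uv: "w = [u, v]" by (auto simp: pairs_iff)
  ultimately have "w = [b, a]" by simp
  then show ?thesis using w(1) by simp
qed

end

section \<open>The cobar differential\<close>

lemma suspension_simps [simp]:
  "carrier (suspension V) = carrier V" "add (suspension V) = add V" "zero (suspension V) = zero V"
  "smult (suspension V) = smult V" "grade (suspension V) n = grade V (n - 1)"
  by (simp_all add: suspension_def)

lemma suspension_finsum: "finsum (suspension V) = finsum V"
  by (intro ext) (simp add: finsum_def)

lemma suspension_lincomb: "lincomb (suspension V) = lincomb V"
  by (intro ext) (simp add: lincomb_def suspension_finsum)

lemma graded_space_suspension:
  assumes "graded_space V" shows "graded_space (suspension V)"
proof -
  interpret V: graded_space V by fact
  let ?S = "suspension V"
  have S: "module scalars ?S"
    by (rule module_embedding[OF V.module_axioms, of "\<lambda>x. x"]) (auto intro!: linear_mapI)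
  interpret S: scalar_module ?S using S by (simp add: scalar_module_def)
  have map: "graded_map (- 1) ?S V (\<lambda>x. x)" by (auto intro!: graded_mapI linear_mapI)
  show ?thesis
  proof (rule graded_space.intro[OF S graded_space_axioms.intro])
    show "submodule (grade ?S n) scalars ?S" for n
      by (simp add: S.submodule_iff V.grade_add V.grade_smult subset_iff V.grade_mem)
    fix x assume "x \<in> carrier ?S"
    then have x: "x \<in> carrier V" by simp
    let ?A = "{n. V.comp n x \<noteq> \<zero>\<^bsub>V\<^esub>}"
    have "x = finsum V (\<lambda>n. V.comp (n - 1) x) ((\<lambda>n. n + 1) ` ?A)"
      by (subst V.finsum_reindex) (use x V.comp_finsum[OF x] in \<open>auto simp: inj_on_def\<close>)
    moreover have "V.comp (n - 1) x = \<zero>\<^bsub>V\<^esub>" if "n \<notin> (\<lambda>n. n + 1) ` ?A" for n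
      using that by (metis (mono_tags) diff_add_cancel imageI mem_Collect_eq)
    ultimately have "is_decomposition ?S x (\<lambda>n. V.comp (n - 1) x)"
      using x V.comp_finite[OF x]
      by (intro is_decompositionI[OF S, of _ "(\<lambda>n. n + 1) ` ?A"]) (simp_all add: suspension_finsum)
    moreover have "f = (\<lambda>n. V.comp (n - 1) x)" if "is_decomposition ?S x f" for f
    proof
      fix n
      have "is_decomposition V x (\<lambda>n. f (n - - 1))"
        by (rule decomposition_map[OF S _ \<open>graded_space V\<close> map that]) (auto dest: V.grade_mem)
      from V.comp_unique[OF this, of "n - 1"] show "f n = V.comp (n - 1) x" by simp
    qed
    ultimately show "\<exists>!f. is_decomposition ?S x f" by blast
  qed
qed

lemma keys_derivation:
  assumes D: "\<And>x. x \<in> X \<Longrightarrow> keys (D x) \<subseteq> lists X" and p: "keys p \<subseteq> lists X"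
  shows "keys (derivation d D p :: 'a list \<Rightarrow>\<^sub>0 'k::field_char_0) \<subseteq> lists X"
  unfolding derivation_def
proof (rule keys_lin_subset)
  fix w assume "w \<in> keys p"
  then have "w \<in> lists X" using p by blast
  then show "keys (word_derivation d D w) \<subseteq> lists X"
  proof induction
    case (Cons x w)
    have "keys (D x * single w 1) \<subseteq> lists X"
      by (rule keys_mult_lists) (use D Cons in auto)
    moreover have "keys (letter x * word_derivation d D w) \<subseteq> lists X"
      by (rule keys_mult_lists) (use Cons in auto)
    ultimately show ?case by (simp add: keys_add_subset keys_scl_subset)
  qed simp
qed

locale cocommutative_basis = coalgebra_basis C \<Delta> B d
  for C :: "('k::field_char_0, 'a) graded_space" (structure) and \<Delta> B d +
  assumes cocommutative: "cocommutative C \<Delta>"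
begin

abbreviation "d' \<equiv> \<lambda>b. d b + 1"

sublocale S: homogeneous_basis "suspension C" B d'
proof (rule homogeneous_basis.intro[OF graded_space_suspension[OF graded_space_axioms] homogeneous_basis_axioms.intro])
  show "independent (suspension C) B" using indep by (simp add: independent_def suspension_lincomb)
  show "grade (suspension C) n \<subseteq> span_of (suspension C) B" for n
    using grade_span by (simp add: span_of_def suspension_lincomb)
qed (simp add: basis_grade)

lemma S_coord: "S.coord = coord"
  by (intro ext) (simp add: S.coord_def coord_def suspension_lincomb)

text \<open>
  The sign \<open>(-1)\<^sup>x\<close> of \<open>x \<otimes> y\<close> in the cobar differential, where the degree is that in \<open>C\<close>.
\<close>

definition sign_first :: "('a list \<Rightarrow>\<^sub>0 'k) \<Rightarrow> 'a list \<Rightarrow>\<^sub>0 'k" where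
  "sign_first = lin (\<lambda>w. scl (koszul_sign (d (w!0))) (single w 1))"

text \<open>
  The values of the cobar differential on generators, with products instead of half the brackets; see
  \<open>\<delta>_formula\<close> for the agreement of the two.
\<close>

definition D1 :: "'a \<Rightarrow> 'a list \<Rightarrow>\<^sub>0 'k" where
  "D1 b = (if b \<in> B then sign_first (cop b) else 0)"

abbreviation "DP \<equiv> derivation d' D1"

lemma linear_sign_first [simp]: "linear_pm sign_first"
  by (simp add: sign_first_def)

lemma keys_sign_first: "keys (sign_first p) \<subseteq> keys p"
  unfolding sign_first_def by (rule keys_lin_subset) (simp add: order_trans[OF keys_scl])

lemma keys_D1: "keys (D1 b) \<subseteq> pairs B"
  using cop_keys[of b] basis_carrier keys_sign_first[of "cop b"] by (auto simp: D1_def)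

lemma homogeneous_D1: "homogeneous d' (d' b + 1) (D1 b)"
proof (cases "b \<in> B")
  case True
  have "homogeneous d (d b) (cop b)" by (rule cop_homogeneous[OF basis_grade[OF True]])
  moreover have "word_degree d' w = word_degree d w + 2" if "w \<in> pairs B" for w using that by (auto simp: pairs_iff)
  ultimately show ?thesis
    using True cop_keys[of b] basis_carrier keys_sign_first[of "cop b"]
    unfolding D1_def homogeneous_def by force
qed (simp add: D1_def)

text \<open>
  Applying the derivation to the first factor of \<open>\<Delta> b\<close> gives \<open>(\<Delta> \<otimes> Id) \<Delta> b\<close>, and applying it to the second
  factor gives \<open>(Id \<otimes> \<Delta>) \<Delta> b\<close> with the opposite sign. In both cases each word of length three gets, up to
  this global sign, the sign \<open>\<rho>\<close> of its middle letter, so the terms cancel by coassociativity.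
\<close>

lemma DP_D1: "DP (D1 b) = 0"
proof (cases "b \<in> B")
  case True
  define \<rho> :: "('a list \<Rightarrow>\<^sub>0 'k) \<Rightarrow> 'a list \<Rightarrow>\<^sub>0 'k" where
    "\<rho> = lin (\<lambda>w. scl (koszul_sign (d (w!1))) (single w 1))"
  have b: "b \<in> carrier C" using True basis_carrier by blast
  (* The coproduct preserves degrees, so d x = d u + d v for the words [u, v] in cop x. *)
  have left: "scl (koszul_sign (d x)) (D1 x * letter y) = \<rho> (cop x * letter y)" if x: "x \<in> B" for x y
  proof -
    have xc: "x \<in> carrier C" using x basis_carrier by blast
    have "keys (cop x) \<subseteq> {w \<in> pairs B. word_degree d w = d x}"
      using cop_keys[OF xc] cop_homogeneous[OF basis_grade[OF x]] by (auto simp: homogeneous_def)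
    then have "scl (koszul_sign (d x)) (sign_first (cop x) * letter y) = \<rho> (cop x * letter y)"
    proof (rule linear_pm_eqI[rotated 2])
      fix w assume "w \<in> {w \<in> pairs B. word_degree d w = d x}"
      then obtain u v where w: "w = [u, v]" and uv: "d x = d u + d v" by (auto simp: pairs_iff)
      have "koszul_sign (d x) * koszul_sign (d u) = (koszul_sign (d v) :: 'k)"
        unfolding uv by (auto simp: koszul_sign_def)
      then show "scl (koszul_sign (d x)) (sign_first (single w 1) * letter y) = \<rho> (single w 1 * letter y)"
        by (simp add: sign_first_def \<rho>_def w letter_def)
    qed (simp_all add: linear_pm_def linear_pm_add[OF linear_sign_first] linear_pm_scl[OF linear_sign_first]
          \<rho>_def lin_add lin_scl distrib_right scl_add_right mult.commute)
    then show ?thesis using x by (simp add: D1_def)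
  qed
  have right: "letter x * D1 y = \<rho> (letter x * cop y)" if y: "y \<in> B" for x y
  proof -
    have yc: "y \<in> carrier C" using y basis_carrier by blast
    have "letter x * sign_first (cop y) = \<rho> (letter x * cop y)"
      by (rule linear_pm_eqI[OF _ _ cop_keys[OF yc]])
        (auto simp: linear_pm_def linear_pm_add[OF linear_sign_first] linear_pm_scl[OF linear_sign_first]
          \<rho>_def lin_add lin_scl distrib_left pairs_iff sign_first_def letter_def)
    then show ?thesis using y by (simp add: D1_def)
  qed
  (* The degree of x in the suspension is d x + 1, hence the minus sign. *)
  have pair: "DP (single [x, y] 1) = D1 x * letter y - scl (koszul_sign (d x)) (letter x * D1 y)" for x y
  proof -
    have "single [x, y] (1 :: 'k) = letter x * letter y" by (simp add: letter_def)
    moreover have "homogeneous d' (d' x) (letter x :: 'a list \<Rightarrow>\<^sub>0 'k)" by (simp add: homogeneous_def)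
    moreover have "koszul_sign (d' x) = - (koszul_sign (d x) :: 'k)" by (auto simp: koszul_sign_def)
    ultimately show ?thesis by (simp add: derivation_mult_homogeneous)
  qed
  have "DP (D1 b) = lin (\<lambda>w. \<rho> (cop (w!0) * letter (w!1)) - \<rho> (letter (w!0) * cop (w!1))) (cop b)"
    unfolding D1_def[of b] using True
  proof simp
    show "DP (sign_first (cop b)) = lin (\<lambda>w. \<rho> (cop (w!0) * letter (w!Suc 0)) - \<rho> (letter (w!0) * cop (w!Suc 0))) (cop b)"
    proof (rule lin_eq[OF linear_pm_comp[OF linear_derivation linear_sign_first]])
      fix w assume "w \<in> keys (cop b)"
      then have "w \<in> pairs B" using cop_keys[OF b] by blast
      then obtain x y where w: "w = [x, y]" "x \<in> B" "y \<in> B" by (auto simp: pairs_iff)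
      have "DP (sign_first (single w 1)) = scl (koszul_sign (d x)) (DP (single [x, y] 1))"
        unfolding sign_first_def using w linear_pm_scl[OF linear_derivation, of d' D1 "koszul_sign (d x)" "single [x, y] 1"]
        by simp
      also have "\<dots> = scl (koszul_sign (d x)) (D1 x * letter y) - letter x * D1 y"
        by (simp add: pair scl_diff_right)
      also have "\<dots> = \<rho> (cop x * letter y) - \<rho> (letter x * cop y)" using w left right by simp
      finally show "DP (sign_first (single w 1)) = \<rho> (cop (w!0) * letter (w!Suc 0)) - \<rho> (letter (w!0) * cop (w!Suc 0))"
        using w by simp
    qed
  qed
  also have "\<dots> = \<rho> (lin (\<lambda>w. cop (w!0) * letter (w!1)) (cop b)) - \<rho> (lin (\<lambda>w. letter (w!0) * cop (w!1)) (cop b))"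
    by (rule lin_eq[symmetric, OF linear_pm_minus'[OF linear_pm_comp linear_pm_comp]]) (simp_all add: \<rho>_def)
  also have "\<dots> = 0" using cop_coassociative[OF b] by simp
  finally show ?thesis .
qed (simp add: D1_def linear_pm_zero[OF linear_derivation])

lemma DP_DP: "DP (DP p) = 0"
  by (rule derivation_square_zero[OF homogeneous_D1 DP_D1])

lemma keys_DP: "keys p \<subseteq> lists B \<Longrightarrow> keys (DP p) \<subseteq> lists B"
  by (rule keys_derivation) (use keys_D1 in \<open>auto simp: pairs_def\<close>)

definition \<delta> :: "('a list \<Rightarrow>\<^sub>0 'k) set \<Rightarrow> ('a list \<Rightarrow>\<^sub>0 'k) set" where
  "\<delta> t = tensor_class (suspension C) (DP (S.\<nu> t))"

lemma \<delta>_\<nu>: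
  assumes "t \<in> carrier S.T" shows "\<delta> t \<in> carrier S.T" "S.\<nu> (\<delta> t) = DP (S.\<nu> t)"
  unfolding \<delta>_def by (rule S.class_basis[OF keys_DP[OF S.\<nu>_keys[OF assms]]])+

lemma graded_map_\<delta>: "graded_map 1 S.TL S.TL \<delta>"
proof (intro graded_mapI linear_mapI; (rule S.\<nu>_inj)?)
  show "t \<in> grade S.TL n \<Longrightarrow> \<delta> t \<in> grade S.TL (n + 1)" for t n
    by (simp add: S.\<nu>_grade \<delta>_\<nu> homogeneous_derivation[OF homogeneous_D1])
qed (simp_all add: \<delta>_\<nu> linear_pm_add[OF linear_derivation] linear_pm_scl[OF linear_derivation])

lemma leibniz_\<delta>: "leibniz S.TL \<delta>"
  unfolding leibniz_def
proof (intro allI ballI)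
  fix i x y assume x: "x \<in> grade S.TL i" and y: "y \<in> carrier S.TL"
  have xy: "x \<in> carrier S.T" "homogeneous d' i (S.\<nu> x)" "y \<in> carrier S.T" using x y by (auto simp: S.\<nu>_grade)
  show "\<delta> (bracket S.TL x y) =
      bracket S.TL (\<delta> x) y \<oplus>\<^bsub>S.TL\<^esub> koszul_sign i \<odot>\<^bsub>S.TL\<^esub> bracket S.TL x (\<delta> y)"
    by (rule S.\<nu>_inj)
      (simp_all add: \<delta>_\<nu> S.graded_commutator_T xy derivation_commutator[OF homogeneous_D1 xy(2)])
qed

lemma \<delta>_\<delta>: "t \<in> carrier S.T \<Longrightarrow> \<delta> (\<delta> t) = \<zero>\<^bsub>S.T\<^esub>"
  by (rule S.\<nu>_inj) (simp_all add: \<delta>_\<nu> DP_DP)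

lemma DP_expansion:
  assumes x: "x \<in> carrier C" shows "DP (expansion x) = sign_first (cop x)"
proof -
  have "DP (expansion x) = lin D1 (coord x)"
    by (rule lin_eq[OF linear_pm_comp[OF linear_derivation linear_pm_lin]]) simp
  also have "\<dots> = lin (\<lambda>b. sign_first (cop b)) (coord x)"
    by (rule lin_cong) (use coord_keys[OF x] in \<open>auto simp: D1_def\<close>)
  also have "\<dots> = sign_first (cop x)"
    using linear_coord[of "\<lambda>x. sign_first (cop x)", OF _ _ x]
    by (simp add: cop_add cop_smult linear_pm_add linear_pm_scl)
  finally show ?thesis .
qed

text \<open>
  The sign conventions of the suspension and of the twist match: the two terms of the commutator in
  \<open>C[-1]\<close> are the signed tensor and its signed twist.
\<close>

lemma sign_first_commutator:
  assumes x: "x \<in> grade C i" and y: "y \<in> grade C j"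
  shows "scl (koszul_sign i) (commutator d' (expansion x) (expansion y)) =
    sign_first (expansion x * expansion y) + sign_first (lin (swap_letters d) (expansion x * expansion y))"
proof -
  have c: "x \<in> carrier C" "y \<in> carrier C" using x y by auto
  have cx: "keys (coord x) \<subseteq> {b \<in> B. d b = i}" and cy: "keys (coord y) \<subseteq> {b \<in> B. d b = j}"
    using coord_keys[OF c(1)] coord_keys[OF c(2)] coord_grade[OF x] coord_grade[OF y] by auto
  have sf: "sign_first (lin letter p * lin letter q) = scl (koszul_sign i) (lin letter p * lin letter q)"
    if "keys p \<subseteq> {b \<in> B. d b = i}" for p q and i
    by (rule linear_bilinear_eqI[OF _ _ _ _ that subset_UNIV])
      (auto simp: linear_pm_def lin_add lin_scl algebra_simps scl_add_right letter_def
        linear_pm_add[OF linear_sign_first] linear_pm_scl[OF linear_sign_first] sign_first_def)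
  have hom: "homogeneous d' (i + 1) (expansion x)" "homogeneous d' (j + 1) (expansion y)"
    using S.homogeneous_expansion[of x "i + 1"] S.homogeneous_expansion[of y "j + 1"] x y by (simp_all add: S_coord)
  have "koszul_sign i * koszul_sign ((i + 1) * (j + 1)) = - (koszul_sign (i * j) * koszul_sign j :: 'k)"
    by (auto simp: koszul_sign_def)
  then show ?thesis
    by (simp add: commutator_homogeneous[OF hom] scl_diff_right swap_letters_product[OF cx cy] sf[OF cx] sf[OF cy]
        linear_pm_scl[OF linear_sign_first])
qed

abbreviation "SL \<equiv> free_lie (suspension C)"

abbreviation "s \<equiv> tensor_inc (suspension C)"

lemma SL_T: "x \<in> carrier SL \<Longrightarrow> x \<in> carrier S.T"
  using graded_lie_algebra.lie_generated_carrier[OF S.graded_lie_algebra_tensor S.tensor_inc_image]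
  by (auto simp: free_lie_eq)

lemma SL_simps [simp]: "add SL = add S.T" "smult SL = smult S.T" "zero SL = zero S.T"
    "bracket SL = graded_commutator S.T" "grade SL n = grade S.T n \<inter> carrier SL"
  by (simp_all add: free_lie_eq)

lemma s_mem: "x \<in> carrier C \<Longrightarrow> s x \<in> carrier SL"
  using S.inc_simps(1) by simp

lemma \<nu>_finsum_SL:
  assumes "\<And>a. a \<in> A \<Longrightarrow> f a \<in> carrier SL"
  shows "S.\<nu> (finsum SL f A) = (\<Sum>a\<in>A. S.\<nu> (f a))"
proof -
  have "linear_map SL (poly_lie d' B) S.\<nu>"
    using SL_T S.\<nu>_keys by (intro linear_mapI) auto
  from linear_map_finsum[OF S.L.module_axioms poly_lie_module this, of f A] assms show ?thesis
    by (simp add: poly_lie_finsum SL_T S.\<nu>_keys Pi_iff)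
qed

text \<open>
  Summing \<open>sign_first_commutator\<close> over \<open>r\<close> gives the signed coproduct plus its signed twist. By
  cocommutativity these are equal, which cancels the factor \<open>1 / 2\<close>. In particular the right-hand side
  does not depend on the representation of the coproduct.
\<close>

lemma \<delta>_formula:
  assumes x: "x \<in> carrier C" and y: "\<And>r. r < m \<Longrightarrow> y r \<in> grade C (e r)" "\<And>r. r < m \<Longrightarrow> y' r \<in> grade C (e' r)"
    and \<Delta>x: "\<Delta> x = (\<Oplus>\<^bsub>T\<^esub>r\<in>{..<m}. tensor (y r) C (y' r))"
  shows "\<delta> (s x) = (1 / 2) \<odot>\<^bsub>SL\<^esub> (\<Oplus>\<^bsub>SL\<^esub>r\<in>{..<m}. koszul_sign (e r) \<odot>\<^bsub>SL\<^esub> bracket SL (s (y r)) (s (y' r)))"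
proof (rule S.\<nu>_inj)
  have yc: "y r \<in> carrier C" "y' r \<in> carrier C" if "r < m" for r using y[OF that] by auto
  let ?p = "\<lambda>r. expansion (y r) * expansion (y' r)"
  have cop: "cop x = (\<Sum>r<m. ?p r)"
    unfolding cop_def \<Delta>x by (subst \<nu>_finsum) (simp_all add: tensor_T2 yc)
  have mem: "koszul_sign (e r) \<odot>\<^bsub>SL\<^esub> bracket SL (s (y r)) (s (y' r)) \<in> carrier SL" if "r < m" for r
    using S.L.bracket_simps(1)[OF s_mem s_mem] yc[OF that] S.L.smult_mem by blast
  then have summem: "(\<Oplus>\<^bsub>SL\<^esub>r\<in>{..<m}. koszul_sign (e r) \<odot>\<^bsub>SL\<^esub> bracket SL (s (y r)) (s (y' r))) \<in> carrier SL"
    by (intro S.L.finsum_closed) auto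
  show "\<delta> (s x) \<in> carrier S.T" using \<delta>_\<nu>(1)[OF SL_T[OF s_mem[OF x]]] .
  show "(1 / 2) \<odot>\<^bsub>SL\<^esub> (\<Oplus>\<^bsub>SL\<^esub>r\<in>{..<m}. koszul_sign (e r) \<odot>\<^bsub>SL\<^esub> bracket SL (s (y r)) (s (y' r))) \<in> carrier S.T"
    by (rule SL_T[OF S.L.smult_mem[OF summem]])
  have \<nu>s: "S.\<nu> (s z) = expansion z" if "z \<in> carrier C" for z using that by (simp add: S_coord)
  have "S.\<nu> ((1 / 2) \<odot>\<^bsub>SL\<^esub> (\<Oplus>\<^bsub>SL\<^esub>r\<in>{..<m}. koszul_sign (e r) \<odot>\<^bsub>SL\<^esub> bracket SL (s (y r)) (s (y' r)))) =
      scl (1 / 2) (\<Sum>r<m. S.\<nu> (koszul_sign (e r) \<odot>\<^bsub>SL\<^esub> bracket SL (s (y r)) (s (y' r))))"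
    using S.\<nu>_simps(5)[OF SL_T[OF summem], of "1 / 2"] \<nu>_finsum_SL[of "{..<m}", OF mem] by simp
  also have "(\<Sum>r<m. S.\<nu> (koszul_sign (e r) \<odot>\<^bsub>SL\<^esub> bracket SL (s (y r)) (s (y' r)))) =
      (\<Sum>r<m. scl (koszul_sign (e r)) (commutator d' (expansion (y r)) (expansion (y' r))))"
    using yc SL_T[OF s_mem] by (intro sum.cong) (simp_all add: S.graded_commutator_T S_coord)
  also have "\<dots> = (\<Sum>r<m. sign_first (?p r) + sign_first (lin (swap_letters d) (?p r)))"
    by (intro sum.cong refl sign_first_commutator[OF y(1) y(2)]) simp_all
  also have "\<dots> = sign_first (cop x) + sign_first (lin (swap_letters d) (cop x))"
    by (simp add: sum.distrib cop lin_sum linear_pm_sum[OF linear_sign_first])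
  also have "\<dots> = scl 2 (sign_first (cop x))"
    using cop_cocommutative[OF cocommutative x] scl_add_left[of 1 1 "sign_first (cop x)"] by simp
  finally show "S.\<nu> (\<delta> (s x)) =
      S.\<nu> ((1 / 2) \<odot>\<^bsub>SL\<^esub> (\<Oplus>\<^bsub>SL\<^esub>r\<in>{..<m}. koszul_sign (e r) \<odot>\<^bsub>SL\<^esub> bracket SL (s (y r)) (s (y' r))))"
    using x \<delta>_\<nu>(2)[OF SL_T[OF s_mem[OF x]]] by (simp add: S_coord DP_expansion)
qed

text \<open>
  The expansion in the basis, written as a sum of homogeneous tensors indexed by natural numbers. The set \<open>X\<close>
  keeps track of the basis elements involved.
\<close>

lemma cop_representation:
  assumes x: "x \<in> carrier C" and X: "keys (cop x) \<subseteq> pairs X" "X \<subseteq> B"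
  obtains m y y' and e e' :: "nat \<Rightarrow> int" where
    "\<And>r. r < m \<Longrightarrow> y r \<in> grade C (e r)" "\<And>r. r < m \<Longrightarrow> y' r \<in> grade C (e' r)"
    "\<And>r. r < m \<Longrightarrow> keys (coord (y r)) \<subseteq> X" "\<And>r. r < m \<Longrightarrow> keys (coord (y' r)) \<subseteq> X"
    "\<Delta> x = (\<Oplus>\<^bsub>T\<^esub>r\<in>{..<m :: nat}. tensor (y r) C (y' r))"
proof -
  obtain f where f: "bij_betw f {0..<card (keys (cop x))} (keys (cop x))"
    using ex_bij_betw_nat_finite[OF finite_keys] by blast
  define m where "m = card (keys (cop x))"
  have f: "bij_betw f {..<m} (keys (cop x))" using f by (simp add: m_def lessThan_atLeast0)
  define y where "y r = lookup (cop x) (f r) \<odot> (f r ! 0)" for r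
  define y' where "y' r = f r ! 1" for r
  have pair: "\<exists>a\<in>X. \<exists>b\<in>X. f r = [a, b]" if "r < m" for r
    using bij_betwE[OF f] that X(1) by (auto simp: pairs_iff dest!: subsetD)
  have XC: "a \<in> carrier C" "a \<in> B" "a \<in> grade C (d a)" if "a \<in> X" for a
    using that X(2) basis_carrier basis_grade by auto
  have "y r \<in> grade C (d (f r ! 0))" "y' r \<in> grade C (d (f r ! 1))"
    "keys (coord (y r)) \<subseteq> X" "keys (coord (y' r)) \<subseteq> X" "y r \<in> carrier C" "y' r \<in> carrier C"
    "expansion (y r) * expansion (y' r) = single (f r) (lookup (cop x) (f r))" if r: "r < m" for r
  proof -
    obtain a b where ab: "a \<in> X" "b \<in> X" "f r = [a, b]" using pair[OF r] by blast
    note a = XC[OF ab(1)] and b = XC[OF ab(2)]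
    show "y r \<in> grade C (d (f r ! 0))" "y' r \<in> grade C (d (f r ! 1))" "y r \<in> carrier C" "y' r \<in> carrier C"
      using a b ab by (simp_all add: y_def y'_def grade_smult)
    show "keys (coord (y r)) \<subseteq> X" "keys (coord (y' r)) \<subseteq> X"
      using a b ab by (simp_all add: y_def y'_def coord_smult)
    show "expansion (y r) * expansion (y' r) = single (f r) (lookup (cop x) (f r))"
      using a b ab by (simp add: y_def y'_def coord_smult letter_def)
  qed
  note yy = this
  have "\<Delta> x = (\<Oplus>\<^bsub>T\<^esub>r\<in>{..<m}. tensor (y r) C (y' r))"
  proof (rule \<nu>_inj)
    interpret T: graded_space T by (rule graded_space_T)
    show "\<Delta> x \<in> carrier T" by (rule \<Delta>_mem(2)[OF x])
    show "(\<Oplus>\<^bsub>T\<^esub>r\<in>{..<m}. tensor (y r) C (y' r)) \<in> carrier T"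
      by (intro T.finsum_closed) (use yy tensor_T2 in auto)
    have "\<nu> (\<Oplus>\<^bsub>T\<^esub>r\<in>{..<m}. tensor (y r) C (y' r)) = (\<Sum>r<m. single (f r) (lookup (cop x) (f r)))"
      by (subst \<nu>_finsum) (simp_all add: tensor_T2 yy)
    also have "\<dots> = (\<Sum>w\<in>keys (cop x). single w (lookup (cop x) w))"
      by (rule sum.reindex_bij_betw[OF f])
    also have "\<dots> = cop x" by (rule poly_mapping_monomials)
    finally show "\<nu> (\<Delta> x) = \<nu> (\<Oplus>\<^bsub>T\<^esub>r\<in>{..<m}. tensor (y r) C (y' r))" by (simp add: cop_def)
  qed
  then show thesis using that[of m y "\<lambda>r. d (f r ! 0)" y' "\<lambda>r. d (f r ! 1)"] yy by blast
qed

lemma \<delta>_sub_lie: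
  assumes x: "x \<in> carrier C" and X: "keys (cop x) \<subseteq> pairs X" "X \<subseteq> B"
  shows "\<delta> (s x) \<in> S.sub_lie X"
proof -
  obtain m y y' and e e' :: "nat \<Rightarrow> int" where
    r: "\<And>r. r < m \<Longrightarrow> y r \<in> grade C (e r)" "\<And>r. r < m \<Longrightarrow> y' r \<in> grade C (e' r)"
    "\<And>r. r < m \<Longrightarrow> keys (coord (y r)) \<subseteq> X" "\<And>r. r < m \<Longrightarrow> keys (coord (y' r)) \<subseteq> X"
    "\<Delta> x = (\<Oplus>\<^bsub>T\<^esub>r\<in>{..<m :: nat}. tensor (y r) C (y' r))"
    by (rule cop_representation[OF x X], rule that)
  note sub = S.L.graded_subspaceD[OF S.sub_lie_graded[OF X(2)]]
  have br: "bracket SL a b \<in> S.sub_lie X" if "a \<in> S.sub_lie X" "b \<in> S.sub_lie X" for a b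
    using that S.sub_lie_subalgebra[OF X(2)] by (simp add: graded_lie_subalgebra_iff)
  have "s z \<in> S.sub_lie X" if "z \<in> carrier C" "keys (coord z) \<subseteq> X" for z
    using S.inc_sub_lie[OF X(2), of z] that by (simp add: S_coord)
  then have "koszul_sign (e k) \<odot>\<^bsub>SL\<^esub> bracket SL (s (y k)) (s (y' k)) \<in> S.sub_lie X" if k: "k < m" for k
    by (intro sub(6) br) (use grade_mem[OF r(1)[OF k]] grade_mem[OF r(2)[OF k]] r(3,4)[OF k] in blast)+
  then have "(\<Oplus>\<^bsub>SL\<^esub>r\<in>{..<m}. koszul_sign (e r) \<odot>\<^bsub>SL\<^esub> bracket SL (s (y r)) (s (y' r))) \<in> S.sub_lie X"
    by (intro S.L.finsum_mem[OF sub(1)]) simp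
  then have mem: "(1 / 2) \<odot>\<^bsub>SL\<^esub> (\<Oplus>\<^bsub>SL\<^esub>r\<in>{..<m}. koszul_sign (e r) \<odot>\<^bsub>SL\<^esub> bracket SL (s (y r)) (s (y' r)))
      \<in> S.sub_lie X" by (rule sub(6))
  have "\<delta> (s x) = (1 / 2) \<odot>\<^bsub>SL\<^esub> (\<Oplus>\<^bsub>SL\<^esub>r\<in>{..<m}. koszul_sign (e r) \<odot>\<^bsub>SL\<^esub> bracket SL (s (y r)) (s (y' r)))"
    by (rule \<delta>_formula[OF x]) (use r in blast)+
  then show ?thesis using mem by metis
qed

lemma sub_lie_B: "S.sub_lie B = carrier SL"
proof
  show "S.sub_lie B \<subseteq> carrier SL" by (rule S.L.graded_subspaceD(7)[OF S.sub_lie_graded]) simp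
  have "s ` carrier C \<subseteq> S.sub_lie B" using S.inc_sub_lie[of B] S.coord_keys by auto
  then have "lie_generated SL (s ` carrier (suspension C)) \<subseteq> S.sub_lie B"
    by (intro lie_generated_least S.sub_lie_subalgebra) simp_all
  then show "carrier SL \<subseteq> S.sub_lie B" unfolding S.free_lie_generated .
qed

lemma \<delta>_SL: "x \<in> carrier SL \<Longrightarrow> \<delta> x \<in> carrier SL"
proof -
  assume x: "x \<in> carrier SL"
  have gen: "carrier SL = lie_generated S.TL (s ` carrier C)" by (simp add: free_lie_eq)
  have "\<delta> g \<in> lie_generated S.TL (s ` carrier C)" if "g \<in> s ` carrier C" for g
    using that \<delta>_sub_lie[OF _ cop_keys order_refl] sub_lie_B by (auto simp flip: gen)
  from graded_lie_algebra.derivation_lie_generated[OF S.graded_lie_algebra_TL graded_map_\<delta> leibniz_\<delta> _ this] x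
  show ?thesis using S.tensor_inc_image by (simp add: gen)
qed

lemma graded_map_\<delta>_SL: "graded_map 1 SL SL \<delta>"
  using linear_mapD(2,3)[OF graded_mapD(1)[OF graded_map_\<delta>]] graded_mapD(2)[OF graded_map_\<delta>]
  by (intro graded_mapI linear_mapI) (simp_all add: \<delta>_SL SL_T)

lemma leibniz_\<delta>_SL: "leibniz SL \<delta>"
  using leibniz_\<delta> SL_T by (simp add: leibniz_def)

lemma graded_map_restrict_\<delta>: "graded_map 1 SL SL (restrict \<delta> (carrier SL))"
  using linear_mapD[OF graded_mapD(1)[OF graded_map_\<delta>_SL]] graded_mapD(2)[OF graded_map_\<delta>_SL]
  by (intro graded_mapI linear_mapI) (simp_all add: S.L.grade_mem S.L.a_closed S.L.smult_mem del: SL_simps)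

lemma leibniz_restrict_\<delta>: "leibniz SL (restrict \<delta> (carrier SL))"
  using leibniz_\<delta>_SL by (simp add: leibniz_def S.L.grade_mem S.L.bracket_simps(1) del: SL_simps)

text \<open>
  The derivation \<open>\<delta>\<close> has the prescribed values by \<open>\<delta>_formula\<close>, and two derivations of a free Lie algebra that
  agree on generators are equal.
\<close>

lemma cobar_diff_eq: "cobar_diff C \<Delta> = restrict \<delta> (carrier SL)"
  unfolding cobar_diff_def Let_def
proof (rule the_equality, intro conjI ballI allI impI)
  show "graded_map 1 SL SL (restrict \<delta> (carrier SL))"
    by (rule graded_map_restrict_\<delta>)
  show "leibniz SL (restrict \<delta> (carrier SL))"
    by (rule leibniz_restrict_\<delta>)
next
  fix x m y y' and e e' :: "nat \<Rightarrow> int"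
  assume "x \<in> carrier C" "(\<forall>r<m. y r \<in> grade C (e r) \<and> y' r \<in> grade C (e' r)) \<and>
    \<Delta> x = (\<Oplus>\<^bsub>T\<^esub>r\<in>{..<m}. tensor (y r) C (y' r))"
  then show "restrict \<delta> (carrier SL) (s x) =
      (1 / 2) \<odot>\<^bsub>SL\<^esub> (\<Oplus>\<^bsub>SL\<^esub>r\<in>{..<m}. koszul_sign (e r) \<odot>\<^bsub>SL\<^esub> bracket SL (s (y r)) (s (y' r)))"
    using s_mem \<delta>_formula[of x m y e y' e'] by simp
next
  fix D assume D: "D \<in> extensional (carrier SL) \<and> graded_map 1 SL SL D \<and> leibniz SL D \<and>
     (\<forall>x\<in>carrier C. \<forall>m y y' e e'. (\<forall>r<m. y r \<in> grade C (e r) \<and> y' r \<in> grade C (e' r)) \<and>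
          \<Delta> x = (\<Oplus>\<^bsub>T\<^esub>r\<in>{..<m :: nat}. tensor (y r) C (y' r)) \<longrightarrow>
          D (s x) = (1 / 2) \<odot>\<^bsub>SL\<^esub> (\<Oplus>\<^bsub>SL\<^esub>r\<in>{..<m}. koszul_sign (e r) \<odot>\<^bsub>SL\<^esub> bracket SL (s (y r)) (s (y' r))))"
  have gen: "D (s x) = \<delta> (s x)" if x: "x \<in> carrier C" for x
  proof -
    obtain m y y' and e e' :: "nat \<Rightarrow> int" where
      r: "\<And>r. r < m \<Longrightarrow> y r \<in> grade C (e r)" "\<And>r. r < m \<Longrightarrow> y' r \<in> grade C (e' r)"
        "\<And>r. r < m \<Longrightarrow> keys (coord (y r)) \<subseteq> B" "\<And>r. r < m \<Longrightarrow> keys (coord (y' r)) \<subseteq> B"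
        "\<Delta> x = (\<Oplus>\<^bsub>T\<^esub>r\<in>{..<m :: nat}. tensor (y r) C (y' r))"
      by (rule cop_representation[OF x cop_keys[OF x] order_refl], rule that)
    have "D (s x) = (1 / 2) \<odot>\<^bsub>SL\<^esub> (\<Oplus>\<^bsub>SL\<^esub>r\<in>{..<m}. koszul_sign (e r) \<odot>\<^bsub>SL\<^esub> bracket SL (s (y r)) (s (y' r)))"
      using D x r(1,2,5) by blast
    also have "\<dots> = \<delta> (s x)" by (rule \<delta>_formula[symmetric, OF x]) (use r in blast)+
    finally show ?thesis .
  qed
  show "D = restrict \<delta> (carrier SL)"
  proof (rule extensionalityI[of _ "carrier SL"])
    fix t assume t: "t \<in> carrier SL"
    have "D t = \<delta> t"
    proof (rule S.L.derivations_agree[OF _ _ graded_map_\<delta>_SL leibniz_\<delta>_SL])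
      show "t \<in> lie_generated SL (s ` carrier (suspension C))" using t S.free_lie_generated by simp
    qed (use D gen s_mem in auto)
    then show "D t = restrict \<delta> (carrier SL) t" using t by simp
  qed (use D in auto)
qed simp

lemma cobar_eq: "cobar C \<Delta> = with_diff SL (cobar_diff C \<Delta>)"
  by (simp add: cobar_def with_diff_def)

lemma dg_lie_algebra_cobar: "dg_lie_algebra (with_diff SL (cobar_diff C \<Delta>))" (is "dg_lie_algebra ?M")
proof (rule dg_lie_algebra.intro[OF graded_lie_algebra_with_diff[OF S.L.graded_lie_algebra_axioms] dg_lie_algebra_axioms.intro])
  show "graded_map 1 ?M ?M (diff ?M)"
    using graded_map_restrict_\<delta> unfolding cobar_diff_eq by (simp add: graded_map_def linear_map_def del: SL_simps)
  show "leibniz ?M (diff ?M)"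
    using leibniz_restrict_\<delta> unfolding cobar_diff_eq by (simp add: leibniz_def del: SL_simps)
  show "diff ?M (diff ?M x) = \<zero>\<^bsub>?M\<^esub>" if "x \<in> carrier ?M" for x
    using that unfolding cobar_diff_eq by (simp add: \<delta>_SL \<delta>_\<delta> SL_T)
qed

end

section \<open>Ascending unions as colimits\<close>

lemma transition_id [simp]: "transition (\<lambda>_ x. x) n k = (\<lambda>x. x)"
  by (induction k) auto

text \<open>
  Along inclusions, two elements become equal at a later stage only if they are equal, so the class of \<open>x\<close> in
  the colimit consists of the copies of \<open>x\<close> in all stages that contain it.
\<close>

lemma colimit_ascending_union:
  fixes M :: "('k::field_char_0, 'b) dg_lie"
  assumes M: "dg_lie_algebra M" and S: "\<And>n. graded_lie_subalgebra (S n) M"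
    and D: "\<And>n x. x \<in> S n \<Longrightarrow> diff M x \<in> S n" and mono: "\<And>m n. m \<le> n \<Longrightarrow> S m \<subseteq> S n"
    and union: "carrier M = (\<Union>n. S n)"
  defines "X \<equiv> \<lambda>n. subspace_of M (S n)"
  obtains \<beta> where "dg_lie_iso (colimit X (\<lambda>_ x. x)) M \<beta>"
    "\<And>n x. x \<in> S n \<Longrightarrow> \<beta> (colim_class X (\<lambda>_ x. x) n x) = x"
proof -
  interpret M: dg_lie_algebra M by fact
  define cls where "cls x = {(m, y). y \<in> S m \<and> y = x}" for x
  define \<beta> where "\<beta> P = snd (SOME q. q \<in> P)" for P :: "(nat \<times> 'b) set"
  have X [simp]: "carrier (X n) = S n" "zero (X n) = zero M" "add (X n) = add M" "smult (X n) = smult M"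
    "bracket (X n) = bracket M" "diff (X n) = diff M" "grade (X n) k = grade M k \<inter> S n" for n k
    by (simp_all add: X_def)
  have class_eq: "colim_class X (\<lambda>_ x. x) n x = cls x" for n x
    by (auto simp: colim_class_def cls_def intro: exI[of _ n] add.commute)
  have \<beta>: "\<beta> (cls x) = x" if x: "x \<in> carrier M" for x
  proof -
    obtain n where "x \<in> S n" using x union by blast
    then have "(n, x) \<in> cls x" by (simp add: cls_def)
    then have "(SOME q. q \<in> cls x) \<in> cls x" by (rule someI)
    then show ?thesis by (auto simp: \<beta>_def cls_def)
  qed
  have common: "\<exists>n. x \<in> S n \<and> y \<in> S n" if xy: "x \<in> carrier M" "y \<in> carrier M" for x y
  proof -
    obtain m n where "x \<in> S m" "y \<in> S n" using xy union by blast
    then show ?thesis using mono[of m "max m n"] mono[of n "max m n"] by auto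
  qed
  have unary: "\<Union>{colim_class X (\<lambda>_ x. x) n (f n x') | n x'. (n, x') \<in> cls x} = cls (f' x)"
    if x: "x \<in> carrier M" and f: "\<And>n. x \<in> S n \<Longrightarrow> f n x = f' x" for x and f f'
  proof -
    obtain n where n: "x \<in> S n" using x union by blast
    have "{colim_class X (\<lambda>_ x. x) n (f n x') | n x'. (n, x') \<in> cls x} = {cls (f' x)}"
      using n f by (auto simp: class_eq cls_def[of x] intro!: exI[of _ n])
    then show ?thesis by simp
  qed
  have binary: "\<Union>{colim_class X (\<lambda>_ x. x) n (f n x' y') | n x' y'. (n, x') \<in> cls x \<and> (n, y') \<in> cls y} = cls (f' x y)"
    if x: "x \<in> carrier M" "y \<in> carrier M" and f: "\<And>n. f n x y = f' x y" for x y and f f'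
  proof -
    obtain n where n: "x \<in> S n" "y \<in> S n" using common[OF x] by blast
    have "{colim_class X (\<lambda>_ x. x) n (f n x' y') | n x' y'. (n, x') \<in> cls x \<and> (n, y') \<in> cls y} = {cls (f' x y)}"
      using n f by (auto simp: class_eq cls_def[of x] cls_def[of y] intro!: exI[of _ n])
    then show ?thesis by simp
  qed
  let ?L = "colimit X (\<lambda>_ x. x)"
  have carrier: "carrier ?L = cls ` carrier M"
    by (auto simp: colimit_def class_eq union)
  have add: "cls x \<oplus>\<^bsub>?L\<^esub> cls y = cls (x \<oplus>\<^bsub>M\<^esub> y)" if "x \<in> carrier M" "y \<in> carrier M" for x y
    using binary[OF that, of "\<lambda>n. add (X n)" "add M"] by (simp add: colimit_def)
  have bracket: "bracket ?L (cls x) (cls y) = cls (bracket M x y)" if "x \<in> carrier M" "y \<in> carrier M" for x y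
    using binary[OF that, of "\<lambda>n. bracket (X n)" "bracket M"] by (simp add: colimit_def)
  have smult: "c \<odot>\<^bsub>?L\<^esub> cls x = cls (c \<odot>\<^bsub>M\<^esub> x)" if "x \<in> carrier M" for c x
    using unary[OF that, of "\<lambda>n. smult (X n) c" "smult M c"] by (simp add: colimit_def)
  have diff: "diff ?L (cls x) = cls (diff M x)" if "x \<in> carrier M" for x
    using unary[OF that, of "\<lambda>n. diff (X n)" "diff M"] by (simp add: colimit_def)
  have grade: "grade ?L n = cls ` grade M n" for n
  proof -
    have "grade ?L n = cls ` (\<Union>k. grade M n \<inter> S k)"
      unfolding image_UN by (simp add: colimit_def class_eq)
    also have "(\<Union>k. grade M n \<inter> S k) = grade M n" using M.grade_mem union by blast
    finally show ?thesis .
  qed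
  have Dc: "diff M x \<in> carrier M" if "x \<in> carrier M" for x
    using linear_mapD(1)[OF graded_mapD(1)[OF M.diff_graded_map] that] .
  have "bij_betw \<beta> (carrier ?L) (carrier M)"
    unfolding carrier by (rule bij_betw_byWitness[where f' = cls]) (auto simp: \<beta>)
  moreover have "\<beta> ` grade ?L n = grade M n" for n
    unfolding grade using \<beta> M.grade_mem by (force simp: image_image)
  moreover have "dg_lie_hom ?L M \<beta>"
    unfolding dg_lie_hom_def
  proof (intro conjI graded_lie_homI graded_mapI linear_mapI ballI)
    show "\<beta> P \<in> grade M (n + 0)" if "P \<in> grade ?L n" for P n
      using that \<beta> M.grade_mem by (auto simp: grade)
  qed (auto simp: carrier add bracket smult diff \<beta> Dc)
  ultimately have "dg_lie_iso ?L M \<beta>"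
    by (auto simp: dg_lie_iso_def graded_lie_iso_def dg_lie_hom_def)
  moreover have "\<beta> (colim_class X (\<lambda>_ x. x) n x) = x" if "x \<in> S n" for n x
    using that \<beta> union class_eq by auto
  ultimately show thesis by (rule that)
qed

lemma dg_lie_algebra_zero: "dg_lie_algebra (zero_dg_lie :: ('k::field_char_0, unit) dg_lie)"
proof -
  let ?Z = "zero_dg_lie :: ('k, unit) dg_lie"
  have [simp]: "carrier ?Z = UNIV" "grade ?Z n = UNIV" for n
    by (auto simp: zero_dg_lie_def)
  have mod: "module scalars ?Z" by (rule scalar_moduleI) auto
  interpret scalar_module ?Z using mod by (simp add: scalar_module_def)
  have "graded_space ?Z"
    by (rule graded_space.intro[OF mod graded_space_axioms.intro])
      (auto simp: submodule_iff is_decomposition_def)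
  then interpret graded_space ?Z .
  have "graded_lie_algebra ?Z"
    by (rule graded_lie_algebra.intro[OF graded_space_axioms graded_lie_algebra_axioms.intro])
      (auto simp: linear_map_def)
  then show ?thesis
    by (rule dg_lie_algebra.intro[OF _ dg_lie_algebra_axioms.intro])
      (auto simp: graded_map_def linear_map_def leibniz_def)
qed

section \<open>Conilpotent coalgebras\<close>

text \<open>
  Homogeneous elements that are killed by one of the first iterated coproducts. The sets increase with \<open>n\<close>
  by definition, which is what the successive choice of bases needs.
\<close>

definition conilpotent_part :: "('k::field_char_0, 'a) graded_space \<Rightarrow> ('a \<Rightarrow> ('a list \<Rightarrow>\<^sub>0 'k) set) \<Rightarrow> nat \<Rightarrow> 'a set" where
  "conilpotent_part C \<Delta> n =
     {x. (\<exists>k. x \<in> grade C k) \<and> (\<exists>m\<le>n. iterated_coproduct C \<Delta> m x = \<zero>\<^bsub>tensor_algebra C\<^esub>)}"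

text \<open>
  The second factors are in \<open>X\<close> because they are coordinates of elements killed by an earlier iterated
  coproduct, which are homogeneous; the first factors are in \<open>X\<close> because the coproduct is symmetric up to signs.
\<close>

lemma (in coalgebra_basis) cop_conilpotent_part:
  assumes cocomm: "cocommutative C \<Delta>" and X: "X \<subseteq> B" "conilpotent_part C \<Delta> n \<subseteq> span_of C X"
    and b: "b \<in> B" "b \<in> conilpotent_part C \<Delta> (Suc n)"
  shows "keys (cop b) \<subseteq> pairs X"
proof -
  have bc: "b \<in> carrier C" using b basis_carrier by blast
  obtain m where m: "m \<le> Suc n" "iterated_coproduct C \<Delta> m b = \<zero>\<^bsub>T\<^esub>"
    using b(2) by (auto simp: conilpotent_part_def)
  (* The zeroth iterated coproduct is injective. *)
  have "m \<noteq> 0"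
  proof
    assume "m = 0"
    then have "\<nu> (tensor_inc C b) = 0" using m(2) by simp
    then have "keys (letter b :: 'a list \<Rightarrow>\<^sub>0 'k) = {}" using \<nu>_inc_basis[OF b(1)] by (simp del: keys_letter)
    then show False by simp
  qed
  then obtain m' where m': "m = Suc m'" "m' \<le> n" using m(1) by (cases m) auto
  have second: "c \<in> X" if ac: "[a, c] \<in> keys (cop b)" for a c
  proof -
    let ?y = "lincomb C (right_factor b a)"
    have "?y \<in> conilpotent_part C \<Delta> n"
      using right_factor_grade[OF basis_grade[OF b(1)]] right_factor_conilpotent[OF bc] m(2) m'
      by (auto simp: conilpotent_part_def)
    then obtain g where g: "keys g \<subseteq> X" "?y = lincomb C g" using X(2) by (auto simp: span_of_def)
    have "right_factor b a = g"
      by (rule lincomb_inj[OF right_factor_basis[OF bc] _ g(2)]) (use g(1) X(1) in blast)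
    moreover have "c \<in> keys (right_factor b a)" using ac by (simp add: right_factor_keys[OF bc])
    ultimately show ?thesis using g(1) by blast
  qed
  show ?thesis
  proof
    fix w assume w: "w \<in> keys (cop b)"
    then obtain a c where ac: "w = [a, c]" using cop_keys[OF bc] by (auto simp: pairs_iff dest!: subsetD)
    have "a \<in> X" "c \<in> X" using second[of a c] second[of c a] cop_swap[OF cocomm bc, of a c] w ac by auto
    then show "w \<in> pairs X" using ac by (auto simp: pairs_iff)
  qed
qed

text \<open>
  Bases of the steps of the filtration are chosen successively, each one extending the previous one.
\<close>

lemma adapted_basis_exists:
  assumes "graded_coalgebra C \<Delta>" and conil: "locally_conilpotent C \<Delta>"
  obtains Bn :: "nat \<Rightarrow> 'a set" and d where "homogeneous_basis (C :: ('k::field_char_0, 'a) graded_space) (\<Union>n. Bn n) d"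
    "\<And>n. Bn n \<subseteq> Bn (Suc n)" "\<And>n. Bn n \<subseteq> conilpotent_part C \<Delta> n" "\<And>n. conilpotent_part C \<Delta> n \<subseteq> span_of C (Bn n)"
proof -
  interpret graded_coalgebra C \<Delta> by fact
  let ?N = "conilpotent_part C \<Delta>"
  have N_carrier: "?N n \<subseteq> carrier C" for n by (auto simp: conilpotent_part_def dest: grade_mem)
  have N_mono: "?N n \<subseteq> ?N (Suc n)" for n by (auto simp: conilpotent_part_def intro: le_SucI)
  let ?P = "\<lambda>n X. independent C X \<and> X \<subseteq> ?N n \<and> ?N n \<subseteq> span_of C X"
  have "\<exists>Bn. \<forall>n. ?P n (Bn n) \<and> Bn n \<subseteq> Bn (Suc n)"
  proof (rule dependent_nat_choice)
    have "independent C {}" by (simp add: independent_def)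
    from extend_independent[OF this _ N_carrier[of 0]] show "\<exists>X. ?P 0 X" by (metis empty_subsetI)
    fix X n assume X: "?P n X"
    then have "X \<subseteq> ?N (Suc n)" using N_mono by blast
    from extend_independent[OF conjunct1[OF X] this N_carrier]
    show "\<exists>Y. ?P (Suc n) Y \<and> X \<subseteq> Y" by metis
  qed
  then obtain Bn where Bn: "\<And>n. independent C (Bn n)" "\<And>n. Bn n \<subseteq> ?N n" "\<And>n. ?N n \<subseteq> span_of C (Bn n)"
    and step: "\<And>n. Bn n \<subseteq> Bn (Suc n)" by blast
  have mono: "Bn m \<subseteq> Bn n" if "m \<le> n" for m n by (rule lift_Suc_mono_le[of Bn, OF step that])
  have "subset.chain {B. independent C B} (range Bn)"
  proof -
    have "Bn m \<subseteq> Bn n \<or> Bn n \<subseteq> Bn m" for m n using mono[of m n] mono[of n m] nat_le_linear by blast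
    then show ?thesis unfolding subset_chain_def using Bn(1) by blast
  qed
  then have indep: "independent C (\<Union>n. Bn n)" by (rule independent_Union_chain)
  have "\<forall>b\<in>(\<Union>n. Bn n). \<exists>k. b \<in> grade C k" using Bn(2) by (auto simp: conilpotent_part_def dest!: subsetD)
  then obtain d where d: "\<forall>b\<in>(\<Union>n. Bn n). b \<in> grade C (d b)" by metis
  have "homogeneous_basis C (\<Union>n. Bn n) d"
  proof (rule homogeneous_basis.intro[OF graded_space_axioms homogeneous_basis_axioms.intro[OF indep]])
    show "b \<in> grade C (d b)" if "b \<in> (\<Union>n. Bn n)" for b using d that by blast
    show "grade C k \<subseteq> span_of C (\<Union>n. Bn n)" for k
    proof
      fix x assume x: "x \<in> grade C k"
      then obtain n where "iterated_coproduct C \<Delta> n x = \<zero>\<^bsub>tensor_algebra C\<^esub>"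
        using conil grade_mem[OF x] unfolding locally_conilpotent_def by blast
      then have "x \<in> ?N n" using x by (auto simp: conilpotent_part_def)
      then have "x \<in> span_of C (Bn n)" using Bn(3) by blast
      then show "x \<in> span_of C (\<Union>n. Bn n)" by (auto simp: span_of_def)
    qed
  qed
  then show thesis using that step Bn by blast
qed

theorem proposition6p5:
  fixes C :: "('k::field_char_0, 'a) graded_space"
    and \<Delta> :: "'a \<Rightarrow> ('a list \<Rightarrow>\<^sub>0 'k) set"
  assumes "graded_coalgebra C \<Delta>"
    and "cocommutative C \<Delta>"
    and "locally_conilpotent C \<Delta>"
  shows "semifree_dg_lie_algebra (cobar C \<Delta>)"
proof -
  obtain Bn d where basis: "homogeneous_basis C (\<Union>n. Bn n) d" and step: "\<And>n. Bn n \<subseteq> Bn (Suc n)"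
    and BN: "\<And>n. Bn n \<subseteq> conilpotent_part C \<Delta> n" and NB: "\<And>n. conilpotent_part C \<Delta> n \<subseteq> span_of C (Bn n)"
    by (rule adapted_basis_exists[OF assms(1,3)], rule that)
  let ?B = "\<Union>n. Bn n"
  interpret homogeneous_basis C ?B d by (rule basis)
  interpret graded_coalgebra C \<Delta> by (rule assms(1))
  interpret cocommutative_basis C \<Delta> ?B d
    by (intro cocommutative_basis.intro coalgebra_basis.intro basis assms cocommutative_basis_axioms.intro)
  have mono: "Bn m \<subseteq> Bn n" if "m \<le> n" for m n by (rule lift_Suc_mono_le[of Bn, OF step that])
  have sub: "Bn n \<subseteq> ?B" for n by blast
  let ?M = "cobar C \<Delta>"
  define S where "S n = S.sub_lie (Bn n)" for n
  define X where "X n = subspace_of ?M (S n)" for n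
  have dg: "dg_lie_algebra ?M" using dg_lie_algebra_cobar by (simp add: cobar_eq)
  have diff_cobar: "diff ?M x = \<delta> x" if "x \<in> carrier SL" for x using that by (simp add: cobar_eq cobar_diff_eq)
  (* The zeroth iterated coproduct is the inclusion into the tensor algebra, so it kills no basis element. *)
  have Bn0: "Bn 0 = {}"
  proof -
    have False if b: "b \<in> Bn 0" for b
    proof -
      have "tensor_inc C b = \<zero>\<^bsub>T\<^esub>" using b BN[of 0] by (auto simp: conilpotent_part_def)
      then have "keys (letter b :: 'a list \<Rightarrow>\<^sub>0 'k) = {}"
        using \<nu>_inc_basis[of b] b by (simp del: keys_letter) (metis UN_I UNIV_I keys_zero)
      then show False by simp
    qed
    then show ?thesis by blast
  qed
  have cop: "keys (cop b) \<subseteq> pairs (Bn n)" if "b \<in> Bn (Suc n)" for b n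
    by (rule cop_conilpotent_part[OF assms(2) sub NB]) (use that BN[of "Suc n"] in blast)+
  have S_SL: "x \<in> carrier SL" if "x \<in> S n" for x n
    using that S.L.graded_subspaceD(3)[OF S.sub_lie_graded[OF sub]] by (simp add: S_def)
  have S_mono: "S m \<subseteq> S n" if "m \<le> n" for m n unfolding S_def by (rule S.sub_lie_mono[OF mono[OF that]])
  have gen: "\<delta> (s b) \<in> S n" if "b \<in> Bn (Suc n)" for b n
    unfolding S_def by (rule \<delta>_sub_lie[OF _ cop[OF that] sub]) (use that basis_carrier in blast)
  have \<delta>_S: "\<delta> x \<in> S n" if x: "x \<in> S n" for x n
    using x unfolding S_def S.sub_lie_def
  proof (rule S.L.derivation_lie_generated[OF graded_map_\<delta>_SL leibniz_\<delta>_SL S.inc_carrier[OF sub], rotated])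
    fix g assume "g \<in> s ` Bn n"
    then obtain b where b: "g = s b" "b \<in> Bn n" by blast
    then obtain n' where n': "n = Suc n'" using Bn0 by (cases n) auto
    show "\<delta> g \<in> lie_generated SL (s ` Bn n)"
      using gen[of b n'] b n' S_mono[of n' n] by (auto simp: S_def S.sub_lie_def)
  qed
  have ext: "elementary_semifree_extension (X n) (X (Suc n)) (\<lambda>x. x)" for n
  proof -
    interpret E: adjoined_generators "suspension C" ?B "\<lambda>b. d b + 1" "Bn n" "Bn (Suc n)" "cobar_diff C \<Delta>"
    proof (rule adjoined_generators.intro[OF S.homogeneous_basis_axioms adjoined_generators_axioms.intro])
      show "cobar_diff C \<Delta> x \<in> S.sub_lie (Bn n)" if "x \<in> S.sub_lie (Bn n)" for x
        using \<delta>_S[of x n] S_SL[of x n] that by (simp add: cobar_diff_eq S_def)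
      show "cobar_diff C \<Delta> (s b) \<in> S.sub_lie (Bn n)" if b: "b \<in> Bn (Suc n)" for b
      proof -
        have "b \<in> carrier C" using b basis_carrier by blast
        then show ?thesis using gen[OF b] s_mem by (simp add: cobar_diff_eq S_def)
      qed
    qed (use step sub dg_lie_algebra_cobar in auto)
    show ?thesis using E.elementary_extension by (simp add: E.A1_def E.A2_def X_def S_def cobar_eq)
  qed
  (* A bracket involves finitely many generators, so it lies in one of the subalgebras. *)
  have union: "carrier ?M = (\<Union>n. S n)"
  proof
    show "(\<Union>n. S n) \<subseteq> carrier ?M" using S_SL by (auto simp: cobar_eq)
    have "\<exists>n. x \<in> S n" if x: "x \<in> lie_generated SL (s ` ?B)" for x
      using S.inc_carrier[OF order_refl] x
    proof (induction rule: S.L.lie_generated_induct)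
      case (generator x)
      then show ?case unfolding S_def S.sub_lie_def using lie_generated_subset[of _ SL] by blast
    next
      case zero
      then show ?case using S.L.graded_subspaceD(4)[OF S.sub_lie_graded[OF sub]] unfolding S_def by blast
    next
      case (smult c x)
      then show ?case using S.L.graded_subspaceD(6)[OF S.sub_lie_graded[OF sub]] unfolding S_def by blast
    next
      case (comp n x)
      then show ?case using S.L.graded_subspaceD(2)[OF S.sub_lie_graded[OF sub]] unfolding S_def by blast
    next
      case (add x y)
      then obtain m n where "x \<in> S m" "y \<in> S n" by blast
      then have "x \<in> S (max m n)" "y \<in> S (max m n)" using S_mono[of m "max m n"] S_mono[of n "max m n"] by auto
      then show ?case using S.L.graded_subspaceD(5)[OF S.sub_lie_graded[OF sub]] unfolding S_def by blast
    next
      case (bracket x y)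
      then obtain m n where "x \<in> S m" "y \<in> S n" by blast
      then have "x \<in> S (max m n)" "y \<in> S (max m n)" using S_mono[of m "max m n"] S_mono[of n "max m n"] by auto
      then show ?case using S.sub_lie_subalgebra[OF sub] unfolding S_def graded_lie_subalgebra_iff by blast
    qed
    then show "carrier ?M \<subseteq> (\<Union>n. S n)" using sub_lie_B by (auto simp: cobar_eq S.sub_lie_def)
  qed
  have subalg: "graded_lie_subalgebra (S n) ?M" for n
    unfolding cobar_eq subalgebra_with_diff[OF S.L.graded_lie_algebra_axioms] S_def
    by (rule S.sub_lie_subalgebra[OF sub])
  obtain \<beta> where \<beta>: "dg_lie_iso (colimit X (\<lambda>_ x. x)) ?M \<beta>"
    "\<And>n x. x \<in> S n \<Longrightarrow> \<beta> (colim_class X (\<lambda>_ x. x) n x) = x"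
    by (rule colimit_ascending_union[OF dg subalg _ S_mono union, folded X_def[abs_def]]; (rule that)?)
      (use diff_cobar[OF S_SL] \<delta>_S in auto)
  have S0: "S 0 = {\<zero>\<^bsub>SL\<^esub>}"
  proof
    have "graded_lie_subalgebra {\<zero>\<^bsub>SL\<^esub>} SL"
      unfolding graded_lie_subalgebra_iff
      by (intro conjI S.L.graded_subspaceI) (simp_all add: S.L.comp_zero S.L.bracket_zero del: SL_simps)
    then show "S 0 \<subseteq> {\<zero>\<^bsub>SL\<^esub>}" unfolding S_def S.sub_lie_def Bn0 by (intro lie_generated_least) simp_all
    show "{\<zero>\<^bsub>SL\<^esub>} \<subseteq> S 0" using S.L.graded_subspaceD(4)[OF S.sub_lie_graded[OF sub]] by (simp add: S_def)
  qed
  interpret M: dg_lie_algebra ?M by (rule dg)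
  let ?Z = "zero_dg_lie :: ('k, unit) dg_lie"
  have Z: "carrier ?Z = {()}" "grade ?Z n = {()}" for n by (simp_all add: zero_dg_lie_def)
  have zero_M: "\<zero>\<^bsub>?M\<^esub> = \<zero>\<^bsub>SL\<^esub>" by (simp add: cobar_eq del: SL_simps)
  have D0: "diff ?M \<zero>\<^bsub>?M\<^esub> = \<zero>\<^bsub>?M\<^esub>"
    by (rule linear_map_zero[OF M.module_axioms M.module_axioms graded_mapD(1)[OF M.diff_graded_map]])
  have hom: "dg_lie_hom ?Z ?M (\<lambda>_. \<zero>\<^bsub>?M\<^esub>)"
    unfolding dg_lie_hom_def by (intro conjI graded_lie_homI graded_mapI linear_mapI) (auto simp: D0)
  have S0M: "S 0 = {\<zero>\<^bsub>?M\<^esub>}" by (simp only: S0 zero_M)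
  have iso0: "dg_lie_iso ?Z (X 0) (\<lambda>_. \<zero>\<^bsub>?M\<^esub>)"
    unfolding dg_lie_iso_def graded_lie_iso_def dg_lie_hom_def
    by (intro conjI graded_lie_homI graded_mapI linear_mapI allI)
      (auto simp: S0M Z bij_betw_def X_def D0)
  have "semifree_extension ?Z ?M (\<lambda>_. \<zero>\<^bsub>?M\<^esub>)"
    unfolding semifree_extension_def
  proof (intro conjI, rule dg_lie_algebra_zero, rule dg, rule hom,
      rule exI[of _ X], rule exI[of _ "\<lambda>_ x. x"], rule exI[of _ "\<lambda>_. \<zero>\<^bsub>?M\<^esub>"], rule exI[of _ \<beta>],
      intro conjI allI ballI)
    show "\<zero>\<^bsub>?M\<^esub> = \<beta> (colim_class X (\<lambda>_ x. x) 0 \<zero>\<^bsub>?M\<^esub>)"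
      by (rule \<beta>(2)[symmetric]) (simp add: S0M)
  qed (rule ext iso0 \<beta>(1))+
  then show ?thesis by (simp add: semifree_dg_lie_algebra_def)
qed

end
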